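(* Let $\Gamma<\mathrm{SL}(2,\mathbb{R})$ be a non-cocompact lattice with a cusp at $i\infty$ whose stabilizer is $\Gamma_\infty=\Gamma\cap\left\{\begin{pmatrix} *&*\\0&*\end{pmatrix}\right\}=\left\{\pm\begin{pmatrix}1&m\\0&1\end{pmatrix}: m\in\mathbb{Z}\right\}$. For $x>0$, the double coset count $$\pi(x)=\#\left\{\Gamma_\infty\begin{pmatrix}a&*\\c&*\end{pmatrix}\Gamma_\infty\ :\ 0<c<x,\ 0\le a<c,\ \begin{pmatrix}a&*\\c&*\end{pmatrix}\in\Gamma\right\}$$ is finite, and $$\pi(x)\sim\frac{x^2}{\pi\,\mathrm{vol}(\Gamma\backslash\mathbb{H})}\qquad\text{as }x\to\infty.$$
   Context: $\mathbb{H}$ is the upper half plane and $\mathrm{vol}(\Gamma\backslash\mathbb{H})$ is the hyperbolic area of the quotient (measure $dx\,dy/y^2$). Each double coset in $\Gamma_\infty\backslash\Gamma/\Gamma_\infty$ whose elements have nonzero lower-left entry has a representative $\begin{pmatrix}a&*\\c&*\end{pmatrix}$ with $c>0$ and $0\le a<c$, and the pair $(a,c)$ is uniquely determined by the double coset and determines it. The symbol $\sim$ means that the ratio tends to $1$; on the right-hand side $\pi$ is the usual constant. *)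

theory Defs
  imports "HOL-Analysis.Analysis" "HOL-Algebra.Coset" "HOL-Library.Landau_Symbols"
begin

type_synonym mat2 = "real^2^2"

definition SL2R :: "mat2 monoid" where
  "SL2R = \<lparr>carrier = {A. det A = 1}, mult = (**), one = mat 1\<rparr>"

lemma group_SL2R: "group SL2R"
proof (rule groupI)
  fix A assume A: "A \<in> carrier SL2R"
  then have "invertible A"
    by (simp add: SL2R_def invertible_det_nz)
  then obtain B where B: "A ** B = mat 1" "B ** A = mat 1"
    unfolding invertible_def by blast
  have "det B * det A = 1"
    using B(2) by (metis det_I det_mul)
  then have "det B = 1"
    using A by (simp add: SL2R_def)
  then show "\<exists>B\<in>carrier SL2R. B \<otimes>\<^bsub>SL2R\<^esub> A = \<one>\<^bsub>SL2R\<^esub>"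
    using B(2) by (auto simp: SL2R_def)
qed (auto simp: SL2R_def det_mul matrix_mul_assoc)

definition upper_half_plane :: "complex set" where
  "upper_half_plane = {z. Im z > 0}"

definition moebius :: "mat2 \<Rightarrow> complex \<Rightarrow> complex" where
  "moebius A z = (of_real (A$1$1) * z + of_real (A$1$2)) / (of_real (A$2$1) * z + of_real (A$2$2))"

definition hyperbolic_area :: "complex measure" where
  "hyperbolic_area = density lborel (\<lambda>z. indicator upper_half_plane z * ennreal (1 / (Im z)\<^sup>2))"

definition orbit :: "mat2 set \<Rightarrow> complex \<Rightarrow> complex set" where
  "orbit \<Gamma> z = (\<lambda>A. moebius A z) ` \<Gamma>"

definition orbit_space :: "mat2 set \<Rightarrow> complex set set" where
  "orbit_space \<Gamma> = orbit \<Gamma> ` upper_half_plane"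

definition quotient_topology :: "mat2 set \<Rightarrow> complex set topology" where
  "quotient_topology \<Gamma> =
     topology (\<lambda>U. U \<subseteq> orbit_space \<Gamma> \<and> open {z \<in> upper_half_plane. orbit \<Gamma> z \<in> U})"

lemma openin_quotient_topology:
  "openin (quotient_topology \<Gamma>) U \<longleftrightarrow>
     U \<subseteq> orbit_space \<Gamma> \<and> open {z \<in> upper_half_plane. orbit \<Gamma> z \<in> U}"
proof -
  have "istopology (\<lambda>U. U \<subseteq> orbit_space \<Gamma> \<and> open {z \<in> upper_half_plane. orbit \<Gamma> z \<in> U})"
    unfolding istopology_def
  proof (intro conjI allI impI)
    fix S T
    assume S: "S \<subseteq> orbit_space \<Gamma> \<and> open {z \<in> upper_half_plane. orbit \<Gamma> z \<in> S}"
      and T: "T \<subseteq> orbit_space \<Gamma> \<and> open {z \<in> upper_half_plane. orbit \<Gamma> z \<in> T}"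
    have "{z \<in> upper_half_plane. orbit \<Gamma> z \<in> S \<inter> T} =
        {z \<in> upper_half_plane. orbit \<Gamma> z \<in> S} \<inter> {z \<in> upper_half_plane. orbit \<Gamma> z \<in> T}"
      by auto
    with S T show "open {z \<in> upper_half_plane. orbit \<Gamma> z \<in> S \<inter> T}"
      by (simp add: open_Int)
    show "S \<inter> T \<subseteq> orbit_space \<Gamma>" using S by auto
  next
    fix K
    assume K: "\<forall>U\<in>K. U \<subseteq> orbit_space \<Gamma> \<and> open {z \<in> upper_half_plane. orbit \<Gamma> z \<in> U}"
    have "{z \<in> upper_half_plane. orbit \<Gamma> z \<in> \<Union>K} =
        (\<Union>U\<in>K. {z \<in> upper_half_plane. orbit \<Gamma> z \<in> U})"
      by auto
    with K show "open {z \<in> upper_half_plane. orbit \<Gamma> z \<in> \<Union>K}"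
      by (metis (no_types, lifting) open_UN)
    show "\<Union>K \<subseteq> orbit_space \<Gamma>" using K by auto
  qed
  then show ?thesis
    unfolding quotient_topology_def by (simp add: topology_inverse')
qed

definition cocompact :: "mat2 set \<Rightarrow> bool" where
  "cocompact \<Gamma> \<longleftrightarrow> compact_space (quotient_topology \<Gamma>)"

definition fundamental_domain :: "mat2 set \<Rightarrow> complex set \<Rightarrow> bool" where
  "fundamental_domain \<Gamma> F \<longleftrightarrow>
     F \<in> sets borel \<and> F \<subseteq> upper_half_plane \<and>
     (\<forall>z\<in>upper_half_plane. \<exists>!w. w \<in> F \<inter> orbit \<Gamma> z)"

text \<open>The area of the quotient is the area of a Borel fundamental domain. For a discrete group
  such domains exist and all have the same area, so the infimum is merely a way of naming the common
  value; it is infinite for groups that have no such domain.\<close>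

definition covolume :: "mat2 set \<Rightarrow> ennreal" where
  "covolume \<Gamma> = (INF F \<in> {F. fundamental_domain \<Gamma> F}. emeasure hyperbolic_area F)"

definition lattice_SL2R :: "mat2 set \<Rightarrow> bool" where
  "lattice_SL2R \<Gamma> \<longleftrightarrow> subgroup \<Gamma> SL2R \<and> discrete \<Gamma> \<and> covolume \<Gamma> < \<infinity>"

definition stabilizer_infinity :: "mat2 set \<Rightarrow> mat2 set" where
  "stabilizer_infinity \<Gamma> = \<Gamma> \<inter> {A. A$2$1 = 0}"

text \<open>The point at infinity is a cusp if it is fixed by a parabolic element of the group.\<close>

definition cusp_at_infinity :: "mat2 set \<Rightarrow> bool" where
  "cusp_at_infinity \<Gamma> \<longleftrightarrow>
     (\<exists>A\<in>stabilizer_infinity \<Gamma>. \<bar>trace A\<bar> = 2 \<and> A \<noteq> mat 1 \<and> A \<noteq> - mat 1)"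

definition translation_matrix :: "real \<Rightarrow> mat2" where
  "translation_matrix t = vector [vector [1, t], vector [0, 1]]"

definition double_coset :: "mat2 set \<Rightarrow> mat2 \<Rightarrow> mat2 set" where
  "double_coset H A = H <#>\<^bsub>SL2R\<^esub> (A <#\<^bsub>SL2R\<^esub> H)"

definition counted_double_cosets :: "mat2 set \<Rightarrow> real \<Rightarrow> mat2 set set" where
  "counted_double_cosets \<Gamma> x =
     {double_coset (stabilizer_infinity \<Gamma>) A | A.
        A \<in> \<Gamma> \<and> 0 < A$2$1 \<and> A$2$1 < x \<and> 0 \<le> A$1$1 \<and> A$1$1 < A$2$1}"

definition double_coset_count :: "mat2 set \<Rightarrow> real \<Rightarrow> nat" where
  "double_coset_count \<Gamma> x = card (counted_double_cosets \<Gamma> x)"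

end

theory Submission
  imports Defs
begin

text \<open>
  Let \<open>n h z\<close> be the number of elements of \<open>\<Gamma>\<close> that map \<open>z\<close> into the cusp strip \<open>0 \<le> x < 1, y > h\<close>, and
  let \<open>b h = h * n h / 2\<close>, a bounded function on \<open>\<Gamma>\H\<close> of integral \<open>1\<close>. Unfolding gives, for the
  inner product on \<open>\<Gamma>\H\<close>,
  \<open>\<langle>b h, b h'\<rangle> = min h h' + \<kappa>(h h')\<close>, where \<open>\<kappa>\<close> is a sum over the double cosets that depends only on the
  product \<open>h h'\<close>. Nonnegativity of \<open>\<parallel>b h - b h'\<parallel>\<^sup>2\<close> makes \<open>t \<mapsto> \<kappa>(exp (- t))\<close> midpoint convex up to an
  exponentially small error; as it is bounded, it converges to some \<open>k\<close>. Convolution with a point-pair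
  invariant \<open>K\<close> replaces \<open>b h\<close> by an average of rescaled functions \<open>b (h / v)\<close>, so
  \<open>\<integral>\<integral> K(z, w) (b h z - b h w)\<^sup>2\<close> tends to \<open>0\<close>. Since \<open>K\<close> is positive everywhere, \<open>b h\<close> tends to a
  constant, which must be \<open>1 / vol\<close>, and therefore \<open>k = 1 / vol\<close>. The asymptotics of \<open>\<kappa>\<close> are turned into
  those of the double coset count by two elementary monotone Tauberian steps, separated by an Abel-type
  transform that removes the square root kernel.
\<close>

section \<open>Invariance of the hyperbolic area\<close>

text \<open>The usual source of the constant 1 / vol is the residue of an Eisenstein series; here it
  has to come from L2 geometry alone. Two facts make this possible. First, a horoball of height h'
  pulled back by A meets the horoball of height h in an area that depends only on c^2 h h', so all
  correlations are values of one function of one variable, and positivity of norms becomes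
  convexity. Second, the functions y and 1 have the same eigenvalue under every point-pair
  invariant, so averaging the rescaled copies against K produces the total mass of K again. Hence in
  the limit the inner product of \<open>b h\<close> with its smoothing is at least the mass of K
  times the square norm of \<open>b h\<close>, which forces the K-weighted variance to vanish. K has
  no positive lower bound on a noncompact quotient, so the weight is removed by passing to an almost
  everywhere convergent subsequence. The pi in the result comes from the Abel transform: one double
  coset contributes with a factor 2 pi, the transform of a linear function brings in the integral of
  (1 + y^2)^(-3/2), which is 2, and so k becomes k / pi.\<close>

abbreviation \<mu> :: "complex measure" where "\<mu> \<equiv> hyperbolic_area"

abbreviation weight :: "real \<Rightarrow> ennreal" where "weight y \<equiv> indicator {0<..} y * ennreal (1 / y)"

abbreviation weight2 :: "real \<Rightarrow> ennreal" where "weight2 y \<equiv> indicator {0<..} y * ennreal (1 / y\<^sup>2)"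

text \<open>Lebesgue measure is determined by its values on boxes, and a complex box is a product of
  two intervals. Through this every area computation becomes an iterated real integral.\<close>

lemma lborel_complex:
  "(lborel :: complex measure) = distr (lborel \<Otimes>\<^sub>M lborel) borel (\<lambda>(x, y). Complex x y)"
proof (rule lborel_eqI)
  fix l u :: complex
  assume le: "\<And>b. b \<in> Basis \<Longrightarrow> l \<bullet> b \<le> u \<bullet> b"
  have le1: "Re l \<le> Re u" "Im l \<le> Im u"
    using le[of 1] le[of \<i>] by (auto simp: Basis_complex_def)
  have m: "(\<lambda>(x, y). Complex x y) \<in> lborel \<Otimes>\<^sub>M lborel \<rightarrow>\<^sub>M borel"
  proof -
    have "(\<lambda>(x, y). Complex x y) = (\<lambda>p. of_real (fst p) + \<i> * of_real (snd p))"
      by (auto simp: complex_eq_iff)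
    then show ?thesis by simp
  qed
  have eq: "(\<lambda>(x, y). Complex x y) -` box l u \<inter> space (lborel \<Otimes>\<^sub>M lborel)
      = {Re l<..<Re u} \<times> {Im l<..<Im u}"
    by (auto simp: box_def Basis_complex_def space_pair_measure)
  have "emeasure (distr (lborel \<Otimes>\<^sub>M lborel) borel (\<lambda>(x, y). Complex x y)) (box l u)
      = emeasure (lborel \<Otimes>\<^sub>M lborel) ({Re l<..<Re u} \<times> {Im l<..<Im u})"
    using m by (simp add: emeasure_distr eq)
  also have "\<dots> = emeasure lborel {Re l<..<Re u} * emeasure lborel {Im l<..<Im u}"
    by (rule lborel.emeasure_pair_measure_Times) auto
  also have "\<dots> = ennreal (\<Prod>b\<in>Basis. (u - l) \<bullet> b)"
    using le1 by (simp add: Basis_complex_def ennreal_mult)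
  finally show "emeasure (distr (lborel \<Otimes>\<^sub>M lborel) borel (\<lambda>(x, y). Complex x y)) (box l u)
      = ennreal (\<Prod>b\<in>Basis. (u - l) \<bullet> b)" .
qed simp

lemma measurable_Complex[measurable (raw)]:
  assumes "f \<in> borel_measurable M" "g \<in> borel_measurable M"
  shows "(\<lambda>x. Complex (f x) (g x)) \<in> borel_measurable M"
proof -
  have "(\<lambda>x. Complex (f x) (g x)) = (\<lambda>x. of_real (f x) + \<i> * of_real (g x))"
    by (auto simp: complex_eq_iff)
  then show ?thesis using assms by simp
qed

lemma sets_upper_half_plane[measurable]: "upper_half_plane \<in> sets borel"
proof -
  have "open upper_half_plane" unfolding upper_half_plane_def by (rule open_halfspace_Im_gt)
  then show ?thesis by simp
qed

lemma sets_hyperbolic_area[measurable_cong, simp]: "sets hyperbolic_area = sets borel"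
  and space_hyperbolic_area[simp]: "space hyperbolic_area = UNIV"
  by (simp_all add: hyperbolic_area_def)

lemma nn_integral_hyperbolic_area:
  assumes [measurable]: "f \<in> borel_measurable borel"
  shows "(\<integral>\<^sup>+z. f z \<partial>\<mu>)
       = (\<integral>\<^sup>+y. \<integral>\<^sup>+x. f (Complex x y) * weight2 y \<partial>lborel \<partial>lborel)"
proof -
  have "(\<integral>\<^sup>+z. f z \<partial>\<mu>)
      = (\<integral>\<^sup>+z. (indicator upper_half_plane z * ennreal (1 / (Im z)\<^sup>2)) * f z \<partial>lborel)"
    unfolding hyperbolic_area_def by (subst nn_integral_density) auto
  also have "\<dots> = (\<integral>\<^sup>+p. (case p of (x, y) \<Rightarrow> (indicator upper_half_plane (Complex x y)
        * ennreal (1 / y\<^sup>2)) * f (Complex x y)) \<partial>(lborel \<Otimes>\<^sub>M lborel))"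
    by (subst lborel_complex, subst nn_integral_distr) (auto simp: split_beta' intro!: nn_integral_cong)
  also have "\<dots> = (\<integral>\<^sup>+y. \<integral>\<^sup>+x. (indicator upper_half_plane (Complex x y)
        * ennreal (1 / y\<^sup>2)) * f (Complex x y) \<partial>lborel \<partial>lborel)"
    by (subst lborel_pair.nn_integral_snd[symmetric]) (auto simp: split_beta')
  also have "\<dots> = (\<integral>\<^sup>+y. \<integral>\<^sup>+x. f (Complex x y) * weight2 y \<partial>lborel \<partial>lborel)"
    by (intro nn_integral_cong) (auto simp: upper_half_plane_def mult_ac split: split_indicator)
  finally show ?thesis .
qed

text \<open>\<open>dy / y\<close> is the Haar measure of the multiplicative group of positive reals,
  so \<open>ln\<close> carries it to Lebesgue measure; on intervals this says that \<open>ln\<close>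
  is an antiderivative of \<open>1 / y\<close>.\<close>

lemma nn_integral_inverse_weight_eq_exp:
  fixes g :: "real \<Rightarrow> ennreal"
  assumes [measurable]: "g \<in> borel_measurable borel"
  shows "(\<integral>\<^sup>+y. g y * weight y \<partial>lborel) = (\<integral>\<^sup>+s. g (exp s) \<partial>lborel)"
proof -
  let ?w = "\<lambda>y::real. indicator {0<..} y * ennreal (1 / y)"
  have L: "(lborel :: real measure) = distr (density lborel ?w) borel ln"
  proof (rule lborel_eqI)
    fix l u :: real assume "\<And>b. b \<in> Basis \<Longrightarrow> l \<bullet> b \<le> u \<bullet> b"
    then have lu: "l \<le> u" by simp
    have [measurable]: "ln -` box l u \<in> sets borel"
      using measurable_sets[of ln borel borel "box l u"] by simp
    have "emeasure (distr (density lborel ?w) borel ln) (box l u) =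
        (\<integral>\<^sup>+y. ?w y * indicator (ln -` box l u) y \<partial>lborel)"
      by (subst emeasure_distr) (auto simp: emeasure_density simp del: box_real)
    also have "\<dots> = (\<integral>\<^sup>+y. ennreal (1 / y) * indicator {exp l..exp u} y \<partial>lborel)"
    proof (rule nn_integral_cong_AE)
      \<comment> \<open>Dropping the two endpoints lets the open interval be replaced by the closed
        one that the fundamental theorem expects; the factor supported on positive y discards the
        values of \<open>ln\<close> elsewhere.\<close>
      have "AE y in lborel. y \<noteq> exp l \<and> y \<noteq> exp u"
        using AE_lborel_singleton[of "exp l"] AE_lborel_singleton[of "exp u"] by eventually_elim auto
      then show "AE y in lborel. ?w y * indicator (ln -` box l u) y
          = ennreal (1 / y) * indicator {exp l..exp u} y"
      proof eventually_elim
        case (elim y)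
        have "0 < y \<and> y \<in> ln -` box l u \<longleftrightarrow> y \<in> {exp l..exp u}"
          using elim by (smt (verit, best) atLeastAtMost_iff exp_gt_zero exp_less_cancel_iff exp_ln
            greaterThanLessThan_iff box_real(1) vimage_eq)
        then show ?case by (auto split: split_indicator)
      qed
    qed
    also have "\<dots> = ennreal (ln (exp u) - ln (exp l))"
    proof (rule nn_integral_FTC_Icc)
      fix x assume "x \<in> {exp l..exp u}"
      then have "x > 0" by (metis atLeastAtMost_iff exp_gt_zero less_le_trans)
      then show "(ln has_real_derivative 1 / x) (at x)" "0 \<le> 1 / x"
        by (auto intro!: derivative_eq_intros)
    qed (use lu in auto)
    finally show "emeasure (distr (density lborel ?w) borel ln) (box l u) = ennreal (\<Prod>b\<in>Basis. (u - l) \<bullet> b)"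
      by simp
  qed simp
  have "(\<integral>\<^sup>+s. g (exp s) \<partial>lborel) = (\<integral>\<^sup>+y. g (exp (ln y)) \<partial>density lborel ?w)"
    by (subst L, subst nn_integral_distr) auto
  also have "\<dots> = (\<integral>\<^sup>+y. ?w y * g (exp (ln y)) \<partial>lborel)"
    by (subst nn_integral_density) auto
  also have "\<dots> = (\<integral>\<^sup>+y. g y * ?w y \<partial>lborel)"
    by (intro nn_integral_cong) (auto split: split_indicator simp: mult.commute)
  finally show ?thesis by simp
qed

text \<open>In the coordinate s = ln y the inversion is the reflection of s into ln C - s.\<close>

lemma nn_integral_inverse_weight_invert:
  fixes g :: "real \<Rightarrow> ennreal"
  assumes [measurable]: "g \<in> borel_measurable borel" and C: "C > 0"
  shows "(\<integral>\<^sup>+y. g (C / y) * weight y \<partial>lborel)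
       = (\<integral>\<^sup>+y. g y * weight y \<partial>lborel)"
proof -
  have "(\<integral>\<^sup>+y. g (C / y) * weight y \<partial>lborel) = (\<integral>\<^sup>+s. g (C / exp s) \<partial>lborel)"
    by (rule nn_integral_inverse_weight_eq_exp) measurable
  also have "\<dots> = (\<integral>\<^sup>+s. g (exp (ln C + (-1) * s)) \<partial>lborel)"
    using C by (intro nn_integral_cong) (simp add: exp_diff)
  also have "\<dots> = (\<integral>\<^sup>+s. g (exp s) \<partial>lborel)"
    by (subst (2) nn_integral_real_affine[where c = "-1" and t = "ln C"]) auto
  also have "\<dots> = (\<integral>\<^sup>+y. g y * weight y \<partial>lborel)"
    by (rule nn_integral_inverse_weight_eq_exp[symmetric]) measurable
  finally show ?thesis .
qed

text \<open>The dilation contributes one factor a per coordinate, and the density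
  \<open>1 / y^2\<close> absorbs exactly this product.\<close>

lemma hyperbolic_area_affine:
  assumes [measurable]: "f \<in> borel_measurable borel" and a: "a > 0"
  shows "(\<integral>\<^sup>+z. f (of_real a * z + of_real b) \<partial>\<mu>) = (\<integral>\<^sup>+z. f z \<partial>\<mu>)"
proof -
  have "(\<integral>\<^sup>+z. f z \<partial>\<mu>)
     = (\<integral>\<^sup>+y. \<integral>\<^sup>+x. f (Complex x y) * weight2 y \<partial>lborel \<partial>lborel)"
    by (rule nn_integral_hyperbolic_area) measurable
  also have "\<dots> = (\<integral>\<^sup>+y. ennreal a * (\<integral>\<^sup>+x. f (Complex (b + a * x) y) * weight2 y \<partial>lborel) \<partial>lborel)"
    using a by (subst nn_integral_real_affine[where c = a and t = b]) auto
  also have "\<dots> = ennreal a * (\<integral>\<^sup>+y. ennreal a * (\<integral>\<^sup>+x. f (Complex (b + a * x) (a * y)) * (indicator {0<..} (a * y) * ennreal (1 / (a * y)\<^sup>2)) \<partial>lborel) \<partial>lborel)"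
    using a by (subst nn_integral_real_affine[where c = a and t = 0]) auto
  also have "\<dots> = (\<integral>\<^sup>+y. \<integral>\<^sup>+x. ennreal (a * a) * (f (Complex (b + a * x) (a * y)) * (indicator {0<..} (a * y) * ennreal (1 / (a * y)\<^sup>2))) \<partial>lborel \<partial>lborel)"
    using a by (simp add: nn_integral_cmult ennreal_mult mult.assoc)
  also have "\<dots> = (\<integral>\<^sup>+y. \<integral>\<^sup>+x. f (of_real a * Complex x y + of_real b) * weight2 y \<partial>lborel \<partial>lborel)"
  proof (intro nn_integral_cong)
    fix x y :: real
    have e: "of_real a * Complex x y + of_real b = Complex (b + a * x) (a * y)"
      by (simp add: complex_eq_iff)
    have "ennreal (a * a) * ennreal (1 / (a * y)\<^sup>2) = ennreal (1 / y\<^sup>2)"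
      using a by (subst ennreal_mult[symmetric]) (auto simp: power2_eq_square)
    moreover have "indicator {0<..} (a * y) = (indicator {0<..} y :: ennreal)"
      using a by (auto simp: zero_less_mult_iff split: split_indicator)
    ultimately have "ennreal (a * a) * (F * (indicator {0<..} (a * y) * ennreal (1 / (a * y)\<^sup>2)))
        = F * weight2 y" for F
      by (simp add: mult.left_commute[of "ennreal (a * a)"])
    then show "ennreal (a * a) * (f (Complex (b + a * x) (a * y)) * (indicator {0<..} (a * y) * ennreal (1 / (a * y)\<^sup>2)))
      = f (of_real a * Complex x y + of_real b) * weight2 y"
      unfolding e .
  qed
  also have "\<dots> = (\<integral>\<^sup>+z. f (of_real a * z + of_real b) \<partial>\<mu>)"
    by (rule nn_integral_hyperbolic_area[symmetric]) measurable
  finally show ?thesis by simp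
qed

text \<open>In the coordinates \<open>(Re z / Im z, Im z)\<close> the hyperbolic area is \<open>dt dy / y\<close>, and \<open>z \<mapsto> -1/z\<close> is
  a reflection in \<open>t\<close> followed, for each fixed \<open>t\<close>, by an inversion \<open>y \<mapsto> C/y\<close>.\<close>

lemma nn_integral_hyperbolic_area_slope:
  assumes [measurable]: "f \<in> borel_measurable borel"
  shows "(\<integral>\<^sup>+z. f z \<partial>\<mu>)
       = (\<integral>\<^sup>+t. \<integral>\<^sup>+y. f (Complex (t * y) y) * weight y \<partial>lborel \<partial>lborel)"
proof -
  have "(\<integral>\<^sup>+z. f z \<partial>\<mu>)
     = (\<integral>\<^sup>+y. \<integral>\<^sup>+x. f (Complex x y) * weight2 y \<partial>lborel \<partial>lborel)"
    by (rule nn_integral_hyperbolic_area) measurable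
  also have "\<dots> = (\<integral>\<^sup>+y. \<integral>\<^sup>+t. f (Complex (t * y) y) * weight y \<partial>lborel \<partial>lborel)"
  proof (rule nn_integral_cong)
    fix y :: real
    show "(\<integral>\<^sup>+x. f (Complex x y) * weight2 y \<partial>lborel)
        = (\<integral>\<^sup>+t. f (Complex (t * y) y) * weight y \<partial>lborel)"
    proof (cases "y > 0")
      case True
      have "ennreal y * ennreal (1 / y\<^sup>2) = ennreal (1 / y)"
        using True by (subst ennreal_mult[symmetric]) (auto simp: power2_eq_square)
      then have *: "ennreal y * (f (Complex (t * y) y) * ennreal (1 / y\<^sup>2)) = f (Complex (t * y) y) * ennreal (1 / y)" for t
        by (metis mult.assoc mult.commute)
      show ?thesis using True
        by (subst nn_integral_real_affine[where c = y and t = 0])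
          (auto simp: nn_integral_cmult[symmetric] mult.commute[of y] *)
    qed simp
  qed
  also have "\<dots> = (\<integral>\<^sup>+t. \<integral>\<^sup>+y. f (Complex (t * y) y) * weight y \<partial>lborel \<partial>lborel)"
    by (rule lborel_pair.Fubini') measurable
  finally show ?thesis .
qed

lemma hyperbolic_area_inversion:
  assumes [measurable]: "f \<in> borel_measurable borel"
  shows "(\<integral>\<^sup>+z. f (- 1 / z) \<partial>\<mu>) = (\<integral>\<^sup>+z. f z \<partial>\<mu>)"
proof -
  have "(\<integral>\<^sup>+z. f (- 1 / z) \<partial>\<mu>)
      = (\<integral>\<^sup>+t. \<integral>\<^sup>+y. f (- 1 / Complex (t * y) y) * weight y \<partial>lborel \<partial>lborel)"
    by (rule nn_integral_hyperbolic_area_slope) measurable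
  \<comment> \<open>With x = t y the squared modulus of z is (1 + t^2) y^2, so -1/z has slope -t and
    height C / y with C = 1 / (1 + t^2).\<close>
  also have "\<dots> = (\<integral>\<^sup>+t. \<integral>\<^sup>+y. f (Complex ((- t) * ((1 / (1 + t\<^sup>2)) / y)) ((1 / (1 + t\<^sup>2)) / y)) * weight y \<partial>lborel \<partial>lborel)"
  proof (intro nn_integral_cong)
    fix t y :: real
    have "1 + t\<^sup>2 \<noteq> 0" by (smt (verit) zero_le_power2)
    then have "- 1 / Complex (t * y) y = Complex ((- t) * ((1 / (1 + t\<^sup>2)) / y)) ((1 / (1 + t\<^sup>2)) / y)" if "y > 0"
    proof -
      have e: "(t * y)\<^sup>2 + y\<^sup>2 = (1 + t\<^sup>2) * y\<^sup>2" by (simp add: power2_eq_square algebra_simps)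
      show ?thesis using that \<open>1 + t\<^sup>2 \<noteq> 0\<close>
        by (simp add: complex_eq_iff Re_divide Im_divide e) (simp add: power2_eq_square[of y])
    qed
    then show "f (- 1 / Complex (t * y) y) * weight y =
       f (Complex ((- t) * ((1 / (1 + t\<^sup>2)) / y)) ((1 / (1 + t\<^sup>2)) / y)) * weight y"
      by (auto split: split_indicator)
  qed
  also have "\<dots> = (\<integral>\<^sup>+t. \<integral>\<^sup>+y. f (Complex ((- t) * y) y) * weight y \<partial>lborel \<partial>lborel)"
  proof (rule nn_integral_cong)
    fix t :: real
    have "1 / (1 + t\<^sup>2) > 0" by (smt (verit) zero_le_power2 zero_less_divide_1_iff)
    then show "(\<integral>\<^sup>+y. f (Complex ((- t) * ((1 / (1 + t\<^sup>2)) / y)) ((1 / (1 + t\<^sup>2)) / y)) * weight y \<partial>lborel)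
       = (\<integral>\<^sup>+y. f (Complex ((- t) * y) y) * weight y \<partial>lborel)"
      by (intro nn_integral_inverse_weight_invert[where g = "\<lambda>y. f (Complex ((- t) * y) y)"]) measurable
  qed
  also have "\<dots> = (\<integral>\<^sup>+t. \<integral>\<^sup>+y. f (Complex (t * y) y) * weight y \<partial>lborel \<partial>lborel)"
    by (subst (2) nn_integral_real_affine[where c = "-1" and t = 0]) auto
  also have "\<dots> = (\<integral>\<^sup>+z. f z \<partial>\<mu>)"
    by (rule nn_integral_hyperbolic_area_slope[symmetric]) measurable
  finally show ?thesis .
qed

section \<open>Moebius transformations and discrete groups with a cusp\<close>

lemma mat2_eq_iff:
  fixes A B :: mat2
  shows "A = B \<longleftrightarrow> A$1$1 = B$1$1 \<and> A$1$2 = B$1$2 \<and> A$2$1 = B$2$1 \<and> A$2$2 = B$2$2"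
  by (auto simp: vec_eq_iff forall_2)

lemma mat2_mult [simp]:
  fixes A B :: mat2
  shows "(A ** B) $ i $ j = A$i$1 * B$1$j + A$i$2 * B$2$j"
  by (simp add: matrix_matrix_mult_def sum_2)

lemma mat2_one [simp]:
  "(mat 1 :: mat2)$1$1 = 1" "(mat 1 :: mat2)$1$2 = 0" "(mat 1 :: mat2)$2$1 = 0" "(mat 1 :: mat2)$2$2 = 1"
  by (simp_all add: mat_def)

lemma translation_matrix_nth [simp]:
  "translation_matrix t $1$1 = 1" "translation_matrix t $1$2 = t"
  "translation_matrix t $2$1 = 0" "translation_matrix t $2$2 = 1"
  by (simp_all add: translation_matrix_def)

text \<open>The adjugate is the inverse on determinant 1. Being an explicit total function, it lets
  the simplifier compute the entries of products such as \<open>adj2 A ** B\<close>, on which all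
  separation arguments below rest.\<close>

definition adj2 :: "mat2 \<Rightarrow> mat2" where
  "adj2 A = vector [vector [A$2$2, - A$1$2], vector [- A$2$1, A$1$1]]"

lemma adj2_nth [simp]:
  "adj2 A $1$1 = A$2$2" "adj2 A $1$2 = - A$1$2" "adj2 A $2$1 = - A$2$1" "adj2 A $2$2 = A$1$1"
  by (simp_all add: adj2_def)

lemma adj2_mult: "det A = 1 \<Longrightarrow> adj2 A ** A = mat 1" "det A = 1 \<Longrightarrow> A ** adj2 A = mat 1"
  by (auto simp: mat2_eq_iff det_2 algebra_simps)

lemma adj2_adj2 [simp]: "adj2 (adj2 A) = A"
  by (simp add: mat2_eq_iff)

lemma det_adj2 [simp]: "det (adj2 A) = det A"
  by (simp add: det_2)

lemma in_upper_half_plane [simp]: "z \<in> upper_half_plane \<longleftrightarrow> Im z > 0"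
  by (simp add: upper_half_plane_def)

lemma moebius_denominator_nonzero:
  fixes A :: mat2
  assumes "det A = 1" "Im z > 0"
  shows "of_real (A$2$1) * z + of_real (A$2$2) \<noteq> 0"
proof
  assume *: "of_real (A$2$1) * z + of_real (A$2$2) = 0"
  then have "A$2$1 * Im z = 0" "A$2$1 * Re z + A$2$2 = 0"
    by (auto simp: complex_eq_iff)
  with assms show False by (auto simp: det_2)
qed

lemma Im_moebius:
  assumes "det A = 1"
  shows "Im (moebius A z) = Im z / (norm (of_real (A$2$1) * z + of_real (A$2$2)))\<^sup>2"
proof -
  have "(A$1$1 * Im z) * (A$2$1 * Re z + A$2$2) - (A$1$1 * Re z + A$1$2) * (A$2$1 * Im z)
      = Im z * (A$1$1 * A$2$2 - A$1$2 * A$2$1)"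
    by (simp add: algebra_simps)
  also have "\<dots> = Im z" using assms by (simp add: det_2)
  finally show ?thesis
    by (simp add: moebius_def Im_divide cmod_power2)
qed

lemma Im_moebius_pos: "det A = 1 \<Longrightarrow> Im z > 0 \<Longrightarrow> Im (moebius A z) > 0"
  using moebius_denominator_nonzero by (simp add: Im_moebius)

lemma moebius_mult:
  assumes "det B = 1" "Im z > 0"
  shows "moebius (A ** B) z = moebius A (moebius B z)"
proof -
  let ?u = "of_real (B$1$1) * z + of_real (B$1$2)" and ?v = "of_real (B$2$1) * z + of_real (B$2$2)"
  have v: "?v \<noteq> 0" by (rule moebius_denominator_nonzero[OF assms])
  have e0: "(a * (u / v) + b) * v = a * u + b * v" if "v \<noteq> 0" for a b u v :: complex
    using that by (simp add: field_simps)
  note e = e0[OF v]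
  have "moebius A (moebius B z) = ((of_real (A$1$1) * (?u / ?v) + of_real (A$1$2)) * ?v)
       / ((of_real (A$2$1) * (?u / ?v) + of_real (A$2$2)) * ?v)"
    unfolding moebius_def mult_divide_mult_cancel_right[OF v] ..
  also have "\<dots> = (of_real (A$1$1) * ?u + of_real (A$1$2) * ?v) / (of_real (A$2$1) * ?u + of_real (A$2$2) * ?v)"
    unfolding e ..
  also have "\<dots> = moebius (A ** B) z"
    unfolding moebius_def by (simp add: algebra_simps)
  finally show ?thesis ..
qed

lemma moebius_one [simp]: "moebius (mat 1) z = z"
  by (simp add: moebius_def)

lemma moebius_uminus [simp]: "moebius (- A) z = moebius A z"
proof -
  have "moebius (- A) z = (- (of_real (A$1$1) * z + of_real (A$1$2))) / (- (of_real (A$2$1) * z + of_real (A$2$2)))"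
    by (simp add: moebius_def)
  then show ?thesis by (simp only: minus_divide_divide moebius_def)
qed

lemma moebius_translation [simp]: "moebius (translation_matrix t) z = z + of_real t"
  by (simp add: moebius_def)

lemma moebius_adj2:
  assumes "det A = 1" "Im z > 0"
  shows "moebius (adj2 A) (moebius A z) = z" "moebius A (moebius (adj2 A) z) = z"
  using moebius_mult[of A z "adj2 A"] moebius_mult[of "adj2 A" z A] assms adj2_mult by simp_all

lemma det_translation_matrix [simp]: "det (translation_matrix t) = 1"
  by (simp add: det_2)

lemma translation_matrix_mult: "translation_matrix s ** translation_matrix t = translation_matrix (s + t)"
  by (simp add: mat2_eq_iff)

lemma translation_matrix_0 [simp]: "translation_matrix 0 = mat 1"
  by (simp add: mat2_eq_iff)

lemma measurable_moebius [measurable (raw)]: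
  assumes "f \<in> borel_measurable M"
  shows "(\<lambda>x. moebius A (f x)) \<in> borel_measurable M"
  using assms unfolding moebius_def by simp

lemma AE_upper_half_plane: "AE z in \<mu>. Im z > 0"
  unfolding hyperbolic_area_def
  by (subst AE_density) (auto intro!: AE_I2 split: split_indicator_asm)

text \<open>Bruhat decomposition: a matrix with c = 0 acts affinely, and any other as an affine map,
  followed by the inversion -1/z, followed by a translation.\<close>

lemma hyperbolic_area_moebius:
  assumes [measurable]: "f \<in> borel_measurable borel" and det: "det A = 1"
  shows "(\<integral>\<^sup>+z. f (moebius A z) \<partial>\<mu>) = (\<integral>\<^sup>+z. f z \<partial>\<mu>)"
proof (cases "A$2$1 = 0")
  case True
  let ?a = "A$1$1" and ?b = "A$1$2" and ?d = "A$2$2"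
  have ad: "?a * ?d = 1" using det True by (simp add: det_2)
  then have d: "?d \<noteq> 0" by auto
  then have "1 / ?d = ?a" using ad by (simp add: field_simps)
  then have "inverse (of_real ?d) = (of_real ?a :: complex)"
    by (metis inverse_eq_divide of_real_inverse)
  then have "moebius A z = of_real (?a\<^sup>2) * z + of_real (?a * ?b)" for z
    using True by (simp add: moebius_def divide_inverse power2_eq_square algebra_simps)
  moreover have "?a\<^sup>2 > 0" using ad by (metis mult_zero_left zero_less_power2 zero_neq_one)
  ultimately show ?thesis using hyperbolic_area_affine[of f "?a\<^sup>2" "?a * ?b"] by simp
next
  case False
  let ?a = "A$1$1" and ?b = "A$1$2" and ?c = "A$2$1" and ?d = "A$2$2"
  \<comment> \<open>Writing the denominator as c (c z + d) gives the inner affine map the positive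
    coefficient c^2 that \<open>hyperbolic_area_affine\<close> requires; the factor
    \<open>of_real 1\<close> puts the outer translation into the form of the same lemma.\<close>
  have eq: "moebius A z = of_real 1 * (- 1 / (of_real (?c\<^sup>2) * z + of_real (?c * ?d))) + of_real (?a / ?c)"
    if "Im z > 0" for z
  proof -
    let ?v = "of_real ?c * z + of_real ?d"
    have v: "?v \<noteq> 0" by (rule moebius_denominator_nonzero[OF det that])
    have "of_real (?a * ?d - ?b * ?c) = (1::complex)" using det by (simp add: det_2)
    then have det': "of_real ?a * of_real ?d - of_real ?b * of_real ?c = (1::complex)"
      by (simp only: of_real_diff of_real_mult)
    have "of_real (?c\<^sup>2) * z + of_real (?c * ?d) = of_real ?c * ?v"
      by (simp add: algebra_simps power2_eq_square)
    moreover have "(of_real ?a * z + of_real ?b) / ?v = - 1 / (of_real ?c * ?v) + of_real ?a / of_real ?c"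
    proof -
      have "- 1 / (of_real ?c * ?v) + of_real ?a / of_real ?c = (of_real ?a * ?v - 1) / (of_real ?c * ?v)"
        using False v by (simp add: diff_divide_distrib)
      also have "of_real ?a * ?v - 1 = of_real ?c * (of_real ?a * z + of_real ?b)"
        by (subst det'[symmetric]) (simp add: algebra_simps)
      also have "\<dots> / (of_real ?c * ?v) = (of_real ?a * z + of_real ?b) / ?v"
        using False by simp
      finally show ?thesis ..
    qed
    ultimately show ?thesis by (simp add: moebius_def)
  qed
  have "(\<integral>\<^sup>+z. f (moebius A z) \<partial>\<mu>)
      = (\<integral>\<^sup>+z. f (of_real 1 * (- 1 / (of_real (?c\<^sup>2) * z + of_real (?c * ?d))) + of_real (?a / ?c)) \<partial>\<mu>)"
    using AE_upper_half_plane by (intro nn_integral_cong_AE) (auto elim!: eventually_mono simp: eq)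
  also have "\<dots> = (\<integral>\<^sup>+z. f (of_real 1 * (- 1 / z) + of_real (?a / ?c)) \<partial>\<mu>)"
    using False by (intro hyperbolic_area_affine[where f = "\<lambda>z. f (of_real 1 * (- 1 / z) + of_real (?a / ?c))"]) auto
  also have "\<dots> = (\<integral>\<^sup>+z. f (of_real 1 * z + of_real (?a / ?c)) \<partial>\<mu>)"
    by (intro hyperbolic_area_inversion[where f = "\<lambda>z. f (of_real 1 * z + of_real (?a / ?c))"]) auto
  also have "\<dots> = (\<integral>\<^sup>+z. f z \<partial>\<mu>)"
    by (intro hyperbolic_area_affine) auto
  finally show ?thesis .
qed

section \<open>Consequences of discreteness: countability and a gap in the lower left
  entries\<close>

lemma dist_mat2_le:
  fixes A B :: mat2
  shows "dist A B \<le> \<bar>A$1$1 - B$1$1\<bar> + \<bar>A$1$2 - B$1$2\<bar> + (\<bar>A$2$1 - B$2$1\<bar> + \<bar>A$2$2 - B$2$2\<bar>)"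
proof -
  have "dist A B \<le> (\<Sum>i\<in>UNIV. norm ((A - B)$i))"
    unfolding dist_norm norm_vec_def by (rule L2_set_le_sum) simp
  also have "\<dots> \<le> (\<Sum>i\<in>UNIV. \<Sum>j\<in>UNIV. \<bar>(A - B)$i$j\<bar>)"
    by (intro sum_mono norm_le_l1_cart)
  finally show ?thesis by (simp add: sum_2)
qed

text \<open>Each point is isolated by a member of a countable basis, and that member determines the
  point.\<close>

lemma countable_discrete:
  fixes S :: "'a::second_countable_topology set"
  assumes "discrete S"
  shows "countable S"
proof -
  obtain B :: "'a set set" where B: "countable B" "topological_basis B"
    using ex_countable_basis by blast
  have "\<exists>U\<in>B. U \<inter> S = {x}" if "x \<in> S" for x
  proof -
    obtain T where T: "open T" "T \<inter> S = {x}"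
      using assms \<open>x \<in> S\<close> unfolding discrete_def isolated_in_def by auto
    then obtain U where "U \<in> B" "x \<in> U" "U \<subseteq> T"
      using topological_basisE[OF B(2) T(1), of x] by auto
    then show ?thesis using T that by blast
  qed
  then obtain f where f: "\<And>x. x \<in> S \<Longrightarrow> f x \<in> B \<and> f x \<inter> S = {x}" by metis
  have "inj_on f S" by (intro inj_onI) (metis f singleton_inject)
  moreover have "f ` S \<subseteq> B" using f by auto
  ultimately show ?thesis using B(1) by (metis countable_image_inj_on countable_subset)
qed

text \<open>Collects what needs no area: discreteness and the exact shape of the stabilizer, whose
  negative half also puts \<open>- mat 1\<close> into the group. The area enters with
  \<open>cusp_lattice\<close>.\<close>

locale cusp_group =
  fixes \<Gamma> :: "mat2 set"
  assumes subgroup: "subgroup \<Gamma> SL2R"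
    and discrete: "discrete \<Gamma>"
    and stabilizer: "stabilizer_infinity \<Gamma> =
           range (\<lambda>m::int. translation_matrix (of_int m)) \<union>
           range (\<lambda>m::int. - translation_matrix (of_int m))"
begin

lemma det_1: "A \<in> \<Gamma> \<Longrightarrow> det A = 1"
  using subgroup.subset[OF subgroup] by (auto simp: SL2R_def)

lemma mult_closed: "A \<in> \<Gamma> \<Longrightarrow> B \<in> \<Gamma> \<Longrightarrow> A ** B \<in> \<Gamma>"
  using subgroup.m_closed[OF subgroup] by (auto simp: SL2R_def)

lemma one_closed: "mat 1 \<in> \<Gamma>"
  using subgroup.one_closed[OF subgroup] by (auto simp: SL2R_def)

lemma adj2_closed: assumes "A \<in> \<Gamma>" shows "adj2 A \<in> \<Gamma>"
proof -
  have d: "det A = 1" using assms by (rule det_1)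
  have "inv\<^bsub>SL2R\<^esub> A = adj2 A"
    using d adj2_mult by (intro group.inv_equality[OF group_SL2R]) (auto simp: SL2R_def)
  then show ?thesis using subgroup.m_inv_closed[OF subgroup assms] by simp
qed

lemma stabilizer_iff:
  "A \<in> \<Gamma> \<and> A$2$1 = 0 \<longleftrightarrow> (\<exists>m::int. A = translation_matrix m \<or> A = - translation_matrix m)"
  using stabilizer unfolding stabilizer_infinity_def by (auto simp: set_eq_iff)

lemma translation_closed: "translation_matrix (of_int m) \<in> \<Gamma>"
  using stabilizer_iff by blast

lemma uminus_closed: assumes "A \<in> \<Gamma>" shows "- A \<in> \<Gamma>"
proof -
  have "- mat 1 \<in> \<Gamma>"
    using stabilizer_iff[of "- mat 1"] by (metis of_int_0 translation_matrix_0)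
  then have "(- mat 1) ** A \<in> \<Gamma>" using assms by (rule mult_closed)
  moreover have "(- mat 1) ** A = - A" by (simp add: mat2_eq_iff)
  ultimately show ?thesis by simp
qed

lemma countable_group: "countable \<Gamma>"
  using discrete by (rule countable_discrete)

text \<open>A weak form of Shimizu's lemma. If c were tiny, then after a left translation making |a|
  at most |c|, the conjugate of the unit translation by A would be a nontrivial group element
  arbitrarily close to the identity.\<close>

lemma lower_left_lower_bound:
  obtains c0 where "0 < c0" "c0 \<le> 1" "\<And>A. A \<in> \<Gamma> \<Longrightarrow> A$2$1 \<noteq> 0 \<Longrightarrow> c0 \<le> \<bar>A$2$1\<bar>"
proof -
  have "mat 1 isolated_in \<Gamma>" using discrete one_closed by (rule discreteD)
  then obtain e where e: "e > 0" "\<And>B. B \<in> \<Gamma> \<Longrightarrow> dist (mat 1) B < e \<Longrightarrow> B = mat 1"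
    unfolding isolated_in_dist_Ex_iff by blast
  \<comment> \<open>Each of the four entries of the conjugate will differ from the identity by at
    most c^2, which is at most |c|, so a bound of e / 5 keeps the total distance below e.\<close>
  have "min 1 (e / 5) \<le> \<bar>A$2$1\<bar>" if A: "A \<in> \<Gamma>" "A$2$1 \<noteq> 0" for A
  proof (rule ccontr)
    assume "\<not> ?thesis"
    then have c: "\<bar>A$2$1\<bar> < 1" "\<bar>A$2$1\<bar> < e / 5" by auto
    define m where "m = \<lfloor>A$1$1 / A$2$1\<rfloor>"
    define A' where "A' = translation_matrix (of_int (- m)) ** A"
    define c where "c = A$2$1"
    define a where "a = A$1$1 - of_int m * c"
    have A': "A' \<in> \<Gamma>" "A'$1$1 = a" "A'$2$1 = c"
      unfolding A'_def a_def c_def using A translation_closed[of "- m"] by (auto intro!: mult_closed)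
    have "a = c * (A$1$1 / c - of_int m)" using A by (simp add: a_def c_def algebra_simps)
    moreover have "\<bar>A$1$1 / c - of_int m\<bar> \<le> 1" unfolding m_def c_def by linarith
    ultimately have ac: "\<bar>a\<bar> \<le> \<bar>c\<bar>" by (simp add: abs_mult mult_left_le)
    \<comment> \<open>The conjugate has rows (1 - a c, a^2) and (- c^2, 1 + a c): only the first
      column of \<open>A'\<close> enters, and that is the column the translation has made
      small.\<close>
    define B where "B = A' ** (translation_matrix (of_int 1) ** adj2 A')"
    have B: "B \<in> \<Gamma>" unfolding B_def by (intro mult_closed translation_closed adj2_closed A')
    have det: "A'$1$1 * A'$2$2 - A'$1$2 * A'$2$1 = 1" using det_1[OF A'(1)] by (simp add: det_2)
    have B1: "B$1$1 = 1 - a * c" "B$1$2 = a * a" "B$2$1 = - c * c" "B$2$2 = 1 + a * c"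
      using det unfolding B_def A'(2,3)[symmetric] by (auto simp: algebra_simps)
    have b1: "\<bar>a * c\<bar> \<le> \<bar>c\<bar> * \<bar>c\<bar>" "\<bar>a * a\<bar> \<le> \<bar>c\<bar> * \<bar>c\<bar>"
      using ac by (simp_all add: abs_mult mult_mono mult_right_mono del: abs_mult_self_eq)
    have b2: "\<bar>c\<bar> * \<bar>c\<bar> \<le> \<bar>c\<bar>" using c by (intro mult_left_le) (auto simp: c_def)
    have b3: "\<bar>c * c\<bar> = \<bar>c\<bar> * \<bar>c\<bar>" by (simp add: abs_mult)
    have "dist (mat 1) B \<le> \<bar>a * c\<bar> + \<bar>a * a\<bar> + (\<bar>c * c\<bar> + \<bar>a * c\<bar>)"
      using dist_mat2_le[of "mat 1" B] B1 by simp
    also have "\<dots> < e" using b1 b2 b3 c unfolding c_def by linarith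
    finally have "B = mat 1" using e B by blast
    then have "B$2$1 = 0" by simp
    then show False using A B1 by (simp add: c_def)
  qed
  then show thesis using that[of "min 1 (e / 5)"] e(1) by auto
qed

end

section \<open>Orbit counts in the cusp strip\<close>

context cusp_group
begin

text \<open>Sums over the group are integrals for the counting measure with values in
  \<open>ennreal\<close>. As the group is countable, they can be exchanged with area integrals with
  no condition beyond measurability.\<close>

abbreviation gsum :: "(mat2 \<Rightarrow> ennreal) \<Rightarrow> ennreal" where
  "gsum f \<equiv> (\<integral>\<^sup>+A. f A \<partial>count_space \<Gamma>)"

lemma measurable_gsum [measurable (raw)]:
  assumes "\<And>A. A \<in> \<Gamma> \<Longrightarrow> (\<lambda>x. f A x) \<in> borel_measurable M"
  shows "(\<lambda>x. gsum (\<lambda>A. f A x)) \<in> borel_measurable M"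
proof -
  interpret sigma_finite_measure "count_space \<Gamma>"
    by (rule sigma_finite_measure_count_space_countable[OF countable_group])
  have m: "(\<lambda>(A, x). f A x) \<in> borel_measurable (count_space \<Gamma> \<Otimes>\<^sub>M M)"
    using assms by (intro measurable_pair_measure_countable1[OF countable_group]) auto
  have "(\<lambda>(x, A). f A x) \<in> borel_measurable (M \<Otimes>\<^sub>M count_space \<Gamma>)"
    using measurable_compose[OF measurable_pair_swap' m] by (simp add: case_prod_beta)
  then show ?thesis by (rule borel_measurable_nn_integral)
qed

lemma nn_integral_gsum:
  assumes "\<And>A. A \<in> \<Gamma> \<Longrightarrow> (\<lambda>x. f A x) \<in> borel_measurable M"
  shows "(\<integral>\<^sup>+x. gsum (\<lambda>A. f A x) \<partial>M) = gsum (\<lambda>A. \<integral>\<^sup>+x. f A x \<partial>M)"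
  using assms by (intro nn_integral_count_space_nn_integral countable_group) auto

lemma gsum_adj2: "gsum (\<lambda>A. f (adj2 A)) = gsum f"
  by (rule nn_integral_bij_count_space, rule bij_betw_byWitness[where f' = adj2])
     (auto intro: adj2_closed)

lemma gsum_mult_right:
  assumes B: "B \<in> \<Gamma>"
  shows "gsum (\<lambda>A. f (A ** B)) = gsum f"
proof (rule nn_integral_bij_count_space, rule bij_betw_byWitness[where f' = "\<lambda>A. A ** adj2 B"])
  have d: "det B = 1" using B by (rule det_1)
  show "\<forall>A\<in>\<Gamma>. A ** B ** adj2 B = A" "\<forall>A\<in>\<Gamma>. A ** adj2 B ** B = A"
    by (simp_all add: matrix_mul_assoc[symmetric] adj2_mult[OF d])
qed (auto intro: mult_closed adj2_closed B)

text \<open>Two equations pin a fixed point down. The imaginary part of a z + b = z (c z + d) gives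
  Re z, and invariance of the height, that is |c z + d| = 1, gives Im z. If c were 0, the first
  equation would force A to be plus or minus the identity.\<close>

lemma fixed_points_finite:
  assumes A: "A \<in> \<Gamma>" "A \<noteq> mat 1" "A \<noteq> - mat 1"
  shows "finite {z. Im z > 0 \<and> moebius A z = z}"
proof (rule finite_subset)
  let ?a = "A$1$1" and ?b = "A$1$2" and ?c = "A$2$1" and ?d = "A$2$2"
  have det: "det A = 1" using A det_1 by blast
  show "{z. Im z > 0 \<and> moebius A z = z} \<subseteq> {Complex ((?a - ?d) / (2 * ?c)) (sqrt (1 - (?c * ((?a - ?d) / (2 * ?c)) + ?d)\<^sup>2) / \<bar>?c\<bar>)}"
  proof
    fix z assume "z \<in> {z. Im z > 0 \<and> moebius A z = z}"
    then have z: "Im z > 0" "moebius A z = z" by auto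
    let ?v = "of_real ?c * z + of_real ?d"
    have v: "?v \<noteq> 0" by (rule moebius_denominator_nonzero[OF det z(1)])
    have "of_real ?a * z + of_real ?b = z * ?v"
      using z(2) v unfolding moebius_def by (simp add: divide_eq_eq)
    then have re: "?a * Re z + ?b = Re z * (?c * Re z + ?d) - Im z * (?c * Im z)"
      and im: "?a * Im z = Im z * (?c * Re z + ?d) + Re z * (?c * Im z)"
      by (simp_all add: complex_eq_iff algebra_simps)
    have "Im z * (2 * ?c * Re z + ?d - ?a) = 0" using im by (simp add: algebra_simps)
    then have x: "2 * ?c * Re z = ?a - ?d" using z by simp
    have c: "?c \<noteq> 0"
    proof
      assume c0: "?c = 0"
      then have "?a = ?d" using x by simp
      moreover from this have "?b = 0" using re c0 by simp
      moreover have "?a * ?a = 1" using det c0 \<open>?a = ?d\<close> by (simp add: det_2)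
      then have "?a = 1 \<or> ?a = -1" by (metis square_eq_1_iff power2_eq_square)
      ultimately have "A = mat 1 \<or> A = - mat 1" using c0 by (auto simp: mat2_eq_iff)
      then show False using A by blast
    qed
    have xr: "Re z = (?a - ?d) / (2 * ?c)" using x c by (simp add: field_simps)
    have "Im z = Im z / (norm ?v)\<^sup>2" using Im_moebius[OF det, of z] z(2) by simp
    then have "(norm ?v)\<^sup>2 = 1" using z(1) v by (simp add: field_simps)
    then have n: "(?c * Re z + ?d)\<^sup>2 + (?c * Im z)\<^sup>2 = 1" by (simp add: cmod_power2)
    then have "sqrt (1 - (?c * Re z + ?d)\<^sup>2) = \<bar>?c\<bar> * Im z"
      using z(1) by (intro real_sqrt_unique) (auto simp: power_mult_distrib)
    then have "Im z = sqrt (1 - (?c * Re z + ?d)\<^sup>2) / \<bar>?c\<bar>" using c by simp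
    then show "z \<in> {Complex ((?a - ?d) / (2 * ?c)) (sqrt (1 - (?c * ((?a - ?d) / (2 * ?c)) + ?d)\<^sup>2) / \<bar>?c\<bar>)}"
      unfolding xr[symmetric] by (simp add: complex_eq_iff)
  qed
qed simp

text \<open>Almost every point thus has stabilizer {1, -1}, which is what makes the multiplicity in
  the unfolding exactly 2.\<close>

lemma AE_not_fixed:
  "AE z in \<mu>. \<forall>A\<in>\<Gamma> - {mat 1, - mat 1}. \<not> (Im z > 0 \<and> moebius A z = z)"
proof (rule AE_ball_countable')
  fix A assume A: "A \<in> \<Gamma> - {mat 1, - mat 1}"
  have "finite {z. Im z > 0 \<and> moebius A z = z}" using A by (intro fixed_points_finite) auto
  then have "{z. Im z > 0 \<and> moebius A z = z} \<in> null_sets lborel"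
    by (rule finite_imp_null_set_lborel)
  then have "AE z in lborel. z \<notin> {z. Im z > 0 \<and> moebius A z = z}" by (rule AE_not_in)
  then show "AE z in \<mu>. \<not> (Im z > 0 \<and> moebius A z = z)"
    unfolding hyperbolic_area_def
    by (subst AE_density) (auto elim!: eventually_mono)
qed (use countable_group in auto)

definition stripe :: "real \<Rightarrow> complex set" where
  "stripe h = {z. 0 \<le> Re z \<and> Re z < 1 \<and> h < Im z}"

text \<open>Twice the incomplete Eisenstein series of the indicator of heights above h: the
  half-open strip selects one element from each coset of the translations, and A and -A are both
  counted.\<close>

definition orbits :: "real \<Rightarrow> complex \<Rightarrow> ennreal" where
  "orbits h z = gsum (\<lambda>A. indicator (stripe h) (moebius A z))"

lemma in_stripe [simp]: "z \<in> stripe h \<longleftrightarrow> 0 \<le> Re z \<and> Re z < 1 \<and> h < Im z"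
  by (simp add: stripe_def)

text \<open>Measurability is needed jointly in the height and the point, because smoothing replaces
  h by \<open>h / Im w\<close> with w an integration variable. The strip condition on the height is
  therefore written as a half plane of pairs.\<close>

lemma measurable_orbits [measurable (raw)]:
  assumes [measurable]: "g \<in> borel_measurable M" "f \<in> borel_measurable M"
  shows "(\<lambda>x. orbits (g x) (f x)) \<in> borel_measurable M"
proof -
  have "(\<lambda>x. orbits (g x) (f x)) = (\<lambda>x. gsum (\<lambda>A.
      indicator {x. 0 \<le> Re x} (moebius A (f x)) * indicator {x. Re x < 1} (moebius A (f x))
      * indicator {p. fst p < snd p} (g x, Im (moebius A (f x)))))"
    unfolding orbits_def by (intro ext nn_integral_cong) (auto split: split_indicator)
  also have "\<dots> \<in> borel_measurable M" by measurable
  finally show ?thesis .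
qed

lemma stripe_measurable [measurable]: "stripe h \<in> sets borel"
  unfolding stripe_def by measurable

lemma orbits_invariant:
  assumes "B \<in> \<Gamma>" "Im z > 0"
  shows "orbits h (moebius B z) = orbits h z"
proof -
  have "orbits h (moebius B z) = gsum (\<lambda>A. indicator (stripe h) (moebius (A ** B) z))"
    unfolding orbits_def using moebius_mult[OF det_1[OF assms(1)] assms(2)] by simp
  also have "\<dots> = orbits h z"
    unfolding orbits_def using assms(1) by (rule gsum_mult_right)
  finally show ?thesis .
qed

text \<open>The strip \<open>0 \<le> Re z < 1\<close> may be sheared along horocycles without changing the count, because
  every coset of the translations contains exactly one element in each of the two strips.\<close>

lemma gsum_sheared_stripe:
  fixes \<theta> :: "real \<Rightarrow> real"
  assumes z: "Im z > 0"
  shows "gsum (\<lambda>A. indicator (stripe h) (moebius A z + of_real (\<theta> (Im (moebius A z))))) = orbits h z"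
proof -
  define w where "w A = moebius A z" for A
  define S where "S = {A \<in> \<Gamma>. w A \<in> stripe h}"
  define S' where "S' = {A \<in> \<Gamma>. w A + of_real (\<theta> (Im (w A))) \<in> stripe h}"
  define T where "T k A = translation_matrix (of_int k) ** A" for k :: int and A :: mat2
  have T: "T k A \<in> \<Gamma>" "w (T k A) = w A + of_int k" if "A \<in> \<Gamma>" for k A
    using that z translation_closed det_1[OF that] unfolding T_def w_def
    by (auto intro: mult_closed simp: moebius_mult)
  have TT: "T j (T k A) = T (j + k) A" for j k A
    unfolding T_def by (simp add: matrix_mul_assoc translation_matrix_mult)
  have T0: "T 0 A = A" for A by (simp add: T_def)
  \<comment> \<open>The shear depends on the height only, which translations preserve. So the
    translation that brings an element into one strip is undone by the one that brings it back into
    the other.\<close>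
  have bij: "bij_betw (\<lambda>A. T (- \<lfloor>Re (w A) + \<theta> (Im (w A))\<rfloor>) A) S S'"
  proof (rule bij_betw_byWitness[where f' = "\<lambda>A. T (- \<lfloor>Re (w A)\<rfloor>) A"])
    show "\<forall>A\<in>S. T (- \<lfloor>Re (w (T (- \<lfloor>Re (w A) + \<theta> (Im (w A))\<rfloor>) A))\<rfloor>) (T (- \<lfloor>Re (w A) + \<theta> (Im (w A))\<rfloor>) A) = A"
    proof
      fix A assume A: "A \<in> S"
      then have "\<lfloor>Re (w A)\<rfloor> = 0" "A \<in> \<Gamma>" by (auto simp: S_def floor_eq_iff)
      then show "T (- \<lfloor>Re (w (T (- \<lfloor>Re (w A) + \<theta> (Im (w A))\<rfloor>) A))\<rfloor>) (T (- \<lfloor>Re (w A) + \<theta> (Im (w A))\<rfloor>) A) = A"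
        by (simp add: T TT T0 floor_diff_of_int)
    qed
    show "\<forall>A\<in>S'. T (- \<lfloor>Re (w (T (- \<lfloor>Re (w A)\<rfloor>) A)) + \<theta> (Im (w (T (- \<lfloor>Re (w A)\<rfloor>) A)))\<rfloor>) (T (- \<lfloor>Re (w A)\<rfloor>) A) = A"
    proof
      fix A assume A: "A \<in> S'"
      then have "\<lfloor>Re (w A) + \<theta> (Im (w A))\<rfloor> = 0" "A \<in> \<Gamma>" by (auto simp: S'_def floor_eq_iff)
      moreover have "\<lfloor>Re (w A) - of_int \<lfloor>Re (w A)\<rfloor> + \<theta> (Im (w A))\<rfloor> = \<lfloor>Re (w A) + \<theta> (Im (w A))\<rfloor> - \<lfloor>Re (w A)\<rfloor>"
        by linarith
      ultimately show "T (- \<lfloor>Re (w (T (- \<lfloor>Re (w A)\<rfloor>) A)) + \<theta> (Im (w (T (- \<lfloor>Re (w A)\<rfloor>) A)))\<rfloor>) (T (- \<lfloor>Re (w A)\<rfloor>) A) = A"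
        by (simp add: T TT T0)
    qed
    show "(\<lambda>A. T (- \<lfloor>Re (w A) + \<theta> (Im (w A))\<rfloor>) A) ` S \<subseteq> S'"
      by (auto simp: S_def S'_def T) linarith+
    show "(\<lambda>A. T (- \<lfloor>Re (w A)\<rfloor>) A) ` S' \<subseteq> S"
      by (auto simp: S_def S'_def T) linarith+
  qed
  have "gsum (\<lambda>A. indicator (stripe h) (moebius A z + of_real (\<theta> (Im (moebius A z)))))
      = gsum (\<lambda>A. indicator S' A)"
    by (intro nn_integral_cong) (auto simp: S'_def w_def split: split_indicator)
  also have "\<dots> = emeasure (count_space \<Gamma>) S'"
    by (intro nn_integral_indicator) (auto simp: S'_def)
  also have "\<dots> = emeasure (count_space \<Gamma>) S"
  proof -
    have "S \<subseteq> \<Gamma>" "S' \<subseteq> \<Gamma>" by (auto simp: S_def S'_def)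
    then show ?thesis using bij_betw_same_card[OF bij] bij_betw_finite[OF bij]
      by (simp add: emeasure_count_space)
  qed
  also have "\<dots> = gsum (\<lambda>A. indicator S A)"
    by (intro nn_integral_indicator[symmetric]) (auto simp: S_def)
  also have "\<dots> = orbits h z"
    unfolding orbits_def by (intro nn_integral_cong) (auto simp: S_def w_def split: split_indicator)
  finally show ?thesis .
qed

text \<open>An element that lifts z above h has |c z + d|^2 < Im z / h. Two such vectors with nearly
  equal argument span a small area, so the quotient of the two matrices has lower left entry below
  c0, lies in the stabilizer, and is trivial by the strip condition. Counting angular sectors then
  bounds the number of elements by a multiple of 1 / h.\<close>

lemma orbits_bounded:
  obtains C :: real where "C > 0" "\<And>h z. 0 < h \<Longrightarrow> h \<le> 1 \<Longrightarrow> Im z > 0 \<Longrightarrow> ennreal h * orbits h z \<le> ennreal C"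
proof -
  obtain c0 where c0: "0 < c0" "c0 \<le> 1" "\<And>A. A \<in> \<Gamma> \<Longrightarrow> A$2$1 \<noteq> 0 \<Longrightarrow> c0 \<le> \<bar>A$2$1\<bar>"
    using lower_left_lower_bound by blast
  have "ennreal h * orbits h z \<le> ennreal (2 * pi / c0 + 3)" if h: "0 < h" "h \<le> 1" and z: "Im z > 0" for h z
  proof -
    define S where "S = {A \<in> \<Gamma>. moebius A z \<in> stripe h}"
    define u where "u A = of_real (A$2$1) * z + of_real (A$2$2)" for A :: mat2
    \<comment> \<open>The sector width is chosen so that the area (Im z / h) * \<delta> equals Im z
      * c0, the smallest value allowed for a nonzero lower left entry.\<close>
    define \<delta> where "\<delta> = c0 * h"
    have \<delta>: "0 < \<delta>" "\<delta> \<le> 1" using c0 h by (auto simp: \<delta>_def mult_le_one)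
    define bin where "bin A = \<lfloor>Arg (u A) / \<delta>\<rfloor>" for A
    have same: "A = B" if A: "A \<in> S" and B: "B \<in> S" and bin: "bin A = bin B" for A B
    proof -
      have AB: "A \<in> \<Gamma>" "B \<in> \<Gamma>" "det A = 1" "det B = 1" using A B det_1 by (auto simp: S_def)
      have nz: "u A \<noteq> 0" "u B \<noteq> 0"
        unfolding u_def using moebius_denominator_nonzero z AB by auto
      have arg: "\<bar>Arg (u B) - Arg (u A)\<bar> < \<delta>"
      proof -
        have "\<bar>Arg (u B) / \<delta> - Arg (u A) / \<delta>\<bar> < 1"
          using bin unfolding bin_def by linarith
        then show ?thesis using \<delta> by (simp add: diff_divide_distrib[symmetric] abs_divide)
      qed
      have norm_lt: "(norm (u A))\<^sup>2 < Im z / h" "(norm (u B))\<^sup>2 < Im z / h"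
      proof -
        have "h < Im z / (norm (u A))\<^sup>2" "h < Im z / (norm (u B))\<^sup>2"
          using A B AB by (auto simp: S_def Im_moebius u_def)
        then show "(norm (u A))\<^sup>2 < Im z / h" "(norm (u B))\<^sup>2 < Im z / h"
          using nz h by (auto simp: field_simps)
      qed
      let ?C = "B ** adj2 A"
      have C: "?C \<in> \<Gamma>" using AB by (intro mult_closed adj2_closed)
      \<comment> \<open>The lower left entry of \<open>B ** adj2 A\<close> is the determinant of the
        two bottom rows, and multiplying it by Im z gives the area form of the vectors
        \<open>u A\<close> and \<open>u B\<close>.\<close>
      have "Im (u B * cnj (u A)) = Im z * ?C$2$1"
        unfolding u_def by (simp add: algebra_simps)
      moreover have "Im (u B * cnj (u A)) = norm (u A) * norm (u B) * sin (Arg (u B) - Arg (u A))"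
      proof -
        have "u A = rcis (norm (u A)) (Arg (u A))" "u B = rcis (norm (u B)) (Arg (u B))"
          by (simp_all add: rcis_cmod_Arg)
        then have "u B * cnj (u A) = rcis (norm (u B)) (Arg (u B)) * cnj (rcis (norm (u A)) (Arg (u A)))"
          by simp
        then show ?thesis by (simp add: rcis_def sin_diff algebra_simps)
      qed
      ultimately have im: "Im z * ?C$2$1 = norm (u A) * norm (u B) * sin (Arg (u B) - Arg (u A))" by simp
      have "?C$2$1 = 0"
      proof (rule ccontr)
        assume "?C$2$1 \<noteq> 0"
        then have "c0 \<le> \<bar>?C$2$1\<bar>" using c0 C by blast
        then have "Im z * c0 \<le> \<bar>Im z * ?C$2$1\<bar>" using z by (simp add: abs_mult)
        also have "\<dots> = norm (u A) * norm (u B) * \<bar>sin (Arg (u B) - Arg (u A))\<bar>"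
          unfolding im by (simp add: abs_mult)
        also have "\<dots> \<le> norm (u A) * norm (u B) * \<bar>Arg (u B) - Arg (u A)\<bar>"
          by (intro mult_left_mono abs_sin_x_le_abs_x) auto
        also have "\<dots> \<le> norm (u A) * norm (u B) * \<delta>"
          using arg by (intro mult_left_mono) auto
        also have "\<dots> < Im z / h * \<delta>"
        proof -
          have "0 \<le> (norm (u A) - norm (u B))\<^sup>2" by simp
          then have "norm (u A) * norm (u B) < Im z / h"
            using norm_lt by (simp add: power2_diff)
          then show ?thesis using \<delta> by (intro mult_strict_right_mono) auto
        qed
        also have "\<dots> = Im z * c0" using h by (simp add: \<delta>_def)
        finally show False by simp
      qed
      then obtain m :: int where m: "?C = translation_matrix m \<or> ?C = - translation_matrix m"
        using stabilizer_iff C by blast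
      have BC: "B = ?C ** A" using adj2_mult(1)[OF AB(3)] by (simp add: matrix_mul_assoc[symmetric])
      have "moebius B z = moebius A z + of_real m"
        by (subst BC) (use m AB z in \<open>auto simp: moebius_mult\<close>)
      moreover have "0 \<le> Re (moebius A z)" "Re (moebius A z) < 1" "0 \<le> Re (moebius B z)" "Re (moebius B z) < 1"
        using A B by (auto simp: S_def)
      ultimately have "m = 0" by auto
      then have "B = A \<or> B = - A" using m by (subst (1 2) BC) (auto simp: mat2_eq_iff)
      \<comment> \<open>Opposite vectors have arguments a full pi apart, whereas arguments in one
        bin differ by less than \<delta>, which is at most 1.\<close>
      moreover have "B \<noteq> - A"
      proof
        assume "B = - A"
        then have uu: "u B = - u A" by (simp add: u_def)
        have "\<bar>Arg (u B) - Arg (u A)\<bar> = pi"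
          unfolding uu using nz by (simp add: Arg_minus)
        then show False using arg \<delta> pi_gt3 by linarith
      qed
      ultimately show ?thesis by blast
    qed
    have inj: "inj_on bin S" using same by (auto intro: inj_onI)
    have rng: "bin ` S \<subseteq> {\<lfloor>- pi / \<delta>\<rfloor>..\<lfloor>pi / \<delta>\<rfloor>}"
    proof
      fix k assume "k \<in> bin ` S"
      then obtain A where k: "k = \<lfloor>Arg (u A) / \<delta>\<rfloor>" by (auto simp: bin_def)
      have "- pi \<le> Arg (u A)" "Arg (u A) \<le> pi" using Arg_bounded[of "u A"] by auto
      then show "k \<in> {\<lfloor>- pi / \<delta>\<rfloor>..\<lfloor>pi / \<delta>\<rfloor>}"
        unfolding k using \<delta> divide_right_mono[of "- pi" "Arg (u A)" \<delta>] divide_right_mono[of "Arg (u A)" pi \<delta>]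
        by (auto intro!: floor_mono)
    qed
    then have fin: "finite S" using inj by (metis finite_atLeastAtMost_int finite_subset inj_on_finite)
    have "card S \<le> card {\<lfloor>- pi / \<delta>\<rfloor>..\<lfloor>pi / \<delta>\<rfloor>}"
      by (rule card_inj_on_le[OF inj rng]) simp
    also have "\<dots> = nat (\<lfloor>pi / \<delta>\<rfloor> - \<lfloor>- pi / \<delta>\<rfloor> + 1)" by simp
    finally have "real (card S) \<le> real (nat (\<lfloor>pi / \<delta>\<rfloor> - \<lfloor>- pi / \<delta>\<rfloor> + 1))" by simp
    also have "\<dots> \<le> 2 * (pi / \<delta>) + 3"
    proof -
      have "0 \<le> pi / \<delta>" using \<delta> by simp
      then show ?thesis by linarith
    qed
    finally have "h * real (card S) \<le> h * (2 * (pi / \<delta>) + 3)" using h by simp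
    also have "\<dots> \<le> 2 * pi / c0 + 3" using h c0 by (simp add: \<delta>_def field_simps)
    finally have *: "h * real (card S) \<le> 2 * pi / c0 + 3" .
    have "orbits h z = gsum (\<lambda>A. indicator S A)"
      unfolding orbits_def by (intro nn_integral_cong) (auto simp: S_def split: split_indicator)
    also have "\<dots> = emeasure (count_space \<Gamma>) S"
      by (intro nn_integral_indicator) (auto simp: S_def)
    also have "\<dots> = ennreal (real (card S))"
      using fin by (subst emeasure_count_space_finite) (auto simp: S_def ennreal_of_nat_eq_real_of_nat)
    finally show ?thesis using * h
      by (simp add: ennreal_mult[symmetric] ennreal_leI del: ennreal_le_iff ennreal_le_iff2)
  qed
  moreover have "0 < 2 * pi / c0 + 3" using c0 pi_gt_zero by (intro add_pos_pos divide_pos_pos) auto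
  ultimately show thesis using that by blast
qed

end

section \<open>Unfolding and a point-pair invariant\<close>

interpretation hyperbolic_area: sigma_finite_measure hyperbolic_area
  unfolding hyperbolic_area_def
  by (subst sigma_finite_measure.sigma_finite_iff_density_finite[OF lborel.sigma_finite_measure_axioms])
     (auto simp: ennreal_mult_eq_top_iff split: split_indicator)

lemma nn_integral_even:
  fixes f :: "real \<Rightarrow> ennreal"
  assumes [measurable]: "f \<in> borel_measurable borel" and even: "\<And>x. f (- x) = f x"
  shows "(\<integral>\<^sup>+x. f x \<partial>lborel) = 2 * (\<integral>\<^sup>+x. f x * indicator {0..} x \<partial>lborel)"
proof -
  have "(\<integral>\<^sup>+x. f x \<partial>lborel) = (\<integral>\<^sup>+x. f x * indicator {0..} x + f x * indicator {..<0} x \<partial>lborel)"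
    by (intro nn_integral_cong) (auto split: split_indicator)
  also have "\<dots> = (\<integral>\<^sup>+x. f x * indicator {0..} x \<partial>lborel) + (\<integral>\<^sup>+x. f x * indicator {..<0} x \<partial>lborel)"
    by (rule nn_integral_add) auto
  also have "(\<integral>\<^sup>+x. f x * indicator {..<0} x \<partial>lborel) = (\<integral>\<^sup>+x. f x * indicator {0<..} x \<partial>lborel)"
    by (subst nn_integral_real_affine[where c = "-1" and t = 0])
       (auto simp: even intro!: nn_integral_cong split: split_indicator)
  also have "\<dots> = (\<integral>\<^sup>+x. f x * indicator {0..} x \<partial>lborel)"
    using AE_lborel_singleton[of 0]
    by (intro nn_integral_cong_AE) (auto elim!: eventually_mono split: split_indicator)
  finally show ?thesis by (simp add: mult_2)
qed

lemma nn_integral_inverse_1_plus_square: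
  "(\<integral>\<^sup>+x. ennreal (1 / (1 + x\<^sup>2)) \<partial>lborel) = ennreal pi"
proof -
  have p: "0 < 1 + x\<^sup>2" for x :: real by (smt (verit) zero_le_power2)
  have "(\<integral>\<^sup>+x. ennreal (1 / (1 + x\<^sup>2)) * indicator {0..} x \<partial>lborel) = ennreal (pi / 2 - arctan 0)"
  proof (rule nn_integral_FTC_atLeast)
    show "(arctan has_real_derivative 1 / (1 + x\<^sup>2)) (at x)" for x
      by (auto intro!: derivative_eq_intros simp: inverse_eq_divide)
    show "(arctan \<longlongrightarrow> pi / 2) at_top" by (rule tendsto_arctan_at_top)
  qed (use p in \<open>auto simp: less_imp_le\<close>)
  then show ?thesis
    by (subst nn_integral_even) (auto simp: ennreal_mult'[symmetric] simp flip: ennreal_numeral)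
qed

text \<open>Equals 1 / (16 cosh^4 (d/2)) for the hyperbolic distance d of z and w. It is positive
  everywhere, and this power decays fast enough to be integrable over the plane, where areas grow
  like exp d.\<close>

definition ker :: "complex \<Rightarrow> complex \<Rightarrow> real" where
  "ker z w = (Im z * Im w)\<^sup>2 / norm (z - cnj w) ^ 4"

lemma ker_nonneg [simp]: "0 \<le> ker z w"
  by (simp add: ker_def)

lemma ker_pos: assumes "Im z > 0" "Im w > 0" shows "0 < ker z w"
proof -
  have "z - cnj w \<noteq> 0" using assms by (auto simp: complex_eq_iff)
  then show ?thesis using assms by (simp add: ker_def)
qed

lemma ker_sym: "ker z w = ker w z"
proof -
  have "norm (z - cnj w) = norm (cnj (w - cnj z))"
    by (simp add: norm_minus_commute)
  then show ?thesis by (simp only: complex_mod_cnj ker_def mult.commute)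
qed

text \<open>The map divides \<open>z - cnj w\<close> by (c z + d) (c cnj w + d). The moduli of these
  two factors cancel against those in the two heights.\<close>

lemma ker_moebius:
  assumes det: "det A = 1" and z: "Im z > 0" and w: "Im w > 0"
  shows "ker (moebius A z) (moebius A w) = ker z w"
proof -
  let ?a = "of_real (A$1$1) :: complex" and ?b = "of_real (A$1$2) :: complex"
    and ?c = "of_real (A$2$1) :: complex" and ?d = "of_real (A$2$2) :: complex"
  let ?p = "?c * z + ?d" and ?q = "?c * w + ?d"
  have p: "?p \<noteq> 0" and q: "?q \<noteq> 0" using moebius_denominator_nonzero[OF det] z w by auto
  have cq: "?c * cnj w + ?d \<noteq> 0"
  proof
    assume "?c * cnj w + ?d = 0"
    then have "cnj ?q = 0" by simp
    then show False using q by (simp only: complex_cnj_zero_iff)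
  qed
  have "?a * ?d - ?b * ?c = of_real (A$1$1 * A$2$2 - A$1$2 * A$2$1)" by simp
  also have "\<dots> = 1" using det by (simp add: det_2)
  finally have det': "?a * ?d - ?b * ?c = 1" .
  have "moebius A z - cnj (moebius A w) = ((?a * z + ?b) * (?c * cnj w + ?d) - (?a * cnj w + ?b) * ?p) / (?p * (?c * cnj w + ?d))"
    unfolding moebius_def using p cq by (simp add: diff_frac_eq)
  also have "(?a * z + ?b) * (?c * cnj w + ?d) - (?a * cnj w + ?b) * ?p = (?a * ?d - ?b * ?c) * (z - cnj w)"
    by (simp add: algebra_simps)
  finally have "norm (moebius A z - cnj (moebius A w)) = norm (z - cnj w) / (norm ?p * norm (cnj ?q))"
    unfolding det' by (simp add: norm_divide norm_mult)
  then have "norm (moebius A z - cnj (moebius A w)) = norm (z - cnj w) / (norm ?p * norm ?q)"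
    by (simp only: complex_mod_cnj)
  moreover have "norm ?p > 0" "norm ?q > 0" using p q by auto
  moreover have "norm (z - cnj w) > 0" using z w by (auto simp: complex_eq_iff)
  moreover have "(x / P\<^sup>2 * (y / Q\<^sup>2))\<^sup>2 / (n / (P * Q)) ^ 4 = (x * y)\<^sup>2 / n ^ 4"
    if "P > 0" "Q > 0" "n > 0" for x y P Q n :: real
    using that by (simp add: field_simps power2_eq_square power4_eq_xxxx)
  ultimately show ?thesis
    unfolding ker_def Im_moebius[OF det] by presburger
qed

lemma ker_affine:
  assumes "y > 0"
  shows "ker (Complex x y) (of_real y * w + of_real x) = ker \<i> w"
proof -
  have "Complex x y - cnj (of_real y * w + of_real x) = of_real y * (\<i> - cnj w)"
    by (simp add: complex_eq_iff algebra_simps)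
  then have n: "norm (Complex x y - cnj (of_real y * w + of_real x)) = y * norm (\<i> - cnj w)"
    using assms by (simp add: norm_mult)
  show ?thesis unfolding ker_def n using assms by (simp add: power2_eq_square power4_eq_xxxx)
qed

lemma measurable_ker [measurable (raw)]:
  assumes [measurable]: "f \<in> borel_measurable M" "g \<in> borel_measurable M"
  shows "(\<lambda>x. ker (f x) (g x)) \<in> borel_measurable M"
proof -
  have "(\<lambda>x. cnj (g x)) = (\<lambda>x. Complex (Re (g x)) (- Im (g x)))"
    by (auto simp: complex_eq_iff)
  also have "\<dots> \<in> borel_measurable M" by measurable
  finally show ?thesis unfolding ker_def by measurable
qed

definition ker_mass :: ennreal where
  "ker_mass = (\<integral>\<^sup>+w. ker \<i> w \<partial>\<mu>)"

lemma ker_mass_finite: "ker_mass < \<infinity>"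
proof -
  have "ker_mass = (\<integral>\<^sup>+y. \<integral>\<^sup>+x. ennreal (ker \<i> (Complex x y)) * weight2 y \<partial>lborel \<partial>lborel)"
    unfolding ker_mass_def by (rule nn_integral_hyperbolic_area) measurable
  \<comment> \<open>The squared height in the numerator cancels the area weight, and x^2 + (1 + y)^2
    dominates both 1 + x^2 and 1 + y^2; a product of two Cauchy densities remains.\<close>
  also have "\<dots> \<le> (\<integral>\<^sup>+y. \<integral>\<^sup>+x. ennreal (1 / (1 + x\<^sup>2)) * ennreal (1 / (1 + y\<^sup>2)) \<partial>lborel \<partial>lborel)"
  proof (intro nn_integral_mono)
    fix x y :: real
    show "ennreal (ker \<i> (Complex x y)) * weight2 y \<le> ennreal (1 / (1 + x\<^sup>2)) * ennreal (1 / (1 + y\<^sup>2))"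
    proof (cases "y > 0")
      case True
      have n: "norm (\<i> - cnj (Complex x y)) ^ 4 = (x\<^sup>2 + (1 + y)\<^sup>2)\<^sup>2"
      proof -
        have "norm (\<i> - cnj (Complex x y)) ^ 4 = ((norm (\<i> - cnj (Complex x y)))\<^sup>2)\<^sup>2" by simp
        then show ?thesis by (simp only: cmod_power2) simp
      qed
      have a: "1 + x\<^sup>2 \<le> x\<^sup>2 + (1 + y)\<^sup>2" "1 + y\<^sup>2 \<le> x\<^sup>2 + (1 + y)\<^sup>2"
        using True by (simp_all add: power2_sum)
      have p: "0 < 1 + x\<^sup>2" "0 < 1 + y\<^sup>2" by (smt (verit) zero_le_power2)+
      have "ker \<i> (Complex x y) * (1 / y\<^sup>2) = 1 / (x\<^sup>2 + (1 + y)\<^sup>2)\<^sup>2"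
        unfolding ker_def n using True by simp
      also have "\<dots> = 1 / (x\<^sup>2 + (1 + y)\<^sup>2) * (1 / (x\<^sup>2 + (1 + y)\<^sup>2))" by (simp add: power2_eq_square)
      also have "\<dots> \<le> 1 / (1 + x\<^sup>2) * (1 / (1 + y\<^sup>2))"
        using a p by (intro mult_mono divide_left_mono mult_pos_pos) auto
      finally show ?thesis using True
        by (simp add: ennreal_mult[symmetric])
    qed simp
  qed
  also have "\<dots> = ennreal pi * ennreal pi"
    by (simp add: nn_integral_cmult nn_integral_multc nn_integral_inverse_1_plus_square)
  also have "\<dots> < \<infinity>" by (simp add: ennreal_mult[symmetric])
  finally show ?thesis .
qed

lemma ker_total_mass:
  assumes z: "Im z > 0"
  shows "(\<integral>\<^sup>+w. ker z w \<partial>\<mu>) = ker_mass"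
proof -
  have "(\<integral>\<^sup>+w. ker z w \<partial>\<mu>) = (\<integral>\<^sup>+w. ker z (of_real (Im z) * w + of_real (Re z)) \<partial>\<mu>)"
    using z by (intro hyperbolic_area_affine[symmetric]) auto
  also have "\<dots> = ker_mass"
    unfolding ker_mass_def using ker_affine[OF z, of "Re z"] by simp
  finally show ?thesis .
qed

text \<open>The fundamental domain is a parameter, so that the final asymptotics can be instantiated
  for two domains and shown to give them the same area.\<close>

locale cusp_lattice = cusp_group +
  fixes F :: "complex set"
  assumes fundamental: "fundamental_domain \<Gamma> F"
    and finite_area: "emeasure hyperbolic_area F < \<infinity>"
begin

text \<open>The quotient is modelled by restricting the area to F through a density, so that
  invariant functions stay functions on all complex numbers.\<close>

definition quot :: "complex measure" where
  "quot = density hyperbolic_area (indicator F)"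

lemma F_measurable [measurable]: "F \<in> sets borel" and F_upper: "z \<in> F \<Longrightarrow> Im z > 0"
  using fundamental by (auto simp: fundamental_domain_def)

lemma sets_quot [measurable_cong, simp]: "sets quot = sets borel"
  and space_quot [simp]: "space quot = UNIV"
  by (simp_all add: quot_def)

lemma emeasure_quot: "emeasure quot UNIV = emeasure hyperbolic_area F"
  by (simp add: quot_def emeasure_density)

sublocale quot: finite_measure quot
  using finite_area by (intro finite_measureI) (simp add: emeasure_quot)

lemma nn_integral_quot:
  assumes "f \<in> borel_measurable borel"
  shows "(\<integral>\<^sup>+z. f z \<partial>quot) = (\<integral>\<^sup>+z. indicator F z * f z \<partial>\<mu>)"
  unfolding quot_def using assms by (intro nn_integral_density) (auto simp: hyperbolic_area_def)

lemma AE_quot: "AE z in quot. Im z > 0"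
  unfolding quot_def
  by (subst AE_density) (auto simp: hyperbolic_area_def F_upper intro!: AE_I2 split: split_indicator_asm)

text \<open>F contains one point of the orbit. If \<open>A0\<close> reaches it, then any other A
  that does so differs from \<open>A0\<close> by an element fixing z, hence by a sign off a null
  set.\<close>

lemma gsum_fundamental:
  "AE z in \<mu>. gsum (\<lambda>A. indicator F (moebius A z)) = 2"
  using AE_not_fixed AE_upper_half_plane
proof eventually_elim
  case (elim z)
  then have z: "Im z > 0" and nofix: "\<And>A. A \<in> \<Gamma> \<Longrightarrow> moebius A z = z \<Longrightarrow> A = mat 1 \<or> A = - mat 1"
    by auto
  obtain w where w: "w \<in> F" "w \<in> orbit \<Gamma> z" and uniq: "\<And>w'. w' \<in> F \<Longrightarrow> w' \<in> orbit \<Gamma> z \<Longrightarrow> w' = w"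
  proof -
    have "\<exists>!w. w \<in> F \<inter> orbit \<Gamma> z"
      using fundamental z unfolding fundamental_domain_def by simp
    then show thesis using that by blast
  qed
  obtain A0 where A0: "A0 \<in> \<Gamma>" "w = moebius A0 z" using w by (auto simp: orbit_def)
  have d0: "det A0 = 1" using A0 det_1 by blast
  have iff: "moebius A z \<in> F \<longleftrightarrow> A \<in> {A0, - A0}" if A: "A \<in> \<Gamma>" for A
  proof
    assume "moebius A z \<in> F"
    then have "moebius A z = w" using uniq A by (auto simp: orbit_def)
    then have "moebius (adj2 A0 ** A) z = z"
      using A0 d0 z det_1[OF A] by (simp add: moebius_mult moebius_adj2)
    then have "adj2 A0 ** A = mat 1 \<or> adj2 A0 ** A = - mat 1"
      using nofix mult_closed[OF adj2_closed[OF A0(1)] A] by blast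
    moreover have "A = A0 ** (adj2 A0 ** A)" using adj2_mult(2)[OF d0] by (simp add: matrix_mul_assoc)
    moreover have "A0 ** (- mat 1) = - A0" by (simp add: mat2_eq_iff)
    ultimately show "A \<in> {A0, - A0}" by (metis insertCI matrix_mul_rid)
  qed (use w A0 in auto)
  have "A0 \<noteq> - A0"
  proof
    assume "A0 = - A0"
    then have "A0$1$1 = 0" "A0$1$2 = 0" by (auto simp: mat2_eq_iff)
    then show False using d0 by (simp add: det_2)
  qed
  have "gsum (\<lambda>A. indicator F (moebius A z)) = gsum (\<lambda>A. indicator {A0, - A0} A)"
    using iff by (intro nn_integral_cong) (simp split: split_indicator)
  also have "\<dots> = emeasure (count_space \<Gamma>) {A0, - A0}"
    using A0 uminus_closed by (intro nn_integral_indicator) auto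
  also have "\<dots> = 2"
    using A0 uminus_closed \<open>A0 \<noteq> - A0\<close> by (subst emeasure_count_space_finite) auto
  finally show ?case .
qed

text \<open>Invariance of the area moves A from the argument of H to the indicator of F, and the
  resulting translates of F cover almost every point twice.\<close>

lemma unfold_gsum:
  fixes H :: "complex \<Rightarrow> ennreal"
  assumes [measurable]: "H \<in> borel_measurable borel"
  shows "(\<integral>\<^sup>+z. gsum (\<lambda>A. H (moebius A z)) \<partial>quot) = 2 * (\<integral>\<^sup>+z. H z \<partial>\<mu>)"
proof -
  have "(\<integral>\<^sup>+z. gsum (\<lambda>A. H (moebius A z)) \<partial>quot) = (\<integral>\<^sup>+z. indicator F z * gsum (\<lambda>A. H (moebius A z)) \<partial>\<mu>)"
    by (rule nn_integral_quot) measurable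
  also have "\<dots> = (\<integral>\<^sup>+z. gsum (\<lambda>A. indicator F z * H (moebius A z)) \<partial>\<mu>)"
    by (simp add: nn_integral_cmult)
  also have "\<dots> = gsum (\<lambda>A. \<integral>\<^sup>+z. indicator F z * H (moebius A z) \<partial>\<mu>)"
    by (rule nn_integral_gsum) measurable
  also have "\<dots> = gsum (\<lambda>A. \<integral>\<^sup>+z. indicator F (moebius (adj2 A) z) * H z \<partial>\<mu>)"
  proof (rule nn_integral_cong)
    fix A assume "A \<in> space (count_space \<Gamma>)"
    then have det: "det A = 1" using det_1 by auto
    have "(\<integral>\<^sup>+z. indicator F z * H (moebius A z) \<partial>\<mu>)
       = (\<integral>\<^sup>+z. indicator F (moebius (adj2 A) (moebius A z)) * H (moebius A z) \<partial>\<mu>)"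
      using AE_upper_half_plane
      by (intro nn_integral_cong_AE) (auto elim!: eventually_mono simp: moebius_adj2[OF det])
    also have "\<dots> = (\<integral>\<^sup>+z. indicator F (moebius (adj2 A) z) * H z \<partial>\<mu>)"
      by (rule hyperbolic_area_moebius[OF _ det]) measurable
    finally show "(\<integral>\<^sup>+z. indicator F z * H (moebius A z) \<partial>\<mu>) =
      (\<integral>\<^sup>+z. indicator F (moebius (adj2 A) z) * H z \<partial>\<mu>)" .
  qed
  also have "\<dots> = gsum (\<lambda>A. \<integral>\<^sup>+z. indicator F (moebius A z) * H z \<partial>\<mu>)"
    by (rule gsum_adj2)
  also have "\<dots> = (\<integral>\<^sup>+z. gsum (\<lambda>A. indicator F (moebius A z) * H z) \<partial>\<mu>)"
    by (rule nn_integral_gsum[symmetric]) measurable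
  also have "\<dots> = (\<integral>\<^sup>+z. gsum (\<lambda>A. indicator F (moebius A z)) * H z \<partial>\<mu>)"
    by (simp add: nn_integral_multc)
  also have "\<dots> = (\<integral>\<^sup>+z. 2 * H z \<partial>\<mu>)"
    using gsum_fundamental by (intro nn_integral_cong_AE) (auto elim!: eventually_mono)
  also have "\<dots> = 2 * (\<integral>\<^sup>+z. H z \<partial>\<mu>)"
    by (rule nn_integral_cmult) measurable
  finally show ?thesis .
qed

text \<open>Rankin-Selberg unfolding: an invariant factor may be evaluated at
  \<open>moebius A z\<close> and so be taken inside the group sum.\<close>

lemma integral_orbits_mult:
  fixes \<phi> :: "complex \<Rightarrow> ennreal"
  assumes [measurable]: "\<phi> \<in> borel_measurable borel"
    and inv: "\<And>A z. A \<in> \<Gamma> \<Longrightarrow> Im z > 0 \<Longrightarrow> \<phi> (moebius A z) = \<phi> z"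
  shows "(\<integral>\<^sup>+z. orbits h z * \<phi> z \<partial>quot) = 2 * (\<integral>\<^sup>+z. indicator (stripe h) z * \<phi> z \<partial>\<mu>)"
proof -
  have "(\<integral>\<^sup>+z. orbits h z * \<phi> z \<partial>quot) = (\<integral>\<^sup>+z. gsum (\<lambda>A. indicator (stripe h) (moebius A z) * \<phi> (moebius A z)) \<partial>quot)"
    using AE_quot
  proof (intro nn_integral_cong_AE, eventually_elim)
    case (elim z)
    have "gsum (\<lambda>A. indicator (stripe h) (moebius A z) * \<phi> (moebius A z)) = gsum (\<lambda>A. indicator (stripe h) (moebius A z) * \<phi> z)"
      using elim by (intro nn_integral_cong) (auto simp: inv)
    also have "\<dots> = orbits h z * \<phi> z" unfolding orbits_def by (rule nn_integral_multc) simp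
    finally show ?case ..
  qed
  also have "\<dots> = 2 * (\<integral>\<^sup>+z. indicator (stripe h) z * \<phi> z \<partial>\<mu>)"
    by (rule unfold_gsum) measurable
  finally show ?thesis .
qed

lemma area_stripe:
  assumes h: "h > 0"
  shows "(\<integral>\<^sup>+z. indicator (stripe h) z \<partial>\<mu>) = ennreal (1 / h)"
proof -
  have "(\<integral>\<^sup>+z. indicator (stripe h) z \<partial>\<mu>)
    = (\<integral>\<^sup>+y. \<integral>\<^sup>+x. indicator (stripe h) (Complex x y) * weight2 y \<partial>lborel \<partial>lborel)"
    by (rule nn_integral_hyperbolic_area) measurable
  also have "\<dots> = (\<integral>\<^sup>+y. \<integral>\<^sup>+x. indicator {0..<1::real} x * (indicator {h<..} y * ennreal (1 / y\<^sup>2)) \<partial>lborel \<partial>lborel)"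
    using h by (intro nn_integral_cong) (auto split: split_indicator)
  also have "\<dots> = (\<integral>\<^sup>+y. indicator {h<..} y * ennreal (1 / y\<^sup>2) \<partial>lborel)"
    by (simp add: nn_integral_multc)
  also have "\<dots> = (\<integral>\<^sup>+y. ennreal (1 / y\<^sup>2) * indicator {h..} y \<partial>lborel)"
    using AE_lborel_singleton[of h]
    by (intro nn_integral_cong_AE) (auto elim!: eventually_mono split: split_indicator)
  also have "\<dots> = ennreal (0 - (- 1 / h))"
  proof (rule nn_integral_FTC_atLeast)
    show "((\<lambda>y. - 1 / y) has_real_derivative 1 / y\<^sup>2) (at y)" if "h \<le> y" for y
      using that h by (auto intro!: derivative_eq_intros simp: power2_eq_square)
    show "((\<lambda>y. - 1 / y) \<longlongrightarrow> (0::real)) at_top"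
      by (intro tendsto_divide_0[OF tendsto_const] filterlim_at_top_imp_at_infinity filterlim_ident)
  qed auto
  finally show ?thesis by simp
qed

text \<open>This value dictates the normalisation h / 2 in \<open>ncount\<close>.\<close>

lemma integral_orbits:
  assumes h: "h > 0"
  shows "(\<integral>\<^sup>+z. orbits h z \<partial>quot) = ennreal (2 / h)"
  using integral_orbits_mult[of "\<lambda>_. 1" h] area_stripe[OF h] h
  by (simp add: ennreal_mult''[symmetric] flip: ennreal_numeral)

text \<open>For each A the affine map taking i to \<open>moebius A z\<close> moves the kernel to
  base point i. With w fixed, the strip condition then concerns y w + x, where x + i y is
  \<open>moebius A z\<close>: a rescaled height together with a horizontal shift depending on y
  only, which \<open>gsum_sheared_stripe\<close> removes.\<close>

lemma kernel_smoothing: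
  assumes z: "Im z > 0" and h: "h > 0"
  shows "(\<integral>\<^sup>+w. ennreal (ker z w) * orbits h w \<partial>\<mu>) = (\<integral>\<^sup>+w. ennreal (ker \<i> w) * orbits (h / Im w) z \<partial>\<mu>)"
proof -
  have "(\<integral>\<^sup>+w. ennreal (ker z w) * orbits h w \<partial>\<mu>)
      = (\<integral>\<^sup>+w. gsum (\<lambda>A. ennreal (ker z w) * indicator (stripe h) (moebius A w)) \<partial>\<mu>)"
    unfolding orbits_def by (simp add: nn_integral_cmult)
  also have "\<dots> = gsum (\<lambda>A. \<integral>\<^sup>+w. ennreal (ker z w) * indicator (stripe h) (moebius A w) \<partial>\<mu>)"
    by (rule nn_integral_gsum) measurable
  also have "\<dots> = gsum (\<lambda>A. \<integral>\<^sup>+w. ennreal (ker \<i> w) *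
      indicator (stripe h) (of_real (Im (moebius A z)) * w + of_real (Re (moebius A z))) \<partial>\<mu>)"
  proof (rule nn_integral_cong)
    fix A assume "A \<in> space (count_space \<Gamma>)"
    then have det: "det A = 1" using det_1 by auto
    define y where "y = Im (moebius A z)"
    define x where "x = Re (moebius A z)"
    have y: "y > 0" unfolding y_def by (rule Im_moebius_pos[OF det z])
    have "(\<integral>\<^sup>+w. ennreal (ker z w) * indicator (stripe h) (moebius A w) \<partial>\<mu>)
      = (\<integral>\<^sup>+w. ennreal (ker (moebius A z) (moebius A w)) * indicator (stripe h) (moebius A w) \<partial>\<mu>)"
      using AE_upper_half_plane
      by (intro nn_integral_cong_AE) (auto elim!: eventually_mono simp: ker_moebius[OF det z])
    also have "\<dots> = (\<integral>\<^sup>+w. ennreal (ker (moebius A z) w) * indicator (stripe h) w \<partial>\<mu>)"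
      by (rule hyperbolic_area_moebius[OF _ det]) measurable
    also have "\<dots> = (\<integral>\<^sup>+w. ennreal (ker (moebius A z) (of_real y * w + of_real x)) * indicator (stripe h) (of_real y * w + of_real x) \<partial>\<mu>)"
      using y by (intro hyperbolic_area_affine[symmetric]) measurable
    also have "moebius A z = Complex x y" by (simp add: x_def y_def)
    finally show "(\<integral>\<^sup>+w. ennreal (ker z w) * indicator (stripe h) (moebius A w) \<partial>\<mu>)
      = (\<integral>\<^sup>+w. ennreal (ker \<i> w) * indicator (stripe h) (of_real y * w + of_real x) \<partial>\<mu>)"
      using ker_affine[OF y] by simp
  qed
  also have "\<dots> = (\<integral>\<^sup>+w. gsum (\<lambda>A. ennreal (ker \<i> w) *
      indicator (stripe h) (of_real (Im (moebius A z)) * w + of_real (Re (moebius A z)))) \<partial>\<mu>)"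
    by (rule nn_integral_gsum[symmetric]) measurable
  also have "\<dots> = (\<integral>\<^sup>+w. ennreal (ker \<i> w) * orbits (h / Im w) z \<partial>\<mu>)"
    using AE_upper_half_plane
  proof (intro nn_integral_cong_AE, eventually_elim)
    case (elim w)
    \<comment> \<open>The real part of y w + x is x + y Re w, so the shear function is
      multiplication of the height by Re w; the height condition y Im w > h becomes y > h / Im
      w.\<close>
    have "gsum (\<lambda>A. indicator (stripe h) (of_real (Im (moebius A z)) * w + of_real (Re (moebius A z))))
      = gsum (\<lambda>A. indicator (stripe (h / Im w)) (moebius A z + of_real (Re w * Im (moebius A z))))"
      using elim by (intro nn_integral_cong) (auto simp: field_simps split: split_indicator)
    also have "\<dots> = orbits (h / Im w) z"
      by (rule gsum_sheared_stripe[OF z])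
    finally show ?case by (simp add: nn_integral_cmult)
  qed
  finally show ?thesis .
qed

text \<open>Convolution with the kernel is self-adjoint on the quotient and multiplies constants by
  \<open>ker_mass\<close>. The inner integral is folded to the quotient, the order is exchanged, and
  the group sum is unfolded again in the other variable.\<close>

lemma ker_symmetry:
  fixes \<phi> :: "complex \<Rightarrow> ennreal"
  assumes [measurable]: "\<phi> \<in> borel_measurable borel"
    and inv: "\<And>A z. A \<in> \<Gamma> \<Longrightarrow> Im z > 0 \<Longrightarrow> \<phi> (moebius A z) = \<phi> z"
  shows "(\<integral>\<^sup>+z. \<integral>\<^sup>+w. ker z w * \<phi> w \<partial>\<mu> \<partial>quot) = ker_mass * (\<integral>\<^sup>+z. \<phi> z \<partial>quot)"
proof -
  have "2 * (\<integral>\<^sup>+z. \<integral>\<^sup>+w. ker z w * \<phi> w \<partial>\<mu> \<partial>quot)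
     = (\<integral>\<^sup>+z. 2 * (\<integral>\<^sup>+w. ker z w * \<phi> w \<partial>\<mu>) \<partial>quot)"
    by (rule nn_integral_cmult[symmetric]) measurable
  also have "\<dots> = (\<integral>\<^sup>+z. \<integral>\<^sup>+w. gsum (\<lambda>A. ker z (moebius A w) * \<phi> (moebius A w)) \<partial>quot \<partial>quot)"
    by (subst unfold_gsum) auto
  also have "\<dots> = (\<integral>\<^sup>+w. \<integral>\<^sup>+z. gsum (\<lambda>A. ker z (moebius A w) * \<phi> (moebius A w)) \<partial>quot \<partial>quot)"
    by (rule pair_sigma_finite.Fubini') (auto simp: pair_sigma_finite_def quot.sigma_finite_measure_axioms)
  also have "\<dots> = (\<integral>\<^sup>+w. \<phi> w * (2 * ker_mass) \<partial>quot)"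
    using AE_quot
  proof (intro nn_integral_cong_AE, eventually_elim)
    case (elim w)
    have "(\<integral>\<^sup>+z. gsum (\<lambda>A. ker z (moebius A w) * \<phi> (moebius A w)) \<partial>quot)
      = (\<integral>\<^sup>+z. \<phi> w * gsum (\<lambda>A. ker w (moebius A z)) \<partial>quot)"
      using AE_quot
    proof (intro nn_integral_cong_AE, eventually_elim)
      case (elim z)
      have "gsum (\<lambda>A. ker z (moebius A w) * \<phi> (moebius A w)) = gsum (\<lambda>A. ker w (moebius (adj2 A) z) * \<phi> w)"
      proof (rule nn_integral_cong)
        fix A assume "A \<in> space (count_space \<Gamma>)"
        then have A: "A \<in> \<Gamma>" and det: "det A = 1" using det_1 by auto
        have "ker z (moebius A w) = ker (moebius A (moebius (adj2 A) z)) (moebius A w)"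
          using moebius_adj2(2)[OF det \<open>Im z > 0\<close>] by simp
        also have "\<dots> = ker (moebius (adj2 A) z) w"
          using \<open>Im w > 0\<close> elim det by (intro ker_moebius Im_moebius_pos) auto
        finally show "ennreal (ker z (moebius A w)) * \<phi> (moebius A w) = ennreal (ker w (moebius (adj2 A) z)) * \<phi> w"
          using inv[OF A \<open>Im w > 0\<close>] by (simp add: ker_sym)
      qed
      also have "\<dots> = gsum (\<lambda>A. ker w (moebius A z) * \<phi> w)" by (rule gsum_adj2)
      also have "\<dots> = \<phi> w * gsum (\<lambda>A. ker w (moebius A z))"
        by (subst nn_integral_multc) (simp_all add: mult.commute)
      finally show ?case .
    qed
    also have "\<dots> = \<phi> w * (\<integral>\<^sup>+z. gsum (\<lambda>A. ker w (moebius A z)) \<partial>quot)"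
      by (rule nn_integral_cmult) measurable
    also have "\<dots> = \<phi> w * (2 * ker_mass)"
      by (subst unfold_gsum) (auto simp: ker_total_mass[OF \<open>Im w > 0\<close>])
    finally show ?case .
  qed
  also have "\<dots> = 2 * (ker_mass * (\<integral>\<^sup>+z. \<phi> z \<partial>quot))"
    by (subst nn_integral_multc) (auto simp: mult_ac)
  finally show ?thesis
    by (simp add: ennreal_mult_cancel_left)
qed

text \<open>The functions y and 1 are both killed by the Laplacian, so the kernel has the same
  eigenvalue on them. The proof avoids the integral itself: the smoothing of \<open>orbits 1\<close>
  is integrated over the quotient in two ways, and \<open>orbits (1 / Im w)\<close> has integral 2
  Im w.\<close>

lemma ker_mass_Im: "(\<integral>\<^sup>+w. ker \<i> w * Im w \<partial>\<mu>) = ker_mass"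
proof -
  have "ker_mass * ennreal 2 = ker_mass * (\<integral>\<^sup>+z. orbits 1 z \<partial>quot)" using integral_orbits[of 1] by simp
  also have "\<dots> = (\<integral>\<^sup>+z. \<integral>\<^sup>+w. ker z w * orbits 1 w \<partial>\<mu> \<partial>quot)"
    by (rule ker_symmetry[symmetric]) (auto intro: orbits_invariant)
  also have "\<dots> = (\<integral>\<^sup>+z. \<integral>\<^sup>+w. ker \<i> w * orbits (1 / Im w) z \<partial>\<mu> \<partial>quot)"
    using AE_quot by (intro nn_integral_cong_AE) (auto elim!: eventually_mono simp: kernel_smoothing)
  also have "\<dots> = (\<integral>\<^sup>+w. \<integral>\<^sup>+z. ker \<i> w * orbits (1 / Im w) z \<partial>quot \<partial>\<mu>)"
    by (rule pair_sigma_finite.Fubini') (auto simp: pair_sigma_finite_def quot.sigma_finite_measure_axioms hyperbolic_area.sigma_finite_measure_axioms)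
  also have "\<dots> = (\<integral>\<^sup>+w. ker \<i> w * Im w * ennreal 2 \<partial>\<mu>)"
    using AE_upper_half_plane
  proof (intro nn_integral_cong_AE, eventually_elim)
    case (elim w)
    have "(\<integral>\<^sup>+z. ker \<i> w * orbits (1 / Im w) z \<partial>quot) = ker \<i> w * (\<integral>\<^sup>+z. orbits (1 / Im w) z \<partial>quot)"
      by (rule nn_integral_cmult) measurable
    also have "\<dots> = ker \<i> w * Im w * ennreal 2"
      using elim by (subst integral_orbits) (auto simp: ennreal_mult''[symmetric] mult_ac simp del: ennreal_numeral)
    finally show ?case .
  qed
  also have "\<dots> = (\<integral>\<^sup>+w. ker \<i> w * Im w \<partial>\<mu>) * ennreal 2"
    by (subst nn_integral_multc) (auto simp: ennreal_mult'')
  finally show ?thesis by (simp add: mult.commute[of _ 2] ennreal_mult_cancel_left)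
qed

end

section \<open>Double cosets and the correlation of orbit counts\<close>

lemma nn_integral_count_space_Times:
  assumes "countable S" "countable T"
  shows "(\<integral>\<^sup>+p. f p \<partial>count_space (S \<times> T)) = (\<integral>\<^sup>+x. \<integral>\<^sup>+y. f (x, y) \<partial>count_space T \<partial>count_space S)"
proof -
  interpret sigma_finite_measure "count_space T"
    by (rule sigma_finite_measure_count_space_countable) fact
  show ?thesis
    unfolding pair_measure_countable[OF assms, symmetric]
    by (rule nn_integral_fst[symmetric]) (simp add: pair_measure_countable[OF assms])
qed

lemma nn_integral_int_translates:
  "(\<integral>\<^sup>+m. indicator {0..<1::real} (x + of_int m) \<partial>count_space UNIV) = (1::ennreal)"
  "(\<integral>\<^sup>+m. indicator {0..<1::real} (x - of_int m) \<partial>count_space UNIV) = (1::ennreal)"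
proof -
  have "x + of_int m \<in> {0..<1} \<longleftrightarrow> m = - \<lfloor>x\<rfloor>" "x - of_int m \<in> {0..<1} \<longleftrightarrow> m = \<lfloor>x\<rfloor>" for m :: int
    by (simp; linarith)+
  then have "(indicator {0..<1::real} (x + of_int m) :: ennreal) = indicator {- \<lfloor>x\<rfloor>} m"
    "(indicator {0..<1::real} (x - of_int m) :: ennreal) = indicator {\<lfloor>x\<rfloor>} m" for m :: int
    by (simp_all add: indicator_def del: atLeastLessThan_iff)
  then show "(\<integral>\<^sup>+m. indicator {0..<1::real} (x + of_int m) \<partial>count_space UNIV) = (1::ennreal)"
    "(\<integral>\<^sup>+m. indicator {0..<1::real} (x - of_int m) \<partial>count_space UNIV) = (1::ennreal)"
    by (simp_all add: emeasure_count_space_finite)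
qed

text \<open>A disc of diameter D tangent to the real axis is cut at height y in a chord of Euclidean
  length y * chord (D / y); the maximum with 0 covers heights above the disc.\<close>

definition chord :: "real \<Rightarrow> real" where
  "chord w = 2 * sqrt (max 0 (w - 1))"

lemma chord_nonneg [simp]: "0 \<le> chord w"
  by (simp add: chord_def)

lemma measurable_chord [measurable]: "chord \<in> borel_measurable borel"
  unfolding chord_def[abs_def] by measurable

text \<open>The points that A lifts above h' form a disc of diameter 1 / (h' c^2) tangent to the
  real axis at - d / c. Slicing it horizontally and inverting the height leaves h and h' only in the
  product that bounds the range of integration.\<close>

lemma area_horoball_image:
  fixes A :: mat2
  assumes det: "det A = 1" and c: "A$2$1 > 0" and h: "h > 0" "h' > 0"
  shows "(\<integral>\<^sup>+z. indicator {h<..} (Im z) * indicator {h'<..} (Im (moebius A z)) \<partial>\<mu>)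
     = (\<integral>\<^sup>+u. ennreal (chord (u / (A$2$1)\<^sup>2)) * indicator {..<1 / (h * h')} u * weight u \<partial>lborel)"
proof -
  let ?c = "A$2$1" and ?d = "A$2$2"
  have inner: "(\<integral>\<^sup>+x. indicator {h'<..} (Im (moebius A (Complex x y))) \<partial>lborel) = ennreal y * ennreal (chord ((1 / h') / y / ?c\<^sup>2))"
    if y: "y > 0" for y
  proof -
    \<comment> \<open>When positive, this is the squared half-length D y - y^2 of the slice of the
      disc of diameter D = 1 / (h' c^2).\<close>
    define w where "w = y / (h' * ?c\<^sup>2) - y\<^sup>2"
    have "Im (moebius A (Complex x y)) > h' \<longleftrightarrow> (x + ?d / ?c)\<^sup>2 < w" for x
    proof -
      have n: "(norm (of_real ?c * Complex x y + of_real ?d))\<^sup>2 = ?c\<^sup>2 * ((x + ?d / ?c)\<^sup>2 + y\<^sup>2)"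
        unfolding cmod_power2 using c by (simp add: field_simps power2_eq_square)
      have "0 < ?c\<^sup>2 * ((x + ?d / ?c)\<^sup>2 + y\<^sup>2)" using c y by (intro mult_pos_pos add_nonneg_pos) auto
      then have "h' < y / (?c\<^sup>2 * ((x + ?d / ?c)\<^sup>2 + y\<^sup>2)) \<longleftrightarrow> ((x + ?d / ?c)\<^sup>2 + y\<^sup>2) * (h' * ?c\<^sup>2) < y"
        by (simp add: less_divide_eq mult_ac)
      also have "\<dots> \<longleftrightarrow> (x + ?d / ?c)\<^sup>2 + y\<^sup>2 < y / (h' * ?c\<^sup>2)"
        using h c by (simp add: less_divide_eq)
      finally show ?thesis unfolding Im_moebius[OF det] n w_def by auto
    qed
    also have "(x + ?d / ?c)\<^sup>2 < w \<longleftrightarrow> x \<in> {- ?d / ?c - sqrt (max 0 w)<..<- ?d / ?c + sqrt (max 0 w)}" for x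
    proof -
      have "(x + ?d / ?c)\<^sup>2 < w \<longleftrightarrow> \<bar>x + ?d / ?c\<bar> < sqrt (max 0 w)"
      proof (cases "w > 0")
        case True
        then show ?thesis by (metis max.absorb4 real_sqrt_abs real_sqrt_less_iff)
      next
        case False
        then show ?thesis by (smt (verit) max_def real_sqrt_zero zero_le_power2)
      qed
      also have "\<dots> \<longleftrightarrow> x \<in> {- ?d / ?c - sqrt (max 0 w)<..<- ?d / ?c + sqrt (max 0 w)}" by auto
      finally show ?thesis .
    qed
    finally have iff: "h' < Im (moebius A (Complex x y)) \<longleftrightarrow> x \<in> {- ?d / ?c - sqrt (max 0 w)<..<- ?d / ?c + sqrt (max 0 w)}" for x .
    have "(\<integral>\<^sup>+x. indicator {h'<..} (Im (moebius A (Complex x y))) \<partial>lborel)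
       = (\<integral>\<^sup>+x. indicator {- ?d / ?c - sqrt (max 0 w)<..<- ?d / ?c + sqrt (max 0 w)} x \<partial>lborel)"
      using iff by (intro nn_integral_cong) (simp split: split_indicator)
    also have "\<dots> = ennreal (2 * sqrt (max 0 w))" by simp
    also have "w = y\<^sup>2 * ((1 / h') / y / ?c\<^sup>2 - 1)"
      using y by (simp add: w_def field_simps power2_eq_square)
    also have "max 0 \<dots> = y\<^sup>2 * max 0 ((1 / h') / y / ?c\<^sup>2 - 1)"
      using y by (auto simp: max_def zero_le_mult_iff mult_le_0_iff)
    also have "2 * sqrt \<dots> = y * chord ((1 / h') / y / ?c\<^sup>2)"
      using y by (simp add: chord_def real_sqrt_mult)
    finally show ?thesis using y by (simp add: ennreal_mult)
  qed
  have "(\<integral>\<^sup>+z. indicator {h<..} (Im z) * indicator {h'<..} (Im (moebius A z)) \<partial>\<mu>)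
    = (\<integral>\<^sup>+y. \<integral>\<^sup>+x. indicator {h<..} y * indicator {h'<..} (Im (moebius A (Complex x y))) * weight2 y \<partial>lborel \<partial>lborel)"
    by (subst nn_integral_hyperbolic_area) auto
  also have "\<dots> = (\<integral>\<^sup>+y. indicator {h<..} y * (\<integral>\<^sup>+x. indicator {h'<..} (Im (moebius A (Complex x y))) \<partial>lborel) * weight2 y \<partial>lborel)"
    by (simp add: nn_integral_cmult nn_integral_multc)
  also have "\<dots> = (\<integral>\<^sup>+y. ennreal (chord ((1 / h') / y / ?c\<^sup>2)) * indicator {..<1 / (h * h')} ((1 / h') / y) * weight y \<partial>lborel)"
  proof (rule nn_integral_cong)
    fix y :: real
    show "indicator {h<..} y * (\<integral>\<^sup>+x. indicator {h'<..} (Im (moebius A (Complex x y))) \<partial>lborel) * weight2 y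
      = ennreal (chord ((1 / h') / y / ?c\<^sup>2)) * indicator {..<1 / (h * h')} ((1 / h') / y) * weight y"
    proof (cases "y > 0")
      case True
      have i: "(1 / h') / y \<in> {..<1 / (h * h')} \<longleftrightarrow> h < y" using True h by (simp add: field_simps)
      have e: "ennreal y * ennreal (1 / y\<^sup>2) = ennreal (1 / y)"
        using True by (subst ennreal_mult[symmetric]) (auto simp: power2_eq_square)
      show ?thesis unfolding inner[OF True] e[symmetric] using i True
        by (simp add: mult_ac split: split_indicator)
    qed simp
  qed
  \<comment> \<open>The substitution u = (1 / h') / y preserves dy / y and turns h < y into u < 1 /
    (h h').\<close>
  also have "\<dots> = (\<integral>\<^sup>+u. ennreal (chord (u / ?c\<^sup>2)) * indicator {..<1 / (h * h')} u * weight u \<partial>lborel)"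
    using h by (intro nn_integral_inverse_weight_invert[where g = "\<lambda>u. ennreal (chord (u / ?c\<^sup>2)) * indicator {..<1 / (h * h')} u"]) auto
  finally show ?thesis .
qed

section \<open>Representatives of the double cosets\<close>

context cusp_group
begin

abbreviation \<tau> :: "int \<Rightarrow> mat2" where "\<tau> m \<equiv> translation_matrix (of_int m)"

abbreviation dcoset :: "mat2 \<Rightarrow> mat2 set" where "dcoset \<equiv> double_coset (stabilizer_infinity \<Gamma>)"

text \<open>Left translations shift a, and right translations shift d, by multiples of c.
  Normalising both entries leaves one matrix per double coset, so double cosets can be counted and
  summed over as matrices.\<close>

definition reps :: "mat2 set" where
  "reps = {A \<in> \<Gamma>. 0 < A$2$1 \<and> 0 \<le> A$1$1 \<and> A$1$1 < A$2$1 \<and> 0 \<le> A$2$2 \<and> A$2$2 < A$2$1}"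

lemma countable_reps: "countable reps"
  by (rule countable_subset[OF _ countable_group]) (auto simp: reps_def)

text \<open>Parallel first columns mean that A^-1 B has lower left entry 0, so B is A times a signed
  translation; the sign is fixed by c > 0 and the translation by the range of d.\<close>

lemma reps_eqI:
  assumes A: "A \<in> reps" and B: "B \<in> reps" and parallel: "A$1$1 * B$2$1 = B$1$1 * A$2$1"
  shows "A = B"
proof -
  have AB: "A \<in> \<Gamma>" "B \<in> \<Gamma>" "det A = 1" using A B det_1 by (auto simp: reps_def)
  have C: "adj2 A ** B \<in> \<Gamma>" "(adj2 A ** B)$2$1 = 0"
    using AB parallel by (auto intro!: mult_closed adj2_closed simp: mult.commute)
  then obtain n :: int where n: "adj2 A ** B = translation_matrix n \<or> adj2 A ** B = - translation_matrix n"
    using stabilizer_iff by blast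
  have B_eq: "B = A ** (adj2 A ** B)" using adj2_mult(2)[OF AB(3)] by (simp add: matrix_mul_assoc)
  from n show ?thesis
  proof
    assume n: "adj2 A ** B = translation_matrix n"
    have "B = A ** translation_matrix n" using B_eq n by simp
    then have "B$2$2 = A$2$2 + n * A$2$1" by simp
    moreover have "0 \<le> B$2$2" "B$2$2 < A$2$1" "0 \<le> A$2$2" "A$2$2 < A$2$1"
      using A B \<open>B = A ** translation_matrix n\<close> by (auto simp: reps_def)
    ultimately have "\<bar>n * A$2$1\<bar> < 1 * A$2$1" by linarith
    then have "\<bar>real_of_int n\<bar> < 1" using A by (auto simp: reps_def abs_mult)
    then have "n = 0" by linarith
    then show ?thesis using \<open>B = A ** translation_matrix n\<close> by simp
  next
    assume n: "adj2 A ** B = - translation_matrix n"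
    have "B = A ** (- translation_matrix n)" using B_eq n by simp
    then have "B$2$1 = - A$2$1" by simp
    then show ?thesis using A B by (simp add: reps_def)
  qed
qed

text \<open>For nonparallel first columns the lower left entry of A^-1 B has modulus at least c0, so
  for c < x the fractions a / c in [0, 1) are separated by c0 / x^2. Bins of that width hold at most
  one representative each.\<close>

lemma finite_reps: "finite {A \<in> reps. A$2$1 < x}"
proof -
  obtain c0 where c0: "0 < c0" "c0 \<le> 1" "\<And>A. A \<in> \<Gamma> \<Longrightarrow> A$2$1 \<noteq> 0 \<Longrightarrow> c0 \<le> \<bar>A$2$1\<bar>"
    using lower_left_lower_bound by blast
  show ?thesis
  proof (cases "x > 0")
    case True
    define K where "K = x\<^sup>2 / c0"
    have K: "K > 0" using True c0 by (simp add: K_def)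
    define bin where "bin A = \<lfloor>(A$1$1 / A$2$1) * K\<rfloor>" for A :: mat2
    have "inj_on bin {A \<in> reps. A$2$1 < x}"
    proof (rule inj_onI)
      fix A B assume A: "A \<in> {A \<in> reps. A$2$1 < x}" and B: "B \<in> {A \<in> reps. A$2$1 < x}" and bin: "bin A = bin B"
      have c: "0 < A$2$1" "A$2$1 < x" "0 < B$2$1" "B$2$1 < x" using A B by (auto simp: reps_def)
      have "\<bar>(A$1$1 / A$2$1) * K - (B$1$1 / B$2$1) * K\<bar> < 1"
        using bin unfolding bin_def by linarith
      then have "\<bar>A$1$1 / A$2$1 - B$1$1 / B$2$1\<bar> * K < 1"
        using K by (simp add: left_diff_distrib[symmetric] abs_mult del: times_divide_eq_left)
      moreover have "A$1$1 * B$2$1 - B$1$1 * A$2$1 = (A$1$1 / A$2$1 - B$1$1 / B$2$1) * (A$2$1 * B$2$1)"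
        using c by (simp add: field_simps)
      then have "\<bar>A$1$1 * B$2$1 - B$1$1 * A$2$1\<bar> = \<bar>A$1$1 / A$2$1 - B$1$1 / B$2$1\<bar> * (A$2$1 * B$2$1)"
        using c by (simp add: abs_mult)
      moreover have "\<dots> \<le> \<bar>A$1$1 / A$2$1 - B$1$1 / B$2$1\<bar> * x\<^sup>2"
        unfolding power2_eq_square using c by (intro mult_left_mono mult_mono) auto
      ultimately have lt: "\<bar>A$1$1 * B$2$1 - B$1$1 * A$2$1\<bar> < c0"
        using c0 by (simp add: K_def field_simps)
      have "adj2 A ** B \<in> \<Gamma>" using A B by (auto intro!: mult_closed adj2_closed simp: reps_def)
      moreover have "(adj2 A ** B)$2$1 = A$1$1 * B$2$1 - B$1$1 * A$2$1" by (simp add: mult.commute)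
      ultimately have "A$1$1 * B$2$1 - B$1$1 * A$2$1 = 0"
        using c0(3)[of "adj2 A ** B"] lt by (metis leD)
      then show "A = B" using A B by (intro reps_eqI) auto
    qed
    moreover have "bin ` {A \<in> reps. A$2$1 < x} \<subseteq> {0..\<lfloor>K\<rfloor>}"
    proof clarify
      fix A assume "A \<in> reps"
      then have r: "0 \<le> A$1$1 / A$2$1" "A$1$1 / A$2$1 \<le> 1" by (auto simp: reps_def)
      have "0 \<le> A$1$1 / A$2$1 * K" "A$1$1 / A$2$1 * K \<le> K"
        using r K mult_right_mono[OF r(2), of K] mult_nonneg_nonneg[OF r(1), of K] by auto
      then show "bin A \<in> {0..\<lfloor>K\<rfloor>}" by (auto simp: bin_def intro: floor_mono)
    qed
    ultimately show ?thesis by (rule inj_on_finite) simp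
  next
    case False
    then have "{A \<in> reps. A$2$1 < x} = {}" by (auto simp: reps_def)
    then show ?thesis by (metis finite.emptyI)
  qed
qed

lemma double_coset_eq:
  "dcoset A
    = {B. \<exists>(m::int) (n::int). B = \<tau> m ** A ** \<tau> n
         \<or> B = - (\<tau> m ** A ** \<tau> n)}"
proof -
  have neg: "(- X) ** Y = - (X ** Y)" "X ** (- Y) = - (X ** Y)" for X Y :: mat2
    by (simp_all add: mat2_eq_iff)
  show ?thesis
    unfolding double_coset_def set_mult_def l_coset_def stabilizer
    by (auto simp: SL2R_def neg matrix_mul_assoc)
qed

lemma double_coset_mult_translation:
  "dcoset (A ** \<tau> k) = dcoset A"
proof -
  have sub: "dcoset (A ** \<tau> k)
      \<subseteq> dcoset A" for A k
  proof -
    have "\<tau> m ** (A ** \<tau> k) ** \<tau> n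
      = \<tau> m ** A ** \<tau> (k + n)" for m n :: int
      by (simp add: matrix_mul_assoc[symmetric] translation_matrix_mult)
    note eq = this
    show ?thesis unfolding double_coset_eq eq by blast
  qed
  have "A = (A ** \<tau> k) ** \<tau> (- k)"
    by (simp add: matrix_mul_assoc[symmetric] translation_matrix_mult)
  then show ?thesis using sub by (metis subset_antisym)
qed

lemma bij_reps_double_cosets:
  "bij_betw (dcoset) {A \<in> reps. A$2$1 < x} (counted_double_cosets \<Gamma> x)"
proof (rule bij_betw_imageI)
  show "inj_on (dcoset) {A \<in> reps. A$2$1 < x}"
  proof (rule inj_onI)
    fix A B assume A: "A \<in> {A \<in> reps. A$2$1 < x}" and B: "B \<in> {A \<in> reps. A$2$1 < x}"
      and eq: "dcoset A = dcoset B"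
    have "B = \<tau> 0 ** B ** \<tau> 0" by simp
    then have "B \<in> dcoset B" unfolding double_coset_eq by blast
    then have "B \<in> dcoset A" using eq by simp
    then obtain m n :: int where "B = translation_matrix m ** A ** translation_matrix n
         \<or> B = - (translation_matrix m ** A ** translation_matrix n)"
      unfolding double_coset_eq by blast
    then show "A = B"
    proof
      assume "B = translation_matrix m ** A ** translation_matrix n"
      then have b: "B$2$1 = A$2$1" "B$1$1 = A$1$1 + m * A$2$1" by simp_all
      have "0 \<le> B$1$1" "B$1$1 < A$2$1" "0 \<le> A$1$1" "A$1$1 < A$2$1" using A B b by (auto simp: reps_def)
      then have "\<bar>m * A$2$1\<bar> < 1 * A$2$1" using b by linarith
      then have "\<bar>real_of_int m\<bar> < 1" using A by (auto simp: reps_def abs_mult)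
      then have "m = 0" by linarith
      then show "A = B" using A B b by (intro reps_eqI) auto
    next
      assume "B = - (translation_matrix m ** A ** translation_matrix n)"
      then have "B$2$1 = - A$2$1" by simp
      then show "A = B" using A B by (auto simp: reps_def)
    qed
  qed
  show "dcoset ` {A \<in> reps. A$2$1 < x} = counted_double_cosets \<Gamma> x"
  proof
    show "dcoset ` {A \<in> reps. A$2$1 < x} \<subseteq> counted_double_cosets \<Gamma> x"
      unfolding counted_double_cosets_def by (auto simp: reps_def)
    show "counted_double_cosets \<Gamma> x \<subseteq> dcoset ` {A \<in> reps. A$2$1 < x}"
    proof
      fix X assume "X \<in> counted_double_cosets \<Gamma> x"
      then obtain A where X: "X = dcoset A" and A: "A \<in> \<Gamma>"
        "0 < A$2$1" "A$2$1 < x" "0 \<le> A$1$1" "A$1$1 < A$2$1"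
        unfolding counted_double_cosets_def by blast
      \<comment> \<open>A right translation reduces d modulo c without touching the first column or
        leaving the double coset.\<close>
      define k where "k = - \<lfloor>A$2$2 / A$2$1\<rfloor>"
      let ?B = "A ** \<tau> k"
      have "A$2$2 + k * A$2$1 = A$2$1 * (A$2$2 / A$2$1 + k)" using A by (simp add: field_simps)
      moreover have "0 \<le> A$2$2 / A$2$1 + k" "A$2$2 / A$2$1 + k < 1" unfolding k_def by linarith+
      ultimately have "0 \<le> A$2$2 + k * A$2$1" "A$2$2 + k * A$2$1 < A$2$1" using A by simp_all
      then have "?B \<in> {A \<in> reps. A$2$1 < x}"
        using A by (auto simp: reps_def mult.commute add.commute intro: mult_closed translation_closed)
      then show "X \<in> dcoset ` {A \<in> reps. A$2$1 < x}"
        unfolding X using double_coset_mult_translation[of A k] by blast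
    qed
  qed
qed

lemma finite_counted_double_cosets: "finite (counted_double_cosets \<Gamma> x)"
  using bij_betw_finite[OF bij_reps_double_cosets] finite_reps by blast

lemma double_coset_count_eq: "double_coset_count \<Gamma> x = card {A \<in> reps. A$2$1 < x}"
  unfolding double_coset_count_def using bij_betw_same_card[OF bij_reps_double_cosets] by metis

text \<open>The unique factorisation that lets the sum over the group be split into double cosets:
  the two exponents are the floors of a / c and d / c.\<close>

lemma bij_reps_translates:
  "bij_betw (\<lambda>(A, m, n). \<tau> m ** A ** \<tau> n)
     (reps \<times> UNIV \<times> (UNIV :: int set)) {A \<in> \<Gamma>. A$2$1 > 0}"
proof (rule bij_betw_byWitness[where f' = "\<lambda>B. (\<tau> (- \<lfloor>B$1$1 / B$2$1\<rfloor>) ** B **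
      \<tau> (- \<lfloor>B$2$2 / B$2$1\<rfloor>), \<lfloor>B$1$1 / B$2$1\<rfloor>, \<lfloor>B$2$2 / B$2$1\<rfloor>)"])
  let ?g = "\<lambda>(A, m, n). \<tau> m ** A ** \<tau> n"
  let ?f = "\<lambda>B. (\<tau> (- \<lfloor>B$1$1 / B$2$1\<rfloor>) ** B **
      \<tau> (- \<lfloor>B$2$2 / B$2$1\<rfloor>), \<lfloor>B$1$1 / B$2$1\<rfloor>, \<lfloor>B$2$2 / B$2$1\<rfloor>)"
  have cancel: "translation_matrix s ** (translation_matrix t ** A ** translation_matrix t') ** translation_matrix s' = A"
    if "s + t = 0" "t' + s' = 0" for s t s' t' A
  proof -
    have "translation_matrix s ** (translation_matrix t ** A ** translation_matrix t') ** translation_matrix s'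
      = (translation_matrix s ** translation_matrix t) ** A ** (translation_matrix t' ** translation_matrix s')"
      by (simp only: matrix_mul_assoc)
    then show ?thesis using that by (simp add: translation_matrix_mult)
  qed
  show "\<forall>p\<in>reps \<times> UNIV \<times> UNIV. ?f (?g p) = p"
  proof (intro ballI)
    fix p assume "p \<in> reps \<times> (UNIV :: int set) \<times> (UNIV :: int set)"
    then obtain A m n where p: "p = (A, m, n)" and A: "A \<in> reps" by auto
    have "\<lfloor>(A$1$1 + m * A$2$1) / A$2$1\<rfloor> = m" "\<lfloor>(A$2$2 + n * A$2$1) / A$2$1\<rfloor> = n"
      using A by (simp_all add: reps_def add_divide_distrib floor_eq_iff)
    then have "\<lfloor>?g (A, m, n)$1$1 / ?g (A, m, n)$2$1\<rfloor> = m" "\<lfloor>?g (A, m, n)$2$2 / ?g (A, m, n)$2$1\<rfloor> = n"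
      by (simp_all add: algebra_simps)
    then show "?f (?g p) = p" unfolding p using cancel[of "- m" m n "- n"] by simp
  qed
  show "\<forall>B\<in>{A \<in> \<Gamma>. A$2$1 > 0}. ?g (?f B) = B"
    by (simp add: cancel)
  show "?g ` (reps \<times> UNIV \<times> UNIV) \<subseteq> {A \<in> \<Gamma>. A$2$1 > 0}"
    by (auto simp: reps_def intro!: mult_closed translation_closed)
  show "?f ` {A \<in> \<Gamma>. A$2$1 > 0} \<subseteq> reps \<times> UNIV \<times> UNIV"
  proof (rule image_subsetI)
    fix B assume "B \<in> {A \<in> \<Gamma>. A$2$1 > 0}"
    then have B: "B \<in> \<Gamma>" "B$2$1 > 0" by auto
    let ?m = "\<lfloor>B$1$1 / B$2$1\<rfloor>" and ?n = "\<lfloor>B$2$2 / B$2$1\<rfloor>"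
    have "B$1$1 - ?m * B$2$1 = B$2$1 * (B$1$1 / B$2$1 - ?m)" "B$2$2 - ?n * B$2$1 = B$2$1 * (B$2$2 / B$2$1 - ?n)"
      using B by (simp_all add: field_simps)
    moreover have "0 \<le> B$1$1 / B$2$1 - ?m" "B$1$1 / B$2$1 - ?m < 1" "0 \<le> B$2$2 / B$2$1 - ?n" "B$2$2 / B$2$1 - ?n < 1"
      by linarith+
    ultimately have "0 \<le> B$1$1 - ?m * B$2$1" "B$1$1 - ?m * B$2$1 < B$2$1" "0 \<le> B$2$2 - ?n * B$2$1" "B$2$2 - ?n * B$2$1 < B$2$1"
      using B by simp_all
    then have "\<tau> (- ?m) ** B ** \<tau> (- ?n) \<in> reps"
      using B translation_closed[of "- ?m"] translation_closed[of "- ?n"]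
      by (auto simp: reps_def algebra_simps intro!: mult_closed)
    then show "?f B \<in> reps \<times> UNIV \<times> UNIV" by simp
  qed
qed

section \<open>Overlap areas of strips, summed over the group\<close>

definition overlap :: "real \<Rightarrow> real \<Rightarrow> mat2 \<Rightarrow> ennreal" where
  "overlap h h' A = (\<integral>\<^sup>+z. indicator (stripe h) z * indicator (stripe h') (moebius A z) \<partial>\<mu>)"

definition chord_sum :: "real \<Rightarrow> ennreal" where
  "chord_sum u = (\<integral>\<^sup>+A. ennreal (chord (u / (A$2$1)\<^sup>2)) \<partial>count_space reps)"

text \<open>By \<open>area_horoball_image\<close> this is the sum over the double cosets of the
  areas in which two horoballs overlap, for heights with h h' = 1 / W.\<close>

definition chord_integral :: "real \<Rightarrow> ennreal" where
  "chord_integral W = (\<integral>\<^sup>+u. chord_sum u * indicator {..<W} u * weight u \<partial>lborel)"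

lemma gsum_indicator:
  assumes "X \<subseteq> \<Gamma>"
  shows "gsum (\<lambda>A. f A * indicator X A) = (\<integral>\<^sup>+A. f A \<partial>count_space X)"
  by (subst (1 2) nn_integral_count_space_indicator)
     (use assms in \<open>auto intro!: nn_integral_cong split: split_indicator\<close>)

lemma measurable_chord_sum [measurable]: "chord_sum \<in> borel_measurable borel"
proof -
  have "reps \<subseteq> \<Gamma>" by (auto simp: reps_def)
  then have "chord_sum = (\<lambda>u. gsum (\<lambda>A. ennreal (chord (u / (A$2$1)\<^sup>2)) * indicator reps A))"
    unfolding chord_sum_def by (intro ext gsum_indicator[symmetric])
  also have "\<dots> \<in> borel_measurable borel" by measurable
  finally show ?thesis .
qed

lemma measurable_chord_integral [measurable (raw)]:
  assumes [measurable]: "f \<in> borel_measurable M"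
  shows "(\<lambda>x. chord_integral (f x)) \<in> borel_measurable M"
proof -
  have "(\<lambda>x. chord_integral (f x)) = (\<lambda>x. \<integral>\<^sup>+u. chord_sum u * indicator {p. fst p < snd p} (u, f x)
      * weight u \<partial>lborel)"
    unfolding chord_integral_def by (intro ext nn_integral_cong) (auto split: split_indicator)
  also have "\<dots> \<in> borel_measurable M" by measurable
  finally show ?thesis .
qed

text \<open>Summing over n lets the first strip sweep out all real parts of z, and summing over m
  does the same for the real part of the image; only the two height conditions survive.\<close>

lemma overlap_translates:
  assumes A: "A \<in> \<Gamma>"
  shows "(\<integral>\<^sup>+m. \<integral>\<^sup>+n. overlap h h' (\<tau> m ** A ** \<tau> n)
         \<partial>count_space UNIV \<partial>count_space UNIV)
     = (\<integral>\<^sup>+z. indicator {h<..} (Im z) * indicator {h'<..} (Im (moebius A z)) \<partial>\<mu>)"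
proof -
  have det: "det A = 1" using A by (rule det_1)
  define G :: "complex \<Rightarrow> ennreal" where "G z = indicator {h<..} (Im z) * indicator {h'<..} (Im (moebius A z))" for z
  define I :: "int \<Rightarrow> complex \<Rightarrow> ennreal" where "I n z = indicator {0..<1} (Re z - of_int n)" for n z
  define J :: "int \<Rightarrow> complex \<Rightarrow> ennreal" where "J m z = indicator {0..<1} (Re (moebius A z) + of_int m)" for m z
  have [measurable]: "G \<in> borel_measurable borel" "I n \<in> borel_measurable borel" "J n \<in> borel_measurable borel" for n
    unfolding G_def[abs_def] I_def[abs_def] J_def[abs_def] by measurable
  have shift: "overlap h h' (\<tau> m ** A ** \<tau> n)
      = (\<integral>\<^sup>+z. G z * (I n z * J m z) \<partial>\<mu>)" for m n
  proof -
    have "overlap h h' (\<tau> m ** A ** \<tau> n)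
       = (\<integral>\<^sup>+z. G (of_real 1 * z + of_real (of_int n)) * (I n (of_real 1 * z + of_real (of_int n)) * J m (of_real 1 * z + of_real (of_int n))) \<partial>\<mu>)"
      unfolding overlap_def using AE_upper_half_plane
    proof (intro nn_integral_cong_AE, eventually_elim)
      case (elim z)
      have "moebius (\<tau> m ** A ** \<tau> n) z = moebius A (z + of_int n) + of_int m"
        using elim det by (simp add: moebius_mult det_mul)
      then show ?case by (auto simp: G_def I_def J_def split: split_indicator)
    qed
    also have "\<dots> = (\<integral>\<^sup>+z. G z * (I n z * J m z) \<partial>\<mu>)"
      by (rule hyperbolic_area_affine) auto
    finally show ?thesis .
  qed
  have sum: "(\<integral>\<^sup>+m. J m z \<partial>count_space UNIV) = 1" "(\<integral>\<^sup>+n. I n z \<partial>count_space UNIV) = 1" for z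
    unfolding I_def J_def by (rule nn_integral_int_translates)+
  have "(\<integral>\<^sup>+m. \<integral>\<^sup>+n. (\<integral>\<^sup>+z. G z * (I n z * J m z) \<partial>\<mu>) \<partial>count_space UNIV \<partial>count_space UNIV)
      = (\<integral>\<^sup>+m. (\<integral>\<^sup>+z. \<integral>\<^sup>+n. G z * (I n z * J m z) \<partial>count_space UNIV \<partial>\<mu>) \<partial>count_space UNIV)"
    by (subst nn_integral_count_space_nn_integral) auto
  also have "\<dots> = (\<integral>\<^sup>+m. (\<integral>\<^sup>+z. G z * J m z \<partial>\<mu>) \<partial>count_space UNIV)"
    by (simp add: nn_integral_cmult nn_integral_multc sum)
  also have "\<dots> = (\<integral>\<^sup>+z. \<integral>\<^sup>+m. G z * J m z \<partial>count_space UNIV \<partial>\<mu>)"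
    by (subst nn_integral_count_space_nn_integral) auto
  also have "\<dots> = (\<integral>\<^sup>+z. G z \<partial>\<mu>)"
    by (simp add: nn_integral_cmult sum)
  finally show ?thesis unfolding shift G_def .
qed

lemma sum_overlap_positive:
  assumes h: "h > 0" "h' > 0"
  shows "(\<integral>\<^sup>+A. overlap h h' A \<partial>count_space {A \<in> \<Gamma>. A$2$1 > 0}) = chord_integral (1 / (h * h'))"
proof -
  let ?W = "1 / (h * h')"
  have "(\<integral>\<^sup>+A. overlap h h' A \<partial>count_space {A \<in> \<Gamma>. A$2$1 > 0})
    = (\<integral>\<^sup>+p. overlap h h' (case p of (A, m, n) \<Rightarrow> \<tau> m ** A ** \<tau> n)
        \<partial>count_space (reps \<times> UNIV \<times> UNIV))"
    by (rule nn_integral_bij_count_space[OF bij_reps_translates, symmetric])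
  also have "\<dots> = (\<integral>\<^sup>+A. \<integral>\<^sup>+m. \<integral>\<^sup>+n. overlap h h' (\<tau> m ** A ** \<tau> n)
         \<partial>count_space UNIV \<partial>count_space UNIV \<partial>count_space reps)"
    by (subst nn_integral_count_space_Times)
       (auto simp: countable_reps nn_integral_count_space_Times simp del: UNIV_Times_UNIV)
  also have "\<dots> = (\<integral>\<^sup>+A. (\<integral>\<^sup>+u. ennreal (chord (u / (A$2$1)\<^sup>2)) * indicator {..<?W} u * weight u \<partial>lborel) \<partial>count_space reps)"
  proof (rule nn_integral_cong)
    fix A assume "A \<in> space (count_space reps)"
    then have "A \<in> \<Gamma>" "0 < A$2$1" "det A = 1" using det_1 by (auto simp: reps_def)
    then show "(\<integral>\<^sup>+m. \<integral>\<^sup>+n. overlap h h' (\<tau> m ** A ** \<tau> n) \<partial>count_space UNIV \<partial>count_space UNIV)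
      = (\<integral>\<^sup>+u. ennreal (chord (u / (A$2$1)\<^sup>2)) * indicator {..<?W} u * weight u \<partial>lborel)"
      using overlap_translates area_horoball_image h by simp
  qed
  also have "\<dots> = (\<integral>\<^sup>+u. \<integral>\<^sup>+A. ennreal (chord (u / (A$2$1)\<^sup>2)) * indicator {..<?W} u * weight u \<partial>count_space reps \<partial>lborel)"
    by (subst nn_integral_count_space_nn_integral) (auto intro: countable_reps)
  also have "\<dots> = chord_integral ?W"
    unfolding chord_integral_def chord_sum_def by (simp add: nn_integral_multc)
  finally show ?thesis .
qed

lemma overlap_uminus: "overlap h h' (- A) = overlap h h' A"
  by (simp add: overlap_def)

lemma bij_stabilizer:
  "bij_betw (\<lambda>(m::int, b). if b then \<tau> m else - \<tau> m)
     (UNIV \<times> UNIV) {A \<in> \<Gamma>. A$2$1 = 0}"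
proof (rule bij_betw_imageI)
  show "inj_on (\<lambda>(m::int, b). if b then \<tau> m else - \<tau> m) (UNIV \<times> UNIV)"
    by (rule inj_onI) (auto simp: mat2_eq_iff split: if_splits)
  show "(\<lambda>(m::int, b). if b then \<tau> m else - \<tau> m) ` (UNIV \<times> UNIV) = {A \<in> \<Gamma>. A$2$1 = 0}"
    unfolding set_eq_iff mem_Collect_eq stabilizer_iff by (auto simp: image_iff split: if_splits)
qed

text \<open>Translations keep heights, so both conditions together say that the height exceeds the
  maximum; exactly one translation brings the real part back into [0, 1). The two signs give the
  factor 2.\<close>

lemma sum_overlap_stabilizer:
  assumes "h > 0" "h' > 0"
  shows "(\<integral>\<^sup>+A. overlap h h' A \<partial>count_space {A \<in> \<Gamma>. A$2$1 = 0})
    = 2 * (\<integral>\<^sup>+z. indicator (stripe (max h h')) z \<partial>\<mu>)"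
proof -
  have "(\<integral>\<^sup>+A. overlap h h' A \<partial>count_space {A \<in> \<Gamma>. A$2$1 = 0})
    = (\<integral>\<^sup>+p. overlap h h' (case p of (m, b) \<Rightarrow> if b then \<tau> m else - \<tau> m)
        \<partial>count_space ((UNIV :: int set) \<times> UNIV))"
    by (rule nn_integral_bij_count_space[OF bij_stabilizer, symmetric])
  also have "\<dots> = (\<integral>\<^sup>+m. overlap h h' (\<tau> m) * 2 \<partial>count_space UNIV)"
    by (subst nn_integral_count_space_Times)
       (auto intro!: nn_integral_cong simp: nn_integral_count_space_finite UNIV_bool overlap_uminus mult_2_right)
  also have "\<dots> = (\<integral>\<^sup>+m. overlap h h' (\<tau> m) \<partial>count_space UNIV) * 2"
    by (rule nn_integral_multc) simp
  also have "(\<integral>\<^sup>+m. overlap h h' (\<tau> m) \<partial>count_space UNIV)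
      = (\<integral>\<^sup>+z. \<integral>\<^sup>+m. indicator (stripe h) z * indicator (stripe h') (z + of_int m) \<partial>count_space UNIV \<partial>\<mu>)"
    unfolding overlap_def by (subst nn_integral_count_space_nn_integral) auto
  also have "\<dots> = (\<integral>\<^sup>+z. \<integral>\<^sup>+m. indicator (stripe (max h h')) z * indicator {0..<1} (Re z + of_int m) \<partial>count_space UNIV \<partial>\<mu>)"
    by (intro nn_integral_cong) (auto split: split_indicator)
  also have "\<dots> = (\<integral>\<^sup>+z. indicator (stripe (max h h')) z \<partial>\<mu>)"
    by (simp add: nn_integral_cmult nn_integral_int_translates)
  finally show ?thesis by (simp add: mult.commute)
qed

lemma gsum_overlap:
  assumes h: "h > 0" "h' > 0"
  shows "gsum (overlap h h') = 2 * (\<integral>\<^sup>+z. indicator (stripe (max h h')) z \<partial>\<mu>) + 2 * chord_integral (1 / (h * h'))"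
proof -
  let ?P = "{A \<in> \<Gamma>. A$2$1 > 0}" and ?Z = "{A \<in> \<Gamma>. A$2$1 = 0}" and ?M = "{A \<in> \<Gamma>. A$2$1 < 0}"
  have "gsum (overlap h h') = gsum (\<lambda>A. overlap h h' A * indicator ?Z A + overlap h h' A * indicator ?P A + overlap h h' A * indicator ?M A)"
    by (intro nn_integral_cong) (auto split: split_indicator)
  also have "\<dots> = (\<integral>\<^sup>+A. overlap h h' A \<partial>count_space ?Z) + (\<integral>\<^sup>+A. overlap h h' A \<partial>count_space ?P) + (\<integral>\<^sup>+A. overlap h h' A \<partial>count_space ?M)"
    by (simp add: nn_integral_add gsum_indicator)
  also have "(\<integral>\<^sup>+A. overlap h h' A \<partial>count_space ?M) = (\<integral>\<^sup>+A. overlap h h' (- A) \<partial>count_space ?P)"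
    by (rule nn_integral_bij_count_space[symmetric], rule bij_betw_byWitness[where f' = uminus])
       (auto intro: uminus_closed)
  finally show ?thesis
    by (simp add: overlap_uminus sum_overlap_positive[OF h] sum_overlap_stabilizer[OF h] mult_2 add_ac)
qed

end

text \<open>One factor 2 comes from unfolding and one from the signs of the matrices; the two
  factors 1/2 in \<open>ncount\<close> compensate for both.\<close>

lemma (in cusp_lattice) integral_orbits_orbits:
  assumes h: "h > 0" "h' > 0"
  shows "(\<integral>\<^sup>+z. orbits h z * orbits h' z \<partial>quot) = 4 * (ennreal (1 / max h h') + chord_integral (1 / (h * h')))"
proof -
  have "(\<integral>\<^sup>+z. orbits h z * orbits h' z \<partial>quot) = 2 * (\<integral>\<^sup>+z. indicator (stripe h) z * orbits h' z \<partial>\<mu>)"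
    by (rule integral_orbits_mult) (auto intro: orbits_invariant)
  also have "(\<integral>\<^sup>+z. indicator (stripe h) z * orbits h' z \<partial>\<mu>)
      = (\<integral>\<^sup>+z. gsum (\<lambda>A. indicator (stripe h) z * indicator (stripe h') (moebius A z)) \<partial>\<mu>)"
    unfolding orbits_def by (simp add: nn_integral_cmult)
  also have "\<dots> = gsum (overlap h h')"
    unfolding overlap_def by (rule nn_integral_gsum) measurable
  also have "2 * gsum (overlap h h') = 4 * (ennreal (1 / max h h') + chord_integral (1 / (h * h')))"
    unfolding gsum_overlap[OF h] using h
    by (subst area_stripe) (auto simp: distrib_left mult.assoc[symmetric])
  finally show ?thesis .
qed

section \<open>Convergence of the correlations\<close>

text \<open>Iterating the midpoint inequality along \<open>t, 2t - T, \<dots>\<close> shows that \<open>\<phi>\<close> is decreasing up to \<open>exp (- T / 2)\<close>.\<close>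

lemma midpoint_convex_bounded_converges:
  fixes \<phi> :: "real \<Rightarrow> real"
  assumes bound: "\<And>t. 0 \<le> t \<Longrightarrow> \<bar>\<phi> t\<bar> \<le> C"
    and mid: "\<And>s t. 0 \<le> s \<Longrightarrow> s \<le> t \<Longrightarrow> 2 * \<phi> (s + t) \<le> \<phi> (2 * s) + \<phi> (2 * t) + exp (- s)"
  obtains L where "(\<phi> \<longlongrightarrow> L) at_top"
proof -
  have step: "\<phi> t \<le> \<phi> T + exp (- T / 2)" if T: "0 \<le> T" "T \<le> t" for T t
  proof -
    define A where "A = \<phi> T + exp (- T / 2)"
    \<comment> \<open>Here u is the midpoint of T and 2 u - T: the hypothesis is applied with s = T
      / 2 and t = u - T / 2. Iteration pushes the far point out while the deviation is halved each
      time, and boundedness kills it.\<close>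
    have half: "\<phi> u - A \<le> (\<phi> (2 * u - T) - A) / 2" if "T \<le> u" for u
    proof -
      have "T / 2 + (u - T / 2) = u" "2 * (T / 2) = T" "2 * (u - T / 2) = 2 * u - T" "- (T / 2) = - T / 2"
        by simp_all
      then have "2 * \<phi> u \<le> \<phi> T + \<phi> (2 * u - T) + exp (- T / 2)"
        using mid[of "T / 2" "u - T / 2"] T that by (simp only:)
      then show ?thesis by (simp add: A_def field_simps)
    qed
    have iter: "\<phi> u - A \<le> (C + \<bar>A\<bar>) / 2 ^ n" if "T \<le> u" for u n
      using that
    proof (induction n arbitrary: u)
      case 0
      then show ?case using bound[of u] T by auto
    next
      case (Suc n)
      have "\<phi> u - A \<le> (\<phi> (2 * u - T) - A) / 2" by (rule half[OF Suc.prems])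
      also have "\<dots> \<le> ((C + \<bar>A\<bar>) / 2 ^ n) / 2" using Suc by (intro divide_right_mono Suc.IH) auto
      finally show ?case by simp
    qed
    have "(\<lambda>n. (C + \<bar>A\<bar>) / 2 ^ n) \<longlonglongrightarrow> 0" by real_asymp
    then have "\<phi> t - A \<le> 0" using iter[OF T(2)] by (intro LIMSEQ_le_const) auto
    then show ?thesis by (simp add: A_def)
  qed
  \<comment> \<open>The infimum of the function corrected by its error is the limit: it bounds the
    function from below up to a vanishing term, and \<open>step\<close> propagates any nearly
    minimal value to all later times.\<close>
  define m where "m = (INF T\<in>{0..}. \<phi> T + exp (- T / 2))"
  have bdd: "bdd_below ((\<lambda>T. \<phi> T + exp (- T / 2)) ` {0..})"
  proof (rule bdd_belowI2)
    fix T :: real assume "T \<in> {0..}"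
    then have "- C \<le> \<phi> T" using bound[of T] by auto
    moreover have "0 \<le> exp (- T / 2)" by simp
    ultimately show "- C \<le> \<phi> T + exp (- T / 2)" by linarith
  qed
  have "(\<phi> \<longlongrightarrow> m) at_top"
  proof (rule tendstoI)
    fix e :: real assume e: "e > 0"
    obtain T where T: "T \<ge> 0" "\<phi> T + exp (- T / 2) < m + e"
      using cInf_lessD[of "(\<lambda>T. \<phi> T + exp (- T / 2)) ` {0..}" "m + e"] e unfolding m_def by auto
    have "((\<lambda>t::real. exp (- t / 2)) \<longlongrightarrow> 0) at_top" by real_asymp
    then have "\<forall>\<^sub>F t in at_top. exp (- t / 2) < e" using e by (simp add: order_tendsto_iff)
    with eventually_ge_at_top[of T] show "\<forall>\<^sub>F t in at_top. dist (\<phi> t) m < e"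
    proof eventually_elim
      case (elim t)
      have "m \<le> \<phi> t + exp (- t / 2)" unfolding m_def using bdd elim T by (intro cINF_lower) auto
      moreover have "\<phi> t < m + e" using step[of T t] T elim by simp
      ultimately show ?case using elim by (simp add: dist_real_def)
    qed
  qed
  then show thesis by (rule that)
qed

context cusp_lattice
begin

text \<open>The function \<open>b h\<close> of the overview. By \<open>orbits_bounded\<close> the
  count is finite for h at most 1 on the upper half plane, so the conversion to reals loses nothing
  there.\<close>

definition ncount :: "real \<Rightarrow> complex \<Rightarrow> real" where
  "ncount h z = h / 2 * enn2real (orbits h z)"

lemma measurable_ncount [measurable (raw)]:
  assumes [measurable]: "f \<in> borel_measurable M"
  shows "(\<lambda>x. ncount h (f x)) \<in> borel_measurable M"
  unfolding ncount_def by measurable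

lemma ncount_bounded:
  obtains C where "C > 0" "\<And>h z. 0 < h \<Longrightarrow> 0 \<le> ncount h z"
    "\<And>h z. 0 < h \<Longrightarrow> h \<le> 1 \<Longrightarrow> 0 < Im z \<Longrightarrow> ncount h z \<le> C"
    "\<And>h z. 0 < h \<Longrightarrow> h \<le> 1 \<Longrightarrow> 0 < Im z \<Longrightarrow> ennreal (ncount h z) = ennreal (h / 2) * orbits h z"
proof -
  obtain C where C: "C > 0" "\<And>h z. 0 < h \<Longrightarrow> h \<le> 1 \<Longrightarrow> Im z > 0 \<Longrightarrow> ennreal h * orbits h z \<le> ennreal C"
    by (rule orbits_bounded) blast
  have eq: "ennreal (ncount h z) = ennreal (h / 2) * orbits h z" if h: "0 < h" "h \<le> 1" "0 < Im z" for h z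
  proof -
    have "ennreal h * orbits h z < \<infinity>" using C(2)[OF h] by (simp add: order_le_less_trans)
    then have "orbits h z < \<infinity>" using h by (auto simp: ennreal_mult_less_top)
    then have "ennreal (enn2real (orbits h z)) = orbits h z" by simp
    then show ?thesis unfolding ncount_def using h by (subst ennreal_mult) auto
  qed
  have le: "ncount h z \<le> C" if h: "0 < h" "h \<le> 1" "0 < Im z" for h z
  proof -
    have "ennreal (ncount h z) \<le> ennreal h * orbits h z"
      unfolding eq[OF h] using h by (intro mult_right_mono ennreal_leI) auto
    also have "\<dots> \<le> ennreal C" by (rule C(2)[OF h])
    finally show ?thesis using C(1) by (simp add: ennreal_le_iff)
  qed
  show thesis by (rule that[of C]) (use C le eq in \<open>auto simp: ncount_def\<close>)
qed

lemma ncount_eq: "0 < h \<Longrightarrow> h \<le> 1 \<Longrightarrow> 0 < Im z \<Longrightarrow> ennreal (ncount h z) = ennreal (h / 2) * orbits h z"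
  and ncount_nonneg: "0 < h \<Longrightarrow> 0 \<le> ncount h z"
  using ncount_bounded by metis+

lemma ncount_invariant: "A \<in> \<Gamma> \<Longrightarrow> 0 < Im z \<Longrightarrow> ncount h (moebius A z) = ncount h z"
  by (simp add: ncount_def orbits_invariant)

lemma integrable_ncount:
  assumes "0 < h" "h \<le> 1"
  shows "integrable quot (ncount h)"
proof -
  obtain C where "C > 0" "\<And>h z. 0 < h \<Longrightarrow> 0 \<le> ncount h z" "\<And>h z. 0 < h \<Longrightarrow> h \<le> 1 \<Longrightarrow> 0 < Im z \<Longrightarrow> ncount h z \<le> C"
    by (rule ncount_bounded) blast
  then show ?thesis using AE_quot assms
    by (intro quot.integrable_const_bound[where B = C]) (auto elim!: eventually_mono)
qed

lemma integrable_ncount_ncount: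
  assumes "0 < h" "h \<le> 1" "0 < h'" "h' \<le> 1"
  shows "integrable quot (\<lambda>z. ncount h z * ncount h' z)"
proof -
  obtain C where "C > 0" "\<And>h z. 0 < h \<Longrightarrow> 0 \<le> ncount h z" "\<And>h z. 0 < h \<Longrightarrow> h \<le> 1 \<Longrightarrow> 0 < Im z \<Longrightarrow> ncount h z \<le> C"
    by (rule ncount_bounded) blast
  then show ?thesis using AE_quot assms
    by (intro quot.integrable_const_bound[where B = "C * C"])
       (auto elim!: eventually_mono simp: abs_mult intro!: mult_mono)
qed

lemma integral_ncount:
  assumes h: "0 < h" "h \<le> 1"
  shows "(\<integral>z. ncount h z \<partial>quot) = 1"
proof -
  have "ennreal (\<integral>z. ncount h z \<partial>quot) = (\<integral>\<^sup>+z. ennreal (ncount h z) \<partial>quot)"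
    using h by (intro nn_integral_eq_integral[symmetric] integrable_ncount) (auto simp: ncount_nonneg)
  also have "\<dots> = (\<integral>\<^sup>+z. ennreal (h / 2) * orbits h z \<partial>quot)"
    using AE_quot by (intro nn_integral_cong_AE) (auto elim!: eventually_mono simp: ncount_eq h)
  also have "\<dots> = ennreal (h / 2) * (\<integral>\<^sup>+z. orbits h z \<partial>quot)"
    by (rule nn_integral_cmult) measurable
  also have "\<dots> = ennreal 1"
    unfolding integral_orbits[OF h(1)] using h by (subst ennreal_mult[symmetric]) auto
  finally have "ennreal (\<integral>z. ncount h z \<partial>quot) = ennreal 1" .
  moreover have "0 \<le> (\<integral>z. ncount h z \<partial>quot)"
    using h by (intro Bochner_Integration.integral_nonneg) (simp add: ncount_nonneg)
  ultimately show ?thesis by (subst (asm) ennreal_inj) auto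
qed

definition corr :: "real \<Rightarrow> real \<Rightarrow> real" where
  "corr h h' = (\<integral>z. ncount h z * ncount h' z \<partial>quot)"

lemma corr_eq:
  assumes h: "0 < h" "h \<le> 1" "0 < h'" "h' \<le> 1"
  shows "ennreal (corr h h') = ennreal (min h h') + ennreal (h * h') * chord_integral (1 / (h * h'))"
proof -
  have "ennreal (corr h h') = (\<integral>\<^sup>+z. ennreal (ncount h z * ncount h' z) \<partial>quot)"
    unfolding corr_def using h
    by (intro nn_integral_eq_integral[symmetric] integrable_ncount_ncount) (auto simp: ncount_nonneg)
  also have "\<dots> = (\<integral>\<^sup>+z. ennreal (h / 2 * (h' / 2)) * (orbits h z * orbits h' z) \<partial>quot)"
    using AE_quot
  proof (intro nn_integral_cong_AE, eventually_elim)
    case (elim z)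
    have "ennreal (ncount h z * ncount h' z) = (ennreal (h / 2) * orbits h z) * (ennreal (h' / 2) * orbits h' z)"
      using elim h by (simp add: ennreal_mult ncount_nonneg ncount_eq)
    also have "\<dots> = (ennreal (h / 2) * ennreal (h' / 2)) * (orbits h z * orbits h' z)" by (simp only: mult_ac)
    finally show ?case using h by (simp only: ennreal_mult[symmetric])
  qed
  also have "\<dots> = ennreal (h / 2 * (h' / 2)) * (\<integral>\<^sup>+z. orbits h z * orbits h' z \<partial>quot)"
    by (rule nn_integral_cmult) measurable
  also have "\<dots> = ennreal (h / 2 * (h' / 2)) * ennreal 4 * (ennreal (1 / max h h') + chord_integral (1 / (h * h')))"
    using integral_orbits_orbits[of h h'] h by (simp add: mult.assoc)
  also have "ennreal (h / 2 * (h' / 2)) * ennreal 4 = ennreal (h * h')"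
    using h by (subst ennreal_mult[symmetric]) auto
  also have "ennreal (h * h') * (ennreal (1 / max h h') + chord_integral (1 / (h * h')))
     = ennreal (min h h') + ennreal (h * h') * chord_integral (1 / (h * h'))"
  proof -
    have "h * h' * (1 / max h h') = min h h'" using h by (auto simp: max_def min_def)
    then have "ennreal (h * h') * ennreal (1 / max h h') = ennreal (min h h')"
      using h by (subst ennreal_mult[symmetric]) auto
    then show ?thesis by (simp add: distrib_left)
  qed
  finally show ?thesis .
qed

text \<open>The overview's \<kappa> at 1 / W: the correlation of heights h, h' is
  \<open>min h h'\<close> plus this at W = 1 / (h h').\<close>

definition chord_mean :: "real \<Rightarrow> real" where
  "chord_mean W = enn2real (chord_integral W) / W"

text \<open>Read off from the diagonal correlation at h = 1 / sqrt W, which is a real number; W at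
  least 1 keeps h in the range where \<open>ncount\<close> is bounded.\<close>

lemma chord_integral_finite:
  assumes "W \<ge> 1"
  shows "chord_integral W < \<infinity>"
proof -
  define h where "h = 1 / sqrt W"
  have h: "0 < h" "h \<le> 1" "h * h = 1 / W" using assms by (auto simp: h_def)
  have "ennreal (min h h) + ennreal (h * h) * chord_integral (1 / (h * h)) < \<infinity>"
    unfolding corr_eq[OF h(1,2,1,2), symmetric] by simp
  then have "ennreal (h * h) * chord_integral (1 / (h * h)) < \<infinity>" by simp
  then show ?thesis using h assms by (auto simp: ennreal_mult_less_top)
qed

lemma corr_eq_real:
  assumes h: "0 < h" "h \<le> 1" "0 < h'" "h' \<le> 1"
  shows "corr h h' = min h h' + chord_mean (1 / (h * h'))"
proof -
  have W: "1 \<le> 1 / (h * h')" using h by (simp add: mult_le_one)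
  have "ennreal (corr h h') = ennreal (min h h' + chord_mean (1 / (h * h')))"
  proof -
    have "ennreal (h * h') * chord_integral (1 / (h * h')) = ennreal (h * h') * ennreal (enn2real (chord_integral (1 / (h * h'))))"
      using chord_integral_finite[OF W] by simp
    also have "\<dots> = ennreal (chord_mean (1 / (h * h')))"
      unfolding chord_mean_def using h by (subst ennreal_mult[symmetric]) (auto simp: mult.commute)
    finally show ?thesis unfolding corr_eq[OF h] using h by (simp add: chord_mean_def)
  qed
  moreover have "0 \<le> corr h h'" unfolding corr_def using h by (intro Bochner_Integration.integral_nonneg) (auto simp: ncount_nonneg)
  moreover have "0 \<le> min h h' + chord_mean (1 / (h * h'))" using h by (simp add: chord_mean_def)
  ultimately show ?thesis by simp
qed

text \<open>With h = exp (- s) and h' = exp (- t) the product becomes the sum s + t, so the mixed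
  correlation sits at the midpoint of the two diagonal ones.\<close>

lemma chord_mean_converges:
  obtains k where "(chord_mean \<longlongrightarrow> k) at_top"
proof -
  obtain C where C: "C > 0" "\<And>h z. 0 < h \<Longrightarrow> 0 \<le> ncount h z" "\<And>h z. 0 < h \<Longrightarrow> h \<le> 1 \<Longrightarrow> 0 < Im z \<Longrightarrow> ncount h z \<le> C"
    by (rule ncount_bounded) blast
  have eq: "corr (exp (- s)) (exp (- t)) = exp (- max s t) + chord_mean (exp (s + t))" if "0 \<le> s" "0 \<le> t" for s t
  proof -
    have "1 / (exp (- s) * exp (- t)) = exp (s + t)" by (simp add: exp_minus exp_add field_simps)
    moreover have "min (exp (- s)) (exp (- t)) = exp (- max s t)" by (auto simp: min_def max_def)
    ultimately show ?thesis using that by (simp add: corr_eq_real)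
  qed
  have "\<bar>chord_mean (exp t)\<bar> \<le> C" if "0 \<le> t" for t
  proof -
    \<comment> \<open>One factor in the diagonal correlation is bounded by C and the other has
      integral 1, which gives the uniform bound C.\<close>
    have "chord_mean (exp t) \<le> corr (exp (- (t / 2))) (exp (- (t / 2)))"
      using eq[of "t / 2" "t / 2"] that by simp
    also have "\<dots> \<le> (\<integral>z. C * ncount (exp (- (t / 2))) z \<partial>quot)"
      unfolding corr_def
    proof (rule integral_mono_AE)
      show "AE z in quot. ncount (exp (- (t / 2))) z * ncount (exp (- (t / 2))) z \<le> C * ncount (exp (- (t / 2))) z"
        using AE_quot by eventually_elim (use C that in \<open>auto intro!: mult_right_mono\<close>)
    qed (use that in \<open>auto intro!: integrable_ncount_ncount integrable_ncount\<close>)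
    also have "\<dots> = C" using that by (simp add: integral_ncount)
    finally show ?thesis by (simp add: chord_mean_def)
  qed
  moreover have "2 * chord_mean (exp (s + t)) \<le> chord_mean (exp (2 * s)) + chord_mean (exp (2 * t)) + exp (- s)"
    if st: "0 \<le> s" "s \<le> t" for s t
  proof -
    let ?h = "exp (- s)" and ?h' = "exp (- t)"
    have int: "integrable quot (\<lambda>z. ncount ?h z * ncount ?h z)" "integrable quot (\<lambda>z. ncount ?h' z * ncount ?h' z)" "integrable quot (\<lambda>z. ncount ?h z * ncount ?h' z)"
      using st by (auto intro!: integrable_ncount_ncount)
    \<comment> \<open>The minima are exp (- s) and exp (- t) on the diagonal and exp (- t) for the
      mixed term, so they add up to exp (- s) - exp (- t), which is below the permitted error exp (-
      s).\<close>
    have "0 \<le> (\<integral>z. (ncount ?h z - ncount ?h' z)\<^sup>2 \<partial>quot)" by (rule Bochner_Integration.integral_nonneg) auto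
    also have "\<dots> = (\<integral>z. ncount ?h z * ncount ?h z + ncount ?h' z * ncount ?h' z - 2 * (ncount ?h z * ncount ?h' z) \<partial>quot)"
      by (intro Bochner_Integration.integral_cong) (auto simp: power2_eq_square algebra_simps)
    also have "\<dots> = corr ?h ?h + corr ?h' ?h' - 2 * corr ?h ?h'"
      unfolding corr_def using int by simp
    also have "\<dots> = exp (- s) + chord_mean (exp (2 * s)) + (exp (- t) + chord_mean (exp (2 * t))) - 2 * (exp (- t) + chord_mean (exp (s + t)))"
      using eq[of s s] eq[of t t] eq[of s t] st by (simp add: max_def)
    finally have "0 \<le> exp (- s) + chord_mean (exp (2 * s)) + (exp (- t) + chord_mean (exp (2 * t))) - 2 * (exp (- t) + chord_mean (exp (s + t)))" .
    moreover have "0 \<le> a + b + (d + c) - 2 * (d + e) \<Longrightarrow> 0 < d \<Longrightarrow> 2 * e \<le> b + c + a" for a b c d e :: real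
      by (simp add: algebra_simps)
    ultimately show ?thesis using exp_gt_zero[of "- t"] by blast
  qed
  ultimately obtain L where L: "((\<lambda>t. chord_mean (exp t)) \<longlongrightarrow> L) at_top"
    by (rule midpoint_convex_bounded_converges[of "\<lambda>t. chord_mean (exp t)"]) blast
  have "((\<lambda>W. chord_mean (exp (ln W))) \<longlongrightarrow> L) at_top"
    by (rule filterlim_compose[OF L ln_at_top])
  moreover have "\<forall>\<^sub>F W in at_top. chord_mean (exp (ln W)) = chord_mean W"
    using eventually_gt_at_top[of 0] by eventually_elim simp
  ultimately have "(chord_mean \<longlongrightarrow> L) at_top" by (rule Lim_transform_eventually)
  then show thesis by (rule that)
qed

end

section \<open>Equidistribution of the orbit counts\<close>

context cusp_lattice
begin

text \<open>The second variable runs over the whole half plane, which by unfolding amounts to half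
  the kernel periodised over the group.\<close>

definition ker_variance :: "real \<Rightarrow> ennreal" where
  "ker_variance h = (\<integral>\<^sup>+z. \<integral>\<^sup>+w. ennreal (ker z w * (ncount h z - ncount h w)\<^sup>2) \<partial>\<mu> \<partial>quot)"

lemma ker_integral_ncount_square:
  assumes h: "0 < h" "h \<le> 1"
  shows "(\<integral>\<^sup>+z. \<integral>\<^sup>+w. ennreal (ker z w * ((ncount h z)\<^sup>2 + (ncount h w)\<^sup>2)) \<partial>\<mu> \<partial>quot)
    = 2 * (ker_mass * ennreal (corr h h))"
proof -
  have e: "(\<integral>\<^sup>+z. ennreal ((ncount h z)\<^sup>2) \<partial>quot) = ennreal (corr h h)"
    unfolding corr_def power2_eq_square using h
    by (intro nn_integral_eq_integral integrable_ncount_ncount) (auto simp: ncount_nonneg)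
  have "(\<integral>\<^sup>+z. \<integral>\<^sup>+w. ennreal (ker z w * ((ncount h z)\<^sup>2 + (ncount h w)\<^sup>2)) \<partial>\<mu> \<partial>quot)
    = (\<integral>\<^sup>+z. \<integral>\<^sup>+w. ennreal (ker z w) * ennreal ((ncount h z)\<^sup>2) + ennreal (ker z w) * ennreal ((ncount h w)\<^sup>2) \<partial>\<mu> \<partial>quot)"
    by (simp add: ennreal_mult distrib_left)
  also have "\<dots> = (\<integral>\<^sup>+z. (\<integral>\<^sup>+w. ennreal (ker z w) \<partial>\<mu>) * ennreal ((ncount h z)\<^sup>2)
       + (\<integral>\<^sup>+w. ennreal (ker z w) * ennreal ((ncount h w)\<^sup>2) \<partial>\<mu>) \<partial>quot)"
    by (simp add: nn_integral_add nn_integral_multc)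
  also have "\<dots> = (\<integral>\<^sup>+z. (\<integral>\<^sup>+w. ennreal (ker z w) \<partial>\<mu>) * ennreal ((ncount h z)\<^sup>2) \<partial>quot)
       + (\<integral>\<^sup>+z. \<integral>\<^sup>+w. ennreal (ker z w) * ennreal ((ncount h w)\<^sup>2) \<partial>\<mu> \<partial>quot)"
    by (rule nn_integral_add) measurable
  also have "(\<integral>\<^sup>+z. (\<integral>\<^sup>+w. ennreal (ker z w) \<partial>\<mu>) * ennreal ((ncount h z)\<^sup>2) \<partial>quot)
      = (\<integral>\<^sup>+z. ker_mass * ennreal ((ncount h z)\<^sup>2) \<partial>quot)"
    using AE_quot by (intro nn_integral_cong_AE) (auto elim!: eventually_mono simp: ker_total_mass)
  also have "\<dots> = ker_mass * ennreal (corr h h)"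
    by (subst nn_integral_cmult) (auto simp: e)
  also have "(\<integral>\<^sup>+z. \<integral>\<^sup>+w. ennreal (ker z w) * ennreal ((ncount h w)\<^sup>2) \<partial>\<mu> \<partial>quot) = ker_mass * ennreal (corr h h)"
    unfolding e[symmetric] by (rule ker_symmetry) (auto simp: ncount_invariant)
  finally show ?thesis by (simp add: mult_2)
qed

text \<open>Smoothing turns the cross term into correlations of heights h and h / Im w. Their term 1
  / max is discarded, and h^2 is split as Im w * (h^2 / Im w) so that the last factor and
  \<open>chord_integral\<close> form \<open>chord_mean (Im w / h^2)\<close>. The statement stays in
  \<open>ennreal\<close> because h / Im w may exceed 1.\<close>

lemma ker_integral_ncount_cross:
  assumes h: "0 < h" "h \<le> 1"
  shows "(\<integral>\<^sup>+w. ennreal (ker \<i> w) * (ennreal (Im w) * (ennreal (h\<^sup>2 / Im w) * chord_integral (Im w / h\<^sup>2))) \<partial>\<mu>)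
    \<le> (\<integral>\<^sup>+z. \<integral>\<^sup>+w. ennreal (ker z w * (ncount h z * ncount h w)) \<partial>\<mu> \<partial>quot)"
proof -
  have "(\<integral>\<^sup>+z. \<integral>\<^sup>+w. ennreal (ker z w * (ncount h z * ncount h w)) \<partial>\<mu> \<partial>quot)
    = (\<integral>\<^sup>+z. \<integral>\<^sup>+w. ennreal (ker \<i> w) * (ennreal ((h / 2)\<^sup>2) * (orbits h z * orbits (h / Im w) z)) \<partial>\<mu> \<partial>quot)"
    using AE_quot
  proof (intro nn_integral_cong_AE, eventually_elim)
    case (elim z)
    have "(\<integral>\<^sup>+w. ennreal (ker z w * (ncount h z * ncount h w)) \<partial>\<mu>)
      = (\<integral>\<^sup>+w. (ennreal ((h / 2)\<^sup>2) * orbits h z) * (ennreal (ker z w) * orbits h w) \<partial>\<mu>)"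
      using AE_upper_half_plane
    proof (intro nn_integral_cong_AE, eventually_elim)
      case (elim w)
      have "ennreal (ker z w * (ncount h z * ncount h w)) = ennreal (ker z w) * ((ennreal (h / 2) * orbits h z) * (ennreal (h / 2) * orbits h w))"
        using h elim \<open>0 < Im z\<close> by (simp add: ennreal_mult ncount_nonneg ncount_eq)
      also have "\<dots> = (ennreal (h / 2) * ennreal (h / 2)) * orbits h z * (ennreal (ker z w) * orbits h w)"
        by (simp only: mult_ac)
      also have "ennreal (h / 2) * ennreal (h / 2) = ennreal ((h / 2)\<^sup>2)"
        unfolding power2_eq_square using h by (intro ennreal_mult[symmetric]) auto
      finally show ?case .
    qed
    also have "\<dots> = (ennreal ((h / 2)\<^sup>2) * orbits h z) * (\<integral>\<^sup>+w. ennreal (ker z w) * orbits h w \<partial>\<mu>)"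
      by (rule nn_integral_cmult) measurable
    also have "\<dots> = (ennreal ((h / 2)\<^sup>2) * orbits h z) * (\<integral>\<^sup>+w. ennreal (ker \<i> w) * orbits (h / Im w) z \<partial>\<mu>)"
      using kernel_smoothing[OF \<open>0 < Im z\<close> h(1)] by simp
    also have "\<dots> = (\<integral>\<^sup>+w. (ennreal ((h / 2)\<^sup>2) * orbits h z) * (ennreal (ker \<i> w) * orbits (h / Im w) z) \<partial>\<mu>)"
      by (rule nn_integral_cmult[symmetric]) measurable
    finally show ?case by (simp only: mult_ac)
  qed
  also have "\<dots> = (\<integral>\<^sup>+w. \<integral>\<^sup>+z. ennreal (ker \<i> w) * (ennreal ((h / 2)\<^sup>2) * (orbits h z * orbits (h / Im w) z)) \<partial>quot \<partial>\<mu>)"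
    by (rule pair_sigma_finite.Fubini')
       (auto simp: pair_sigma_finite_def quot.sigma_finite_measure_axioms hyperbolic_area.sigma_finite_measure_axioms)
  also have "\<dots> \<ge> (\<integral>\<^sup>+w. ennreal (ker \<i> w) * (ennreal (Im w) * (ennreal (h\<^sup>2 / Im w) * chord_integral (Im w / h\<^sup>2))) \<partial>\<mu>)"
    using AE_upper_half_plane
  proof (intro nn_integral_mono_AE, eventually_elim)
    case (elim w)
    let ?v = "Im w"
    have "(\<integral>\<^sup>+z. ennreal (ker \<i> w) * (ennreal ((h / 2)\<^sup>2) * (orbits h z * orbits (h / ?v) z)) \<partial>quot)
      = ennreal (ker \<i> w) * (ennreal ((h / 2)\<^sup>2) * (\<integral>\<^sup>+z. orbits h z * orbits (h / ?v) z \<partial>quot))"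
      by (simp add: nn_integral_cmult)
    also have "\<dots> = ennreal (ker \<i> w) * (ennreal ((h / 2)\<^sup>2) * (4 * (ennreal (1 / max h (h / ?v)) + chord_integral (1 / (h * (h / ?v))))))"
      using elim h by (subst integral_orbits_orbits) auto
    also have "\<dots> \<ge> ennreal (ker \<i> w) * (ennreal ((h / 2)\<^sup>2) * (4 * chord_integral (1 / (h * (h / ?v)))))"
      by (intro mult_left_mono) auto
    also have "1 / (h * (h / ?v)) = ?v / h\<^sup>2" using elim h by (simp add: power2_eq_square)
    also have "ennreal ((h / 2)\<^sup>2) * (4 * chord_integral (?v / h\<^sup>2)) = ennreal (h\<^sup>2) * chord_integral (?v / h\<^sup>2)"
    proof -
      have "ennreal ((h / 2)\<^sup>2) * ennreal 4 = ennreal (h\<^sup>2)"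
        by (subst ennreal_mult[symmetric]) (auto simp: power_divide)
      then show ?thesis by (simp add: mult.assoc[symmetric])
    qed
    also have "ennreal (h\<^sup>2) = ennreal ?v * ennreal (h\<^sup>2 / ?v)"
      using elim by (subst ennreal_mult[symmetric]) auto
    finally show ?case by (simp only: mult.assoc)
  qed
  finally show ?thesis .
qed

text \<open>The square expanded, with the cross term added to the left because subtraction in
  \<open>ennreal\<close> truncates.\<close>

lemma ker_variance_eq:
  assumes h: "0 < h" "h \<le> 1"
  shows "ker_variance h + 2 * (\<integral>\<^sup>+z. \<integral>\<^sup>+w. ennreal (ker z w * (ncount h z * ncount h w)) \<partial>\<mu> \<partial>quot)
    = 2 * (ker_mass * ennreal (corr h h))"
proof -
  have "2 * (\<integral>\<^sup>+z. \<integral>\<^sup>+w. ennreal (ker z w * (ncount h z * ncount h w)) \<partial>\<mu> \<partial>quot)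
    = (\<integral>\<^sup>+z. \<integral>\<^sup>+w. 2 * ennreal (ker z w * (ncount h z * ncount h w)) \<partial>\<mu> \<partial>quot)"
    by (simp add: nn_integral_cmult)
  then have "ker_variance h + 2 * (\<integral>\<^sup>+z. \<integral>\<^sup>+w. ennreal (ker z w * (ncount h z * ncount h w)) \<partial>\<mu> \<partial>quot)
    = (\<integral>\<^sup>+z. \<integral>\<^sup>+w. ennreal (ker z w * (ncount h z - ncount h w)\<^sup>2) + 2 * ennreal (ker z w * (ncount h z * ncount h w)) \<partial>\<mu> \<partial>quot)"
    unfolding ker_variance_def by (simp add: nn_integral_add)
  also have "\<dots> = (\<integral>\<^sup>+z. \<integral>\<^sup>+w. ennreal (ker z w * ((ncount h z)\<^sup>2 + (ncount h w)\<^sup>2)) \<partial>\<mu> \<partial>quot)"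
  proof (intro nn_integral_cong)
    fix z w
    have "ennreal (ker z w * (ncount h z - ncount h w)\<^sup>2) + ennreal 2 * ennreal (ker z w * (ncount h z * ncount h w))
      = ennreal (ker z w * (ncount h z - ncount h w)\<^sup>2 + 2 * (ker z w * (ncount h z * ncount h w)))"
      using h by (subst ennreal_mult[symmetric], (auto simp: ncount_nonneg)[2], subst ennreal_plus[symmetric]) (auto simp: ncount_nonneg)
    also have "ker z w * (ncount h z - ncount h w)\<^sup>2 + 2 * (ker z w * (ncount h z * ncount h w)) = ker z w * ((ncount h z)\<^sup>2 + (ncount h w)\<^sup>2)"
      by (simp add: power2_eq_square algebra_simps)
    finally show "ennreal (ker z w * (ncount h z - ncount h w)\<^sup>2) + 2 * ennreal (ker z w * (ncount h z * ncount h w))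
      = ennreal (ker z w * ((ncount h z)\<^sup>2 + (ncount h w)\<^sup>2))" by simp
  qed
  finally show ?thesis unfolding ker_integral_ncount_square[OF h] .
qed

lemma chord_mean_limit_nonneg:
  assumes k: "(chord_mean \<longlongrightarrow> k) at_top"
  shows "0 \<le> k"
proof (rule tendsto_lowerbound[OF k])
  show "\<forall>\<^sub>F W in at_top. 0 \<le> chord_mean W"
    using eventually_gt_at_top[of 0] by eventually_elim (simp add: chord_mean_def)
qed simp

lemma corr_tendsto:
  assumes k: "(chord_mean \<longlongrightarrow> k) at_top"
  shows "(\<lambda>n. corr (exp (- real n)) (exp (- real n))) \<longlonglongrightarrow> k"
proof -
  have "filterlim (\<lambda>n. 1 / (exp (- real n) * exp (- real n))) at_top sequentially" by real_asymp
  then have "(\<lambda>n. chord_mean (1 / (exp (- real n) * exp (- real n)))) \<longlonglongrightarrow> k"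
    by (rule filterlim_compose[OF k])
  moreover have "(\<lambda>n. exp (- real n)) \<longlonglongrightarrow> 0" by real_asymp
  ultimately have "(\<lambda>n. exp (- real n) + chord_mean (1 / (exp (- real n) * exp (- real n)))) \<longlonglongrightarrow> 0 + k"
    by (intro tendsto_add)
  then show ?thesis by (simp add: corr_eq_real del: mult_exp_exp)
qed

text \<open>The variance is twice the mass times the correlation minus twice the cross term. The
  first part has limit 2 k \<open>ker_mass\<close>, and Fatou's lemma bounds the cross term from
  below by k \<open>ker_mass\<close> in the limit.\<close>

lemma ker_variance_tendsto_0:
  assumes k: "(chord_mean \<longlongrightarrow> k) at_top"
  shows "(\<lambda>n. ker_variance (exp (- real n))) \<longlonglongrightarrow> 0"
proof -
  define h where "h n = exp (- real n)" for n
  have h: "0 < h n" "h n \<le> 1" for n by (auto simp: h_def)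
  define X where "X n = (\<integral>\<^sup>+z. \<integral>\<^sup>+w. ennreal (ker z w * (ncount (h n) z * ncount (h n) w)) \<partial>\<mu> \<partial>quot)" for n
  define Y where "Y n w = ennreal (ker \<i> w) * (ennreal (Im w) * (ennreal ((h n)\<^sup>2 / Im w) * chord_integral (Im w / (h n)\<^sup>2)))" for n w
  have k0: "k \<ge> 0" by (rule chord_mean_limit_nonneg[OF k])
  have [measurable]: "Y n \<in> borel_measurable borel" for n
    unfolding Y_def by measurable
  have Ylim: "(\<lambda>n. Y n w) \<longlonglongrightarrow> ennreal (ker \<i> w) * (ennreal (Im w) * ennreal k)" if w: "Im w > 0" for w
  proof -
    have "filterlim (\<lambda>n. Im w / (h n)\<^sup>2) at_top sequentially"
      unfolding h_def using w by real_asymp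
    then have lim: "(\<lambda>n. chord_mean (Im w / (h n)\<^sup>2)) \<longlonglongrightarrow> k"
      by (rule filterlim_compose[OF k])
    have "(\<lambda>n. ennreal (ker \<i> w) * (ennreal (Im w) * ennreal (chord_mean (Im w / (h n)\<^sup>2)))) \<longlonglongrightarrow> ennreal (ker \<i> w) * (ennreal (Im w) * ennreal k)"
      by (intro ennreal_tendsto_cmult tendsto_ennrealI lim) auto
    moreover have "\<forall>\<^sub>F n in sequentially. ennreal (ker \<i> w) * (ennreal (Im w) * ennreal (chord_mean (Im w / (h n)\<^sup>2))) = Y n w"
    proof -
      have "\<forall>\<^sub>F n in sequentially. 1 \<le> Im w / (h n)\<^sup>2"
        using \<open>filterlim (\<lambda>n. Im w / (h n)\<^sup>2) at_top sequentially\<close> unfolding filterlim_at_top by blast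
      then show ?thesis
      proof eventually_elim
        case (elim n)
        have "ennreal (chord_mean (Im w / (h n)\<^sup>2)) = ennreal ((h n)\<^sup>2 / Im w) * ennreal (enn2real (chord_integral (Im w / (h n)\<^sup>2)))"
          unfolding chord_mean_def using w by (subst ennreal_mult[symmetric]) (auto simp: mult.commute)
        then show ?case unfolding Y_def using chord_integral_finite[OF elim] by simp
      qed
    qed
    ultimately show ?thesis by (rule Lim_transform_eventually)
  qed
  \<comment> \<open>The pointwise limit of the integrands carries the extra factor Im w from the
    rescaling; \<open>ker_mass_Im\<close> makes its integral agree with the limit of the square
    terms.\<close>
  have "ker_mass * ennreal k = (\<integral>\<^sup>+w. ennreal (ker \<i> w) * (ennreal (Im w) * ennreal k) \<partial>\<mu>)"
  proof -
    have "ker_mass = (\<integral>\<^sup>+w. ennreal (ker \<i> w) * ennreal (Im w) \<partial>\<mu>)"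
      unfolding ker_mass_Im[symmetric] by (simp add: ennreal_mult')
    moreover have "(\<integral>\<^sup>+w. ennreal (ker \<i> w) * ennreal (Im w) * ennreal k \<partial>\<mu>)
        = (\<integral>\<^sup>+w. ennreal (ker \<i> w) * ennreal (Im w) \<partial>\<mu>) * ennreal k"
      by (rule nn_integral_multc) measurable
    ultimately show ?thesis by (simp only: mult.assoc)
  qed
  also have "\<dots> = (\<integral>\<^sup>+w. liminf (\<lambda>n. Y n w) \<partial>\<mu>)"
    using AE_upper_half_plane
    by (intro nn_integral_cong_AE) (auto elim!: eventually_mono simp: lim_imp_Liminf[OF _ Ylim])
  also have "\<dots> \<le> liminf (\<lambda>n. \<integral>\<^sup>+w. Y n w \<partial>\<mu>)"
    by (rule nn_integral_liminf) measurable
  also have "\<dots> \<le> liminf X"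
    unfolding X_def Y_def by (intro Liminf_mono always_eventually allI ker_integral_ncount_cross h)
  finally have liminf: "ker_mass * ennreal k \<le> liminf X" .
  have corr: "(\<lambda>n. corr (h n) (h n)) \<longlonglongrightarrow> k"
    unfolding h_def by (rule corr_tendsto[OF k])
  obtain m where m: "ker_mass = ennreal m" "m \<ge> 0"
    using ker_mass_finite by (metis ennreal_cases infinity_ennreal_def less_irrefl)
  have corr_nonneg: "0 \<le> corr (h n) (h n)" for n
    using h by (simp add: corr_eq_real chord_mean_def add_nonneg_nonneg less_imp_le)
  have eq: "ker_variance (h n) + 2 * X n = ennreal (2 * (m * corr (h n) (h n)))" for n
    using ker_variance_eq[OF h, of n] m corr_nonneg[of n] unfolding X_def by (simp add: ennreal_mult)
  define x where "x n = enn2real (X n)" for n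
  have fin: "ker_variance (h n) < \<infinity>" "2 * X n < \<infinity>" for n
    using eq[of n] by (metis ennreal_add_eq_top ennreal_neq_top infinity_ennreal_def less_top)+
  have X: "X n = ennreal (x n)" for n
    using fin(2)[of n] by (auto simp: x_def ennreal_mult_less_top)
  have var: "ker_variance (h n) = ennreal (2 * (m * corr (h n) (h n)) - 2 * x n)" for n
  proof -
    obtain v where v: "ker_variance (h n) = ennreal v" "0 \<le> v"
      using fin(1)[of n] by (cases "ker_variance (h n)") auto
    have x0: "0 \<le> x n" by (simp add: x_def)
    have "ennreal (v + 2 * x n) = ennreal v + 2 * X n"
      using v(2) x0 by (simp add: X ennreal_mult)
    also have "\<dots> = ennreal (2 * (m * corr (h n) (h n)))" using eq[of n] v(1) by simp
    finally have "v + 2 * x n = 2 * (m * corr (h n) (h n))"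
      using v(2) x0 m(2) corr_nonneg[of n] by (subst (asm) ennreal_inj) auto
    then have "v = 2 * (m * corr (h n) (h n)) - 2 * x n" by simp
    then show ?thesis using v(1) by simp
  qed
  \<comment> \<open>Only an upper bound has to be proved for the truncated difference, and
    \<open>ennreal\<close> sends a real number and its positive part to the same value.\<close>
  have "(\<lambda>n. max 0 (2 * (m * corr (h n) (h n)) - 2 * x n)) \<longlonglongrightarrow> 0"
  proof (rule tendstoI)
    fix e :: real assume e: "e > 0"
    have "(\<lambda>n. 2 * (m * corr (h n) (h n))) \<longlonglongrightarrow> 2 * (m * k)"
      by (intro tendsto_mult_left corr)
    then have "\<forall>\<^sub>F n in sequentially. 2 * (m * corr (h n) (h n)) < 2 * (m * k) + e / 2"
      using e by (simp add: order_tendsto_iff)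
    moreover have "\<forall>\<^sub>F n in sequentially. m * k - e / 4 < x n"
    proof (cases "m * k - e / 4 < 0")
      case True
      then show ?thesis unfolding x_def
        by (intro always_eventually allI order_less_le_trans[OF True]) auto
    next
      case False
      then have "ennreal (m * k - e / 4) < ennreal (m * k)"
        using e by (intro ennreal_lessI) (auto simp: not_less)
      also have "\<dots> \<le> liminf X" using liminf m k0 by (simp add: ennreal_mult)
      finally have "\<forall>\<^sub>F n in sequentially. ennreal (m * k - e / 4) < X n"
        by (rule less_LiminfD)
      then show ?thesis using False
        by (auto elim!: eventually_mono simp: X ennreal_less_iff)
    qed
    ultimately show "\<forall>\<^sub>F n in sequentially. dist (max 0 (2 * (m * corr (h n) (h n)) - 2 * x n)) 0 < e"
      by eventually_elim (use e in \<open>auto simp: dist_real_def max_def\<close>)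
  qed
  then have "(\<lambda>n. ennreal (max 0 (2 * (m * corr (h n) (h n)) - 2 * x n))) \<longlonglongrightarrow> ennreal 0"
    by (rule tendsto_ennrealI)
  moreover have "ennreal (max 0 y) = ennreal y" for y by (simp add: max_def ennreal_neg)
  ultimately have "(\<lambda>n. ker_variance (h n)) \<longlonglongrightarrow> ennreal 0" by (simp only: var)
  then show ?thesis by (simp add: h_def)
qed

text \<open>On two copies of the quotient the unweighted variance is exactly 2 V corr - 2. The
  weighted one tends to 0, hence so does its integrand almost everywhere along a subsequence;
  dividing by the positive kernel and dominating by C^2 makes the unweighted one tend to 0 as well,
  so 2 V k = 2.\<close>

lemma limit_times_area:
  assumes k: "(chord_mean \<longlongrightarrow> k) at_top"
  shows "k * measure quot UNIV = 1"
proof -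
  let ?Q = "quot \<Otimes>\<^sub>M quot"
  define h where "h n = exp (- real n)" for n
  have h: "0 < h n" "h n \<le> 1" for n by (auto simp: h_def)
  define V where "V = measure quot UNIV"
  obtain C where C: "C > 0" "\<And>h z. 0 < h \<Longrightarrow> 0 \<le> ncount h z" "\<And>h z. 0 < h \<Longrightarrow> h \<le> 1 \<Longrightarrow> 0 < Im z \<Longrightarrow> ncount h z \<le> C"
    by (rule ncount_bounded) blast
  interpret MM: pair_sigma_finite quot quot ..
  interpret MM: finite_measure ?Q by (rule finite_measure_pair_measure) unfold_locales
  define D where "D n p = (ncount (h n) (fst p) - ncount (h n) (snd p))\<^sup>2" for n p
  have AE2: "AE p in ?Q. 0 < Im (fst p) \<and> 0 < Im (snd p)"
  proof (rule MM.AE_pair_measure)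
    show "{p \<in> space ?Q. 0 < Im (fst p) \<and> 0 < Im (snd p)} \<in> sets ?Q"
      by measurable
    show "AE z in quot. AE w in quot. 0 < Im (fst (z, w)) \<and> 0 < Im (snd (z, w))"
      using AE_quot by eventually_elim (use AE_quot in auto)
  qed
  have D_bound: "\<bar>ncount (h n) z - ncount (h n) w\<bar> \<le> C" if "0 < Im z" "0 < Im w" for n z w
    using C(2)[OF h(1), of n z] C(2)[OF h(1), of n w] C(3)[OF h that(1), of n] C(3)[OF h that(2), of n] by simp
  have D_meas [measurable]: "D n \<in> borel_measurable ?Q" for n
    unfolding D_def by measurable
  \<comment> \<open>The cross term factors over the product space into two integrals equal to 1,
    which accounts for the -2.\<close>
  have D_int: "(\<integral>p. D n p \<partial>?Q) = 2 * V * corr (h n) (h n) - 2" for n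
  proof -
    have "integrable ?Q (D n)"
    proof (rule MM.integrable_const_bound[where B = "C\<^sup>2"])
      show "AE p in ?Q. norm (D n p) \<le> C\<^sup>2"
        using AE2 by eventually_elim (use C in \<open>auto simp: D_def intro!: abs_le_square_iff[THEN iffD1] D_bound[THEN order_trans]\<close>)
    qed measurable
    then have "(\<integral>p. D n p \<partial>?Q) = (\<integral>z. \<integral>w. D n (z, w) \<partial>quot \<partial>quot)"
      by (rule MM.integral_fst'[symmetric])
    also have "\<dots> = (\<integral>z. V * (ncount (h n) z * ncount (h n) z) - 2 * ncount (h n) z + corr (h n) (h n) \<partial>quot)"
    proof (intro Bochner_Integration.integral_cong refl)
      fix z
      have "(\<integral>w. D n (z, w) \<partial>quot) = (\<integral>w. ncount (h n) z * ncount (h n) z - 2 * ncount (h n) z * ncount (h n) w + ncount (h n) w * ncount (h n) w \<partial>quot)"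
        by (intro Bochner_Integration.integral_cong) (auto simp: D_def power2_eq_square algebra_simps)
      also have "\<dots> = V * (ncount (h n) z * ncount (h n) z) - 2 * ncount (h n) z + corr (h n) (h n)"
        using integrable_ncount[OF h, of n] integrable_ncount_ncount[OF h h, of n n] h
        by (simp add: V_def corr_def integral_ncount)
      finally show "(\<integral>w. D n (z, w) \<partial>quot) = V * (ncount (h n) z * ncount (h n) z) - 2 * ncount (h n) z + corr (h n) (h n)" .
    qed
    also have "\<dots> = 2 * V * corr (h n) (h n) - 2"
      using integrable_ncount[OF h, of n] integrable_ncount_ncount[OF h h, of n n] h
      by (simp add: V_def corr_def[symmetric] integral_ncount)
    finally show ?thesis .
  qed
  define G where "G n p = ker (fst p) (snd p) * D n p" for n p
  have G_meas [measurable]: "G n \<in> borel_measurable ?Q" for n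
    unfolding G_def by measurable
  have G_le: "(\<integral>\<^sup>+p. ennreal (G n p) \<partial>?Q) \<le> ker_variance (h n)" for n
  proof -
    have "(\<integral>\<^sup>+p. ennreal (G n p) \<partial>?Q) = (\<integral>\<^sup>+z. \<integral>\<^sup>+w. ennreal (G n (z, w)) \<partial>quot \<partial>quot)"
      by (rule quot.nn_integral_fst[symmetric]) measurable
    also have "\<dots> \<le> (\<integral>\<^sup>+z. \<integral>\<^sup>+w. ennreal (G n (z, w)) \<partial>\<mu> \<partial>quot)"
    proof (intro nn_integral_mono)
      fix z
      have "(\<integral>\<^sup>+w. ennreal (G n (z, w)) \<partial>quot) = (\<integral>\<^sup>+w. indicator F w * ennreal (G n (z, w)) \<partial>\<mu>)"
        unfolding G_def D_def fst_conv snd_conv by (rule nn_integral_quot) measurable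
      also have "\<dots> \<le> (\<integral>\<^sup>+w. ennreal (G n (z, w)) \<partial>\<mu>)"
        by (intro nn_integral_mono) (auto split: split_indicator)
      finally show "(\<integral>\<^sup>+w. ennreal (G n (z, w)) \<partial>quot) \<le> (\<integral>\<^sup>+w. ennreal (G n (z, w)) \<partial>\<mu>)" .
    qed
    finally show ?thesis by (simp add: ker_variance_def G_def D_def)
  qed
  have "(\<lambda>n. \<integral>\<^sup>+p. ennreal (G n p) \<partial>?Q) \<longlonglongrightarrow> 0"
    by (rule tendsto_sandwich[OF _ _ tendsto_const ker_variance_tendsto_0[OF k]])
       (use G_le in \<open>auto simp: h_def\<close>)
  then obtain r :: "nat \<Rightarrow> nat" where r: "strict_mono r" "AE p in ?Q. (\<lambda>n. G (r n) p) \<longlonglongrightarrow> 0"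
  proof -
    assume lim: "(\<lambda>n. \<integral>\<^sup>+p. ennreal (G n p) \<partial>?Q) \<longlonglongrightarrow> 0"
      and that: "\<And>r. strict_mono r \<Longrightarrow> AE p in ?Q. (\<lambda>n. G (r n) p) \<longlonglongrightarrow> 0 \<Longrightarrow> thesis"
    have G0: "0 \<le> G n p" for n p by (simp add: G_def D_def)
    \<comment> \<open>Convergence to 0 makes the integrals finite from some index on; skipping the
      earlier terms gives the integrability that the subsequence theorem asks for.\<close>
    obtain n0 where n0: "\<And>n. n \<ge> n0 \<Longrightarrow> (\<integral>\<^sup>+p. ennreal (G n p) \<partial>?Q) < 1"
      using order_tendstoD(2)[OF lim, of 1] by (auto simp: eventually_sequentially)
    have int: "integrable ?Q (G (n + n0))" for n
      using n0[of "n + n0"] G0 by (intro integrableI_nonneg) (auto intro: order_less_trans)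
    have "(\<lambda>n. \<integral>\<^sup>+p. ennreal (G (n + n0) p) \<partial>?Q) \<longlonglongrightarrow> 0"
      using lim by (rule LIMSEQ_ignore_initial_segment)
    then have "(\<lambda>n. ennreal (\<integral>p. norm (G (n + n0) p) \<partial>?Q)) \<longlonglongrightarrow> ennreal 0"
      using nn_integral_eq_integral[OF int] G0 by simp
    then have "(\<lambda>n. \<integral>p. norm (G (n + n0) p) \<partial>?Q) \<longlonglongrightarrow> 0"
      by (subst (asm) tendsto_ennreal_iff) auto
    from tendsto_L1_AE_subseq[OF int this] obtain r where r: "strict_mono r"
      "AE p in ?Q. (\<lambda>n. G (r n + n0) p) \<longlonglongrightarrow> 0" by auto
    show thesis by (rule that[of "\<lambda>n. r n + n0"]) (use r in \<open>auto simp: strict_mono_def\<close>)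
  qed
  have "(\<lambda>n. \<integral>p. D (r n) p \<partial>?Q) \<longlonglongrightarrow> (\<integral>p. 0 \<partial>?Q)"
  proof (rule integral_dominated_convergence[where w = "\<lambda>_. C\<^sup>2"])
    show "AE p in ?Q. (\<lambda>n. D (r n) p) \<longlonglongrightarrow> 0"
      using r(2) AE2
    proof eventually_elim
      case (elim p)
      then have kp: "ker (fst p) (snd p) > 0" by (intro ker_pos) auto
      have "(\<lambda>n. G (r n) p / ker (fst p) (snd p)) \<longlonglongrightarrow> 0 / ker (fst p) (snd p)"
        using elim kp by (intro tendsto_divide tendsto_const) auto
      then show ?case using kp by (simp add: G_def)
    qed
    show "AE p in ?Q. norm (D (r n) p) \<le> C\<^sup>2" for n
      using AE2 by eventually_elim (use C in \<open>auto simp: D_def intro!: abs_le_square_iff[THEN iffD1] D_bound[THEN order_trans]\<close>)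
  qed auto
  then have "(\<lambda>n. 2 * V * corr (h (r n)) (h (r n)) - 2) \<longlonglongrightarrow> 0" by (simp add: D_int)
  moreover have "(\<lambda>n. 2 * V * corr (h (r n)) (h (r n)) - 2) \<longlonglongrightarrow> 2 * V * k - 2"
  proof -
    have "(\<lambda>n. corr (h n) (h n)) \<longlonglongrightarrow> k" unfolding h_def by (rule corr_tendsto[OF k])
    then have "(\<lambda>n. corr (h (r n)) (h (r n))) \<longlonglongrightarrow> k" using LIMSEQ_subseq_LIMSEQ[OF _ r(1)] by (auto simp: o_def)
    then show ?thesis by (intro tendsto_intros)
  qed
  ultimately have "2 * V * k - 2 = 0" by (rule LIMSEQ_unique[rotated])
  then show ?thesis by (simp add: V_def mult.commute)
qed

end

section \<open>A Tauberian lemma and an Abel transform\<close>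

text \<open>The two inequalities are what an increasing a yields when I has derivative a(x) / x^j.
  Comparing X with l X and with X / l for fixed l > 1 gives bounds l^j k and k / l^j, and l is taken
  close to 1. It is applied with j = 1 to \<open>csum\<close> and with j = 2 to the count.\<close>

lemma monotone_tauberian:
  fixes a I :: "real \<Rightarrow> real" and j :: nat
  assumes ineq: "\<And>X Y. 1 \<le> X \<Longrightarrow> X \<le> Y \<Longrightarrow> a X * ((Y - X) / Y ^ j) \<le> I Y - I X"
    "\<And>X Y. 1 \<le> X \<Longrightarrow> X \<le> Y \<Longrightarrow> I Y - I X \<le> a Y * ((Y - X) / X ^ j)"
    and lim: "((\<lambda>X. I X / X) \<longlongrightarrow> k) at_top"
  shows "((\<lambda>X. a X / X ^ j) \<longlongrightarrow> k) at_top"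
proof (rule order_tendstoI)
  fix u assume u: "k < u"
  have "((\<lambda>l. l ^ j * k) \<longlongrightarrow> 1 ^ j * k) (at_right 1)" by (intro tendsto_intros)
  then have "\<forall>\<^sub>F l in at_right 1. l ^ j * k < u" using u by (simp add: order_tendsto_iff)
  then obtain l where l: "1 < l" "l ^ j * k < u"
    using eventually_happens[OF eventually_conj[OF eventually_at_right_less]] by (metis trivial_limit_at_right_real)
  have "((\<lambda>X. I (l * X) / (l * X)) \<longlongrightarrow> k) at_top"
    using l by (intro filterlim_compose[OF lim] filterlim_tendsto_pos_mult_at_top[OF tendsto_const _ filterlim_ident]) auto
  then have "((\<lambda>X. l ^ j / (l - 1) * (l * (I (l * X) / (l * X)) - I X / X)) \<longlongrightarrow> l ^ j / (l - 1) * (l * k - k)) at_top"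
    by (intro tendsto_intros lim)
  also have "l ^ j / (l - 1) * (l * k - k) = l ^ j * k" using l by (simp add: field_simps)
  finally have "\<forall>\<^sub>F X in at_top. l ^ j / (l - 1) * (l * (I (l * X) / (l * X)) - I X / X) < u"
    using l by (simp add: order_tendsto_iff)
  with eventually_ge_at_top[of 1] show "\<forall>\<^sub>F X in at_top. a X / X ^ j < u"
  proof eventually_elim
    case (elim X)
    have "a X * ((l * X - X) / (l * X) ^ j) \<le> I (l * X) - I X"
      using elim l by (intro ineq(1)) auto
    also have "a X * ((l * X - X) / (l * X) ^ j) = (a X / X ^ j) * ((l - 1) / l ^ j * X)"
      using elim l by (simp add: field_simps power_mult_distrib)
    finally have "a X / X ^ j \<le> (I (l * X) - I X) / ((l - 1) / l ^ j * X)"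
      using elim l by (subst pos_le_divide_eq) auto
    also have "\<dots> = l ^ j / (l - 1) * (l * (I (l * X) / (l * X)) - I X / X)"
      using elim l by (simp add: field_simps)
    finally show ?case using elim by simp
  qed
next
  fix u assume u: "u < k"
  have "((\<lambda>l. k / l ^ j) \<longlongrightarrow> k / 1 ^ j) (at_right 1)" by (intro tendsto_intros) auto
  then have "\<forall>\<^sub>F l in at_right 1. u < k / l ^ j" using u by (simp add: order_tendsto_iff)
  then obtain l where l: "1 < l" "u < k / l ^ j"
    using eventually_happens[OF eventually_conj[OF eventually_at_right_less]] by (metis trivial_limit_at_right_real)
  have flim: "filterlim (\<lambda>X. X / l) at_top at_top"
    using l filterlim_tendsto_pos_mult_at_top[OF tendsto_const[of "1 / l"] _ filterlim_ident[of at_top]] by simp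
  then have "((\<lambda>X. I (X / l) / (X / l)) \<longlongrightarrow> k) at_top"
    by (intro filterlim_compose[OF lim])
  then have "((\<lambda>X. (I X / X - (I (X / l) / (X / l)) / l) / ((1 - 1 / l) * l ^ j)) \<longlongrightarrow> (k - k / l) / ((1 - 1 / l) * l ^ j)) at_top"
    using l by (intro tendsto_intros lim) auto
  also have "(k - k / l) / ((1 - 1 / l) * l ^ j) = k / l ^ j" using l by (simp add: field_simps)
  finally have "\<forall>\<^sub>F X in at_top. u < (I X / X - (I (X / l) / (X / l)) / l) / ((1 - 1 / l) * l ^ j)"
    using l by (simp add: order_tendsto_iff)
  moreover have "\<forall>\<^sub>F X in at_top. 1 \<le> X / l" using flim unfolding filterlim_at_top by blast
  ultimately show "\<forall>\<^sub>F X in at_top. u < a X / X ^ j"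
    using eventually_gt_at_top[of 0]
  proof eventually_elim
    case (elim X)
    have "(I X / X - (I (X / l) / (X / l)) / l) / ((1 - 1 / l) * l ^ j) = (I X - I (X / l)) / ((1 - 1 / l) * l ^ j * X)"
      using elim l by (simp add: field_simps)
    also have "\<dots> \<le> a X / X ^ j"
    proof -
      have "I X - I (X / l) \<le> a X * ((X - X / l) / (X / l) ^ j)"
        using elim l by (intro ineq(2)) (auto simp: field_simps)
      also have "\<dots> = a X / X ^ j * ((1 - 1 / l) * l ^ j * X)"
        using elim l by (simp add: field_simps power_divide)
      finally show ?thesis using elim l by (subst pos_divide_le_eq) auto
    qed
    finally show ?case using elim by simp
  qed
qed

text \<open>Multiplying numerator and denominator by the root gives R^2 - y^2 = (1 + R^2) - (1 +
  y^2) on top; the two pieces integrate to the two arcsines in \<open>G\<close>.\<close>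

lemma has_integral_chord_average:
  assumes R: "R > 0"
  shows "((\<lambda>y. 2 * sqrt (R\<^sup>2 - y\<^sup>2) / (1 + y\<^sup>2)) has_integral 2 * pi * (sqrt (1 + R\<^sup>2) - 1)) {- R..R}"
proof -
  define s where "s = sqrt (1 + R\<^sup>2)"
  define g where "g y = s * y / (R * sqrt (1 + y\<^sup>2))" for y
  define G where "G y = 2 * (s * arcsin (g y) - arcsin (y / R))" for y
  have p: "0 < 1 + y\<^sup>2" for y :: real by (smt (verit) zero_le_power2)
  have s: "s > 0" "s\<^sup>2 = 1 + R\<^sup>2" using p[of R] by (auto simp: s_def)
  have g1: "1 - (g y)\<^sup>2 = (R\<^sup>2 - y\<^sup>2) / (R\<^sup>2 * (1 + y\<^sup>2))" for y
  proof -
    have "(g y)\<^sup>2 = (1 + R\<^sup>2) * y\<^sup>2 / (R\<^sup>2 * (1 + y\<^sup>2))"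
      using p[of y] s by (simp add: g_def power_mult_distrib power_divide less_imp_le)
    then have "1 - (g y)\<^sup>2 = (R\<^sup>2 * (1 + y\<^sup>2) - (1 + R\<^sup>2) * y\<^sup>2) / (R\<^sup>2 * (1 + y\<^sup>2))"
      using p[of y] R by (simp add: diff_divide_distrib)
    then show ?thesis by (simp add: algebra_simps)
  qed
  have g_le: "\<bar>g y\<bar> \<le> 1" if "\<bar>y\<bar> \<le> R" for y
  proof -
    have "y\<^sup>2 \<le> R\<^sup>2" using that R by (simp add: abs_le_square_iff[symmetric])
    then have "0 \<le> 1 - (g y)\<^sup>2" unfolding g1 using p[of y] by auto
    then show ?thesis by (simp add: abs_square_le_1)
  qed
  have ends: "G R = pi * (s - 1)" "G (- R) = - (pi * (s - 1))"
    using R s by (simp_all add: G_def g_def s_def[symmetric] arcsin_minus algebra_simps)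
  \<comment> \<open>At y = R and y = - R both arcsines have argument 1 or -1, where they are
    continuous but not differentiable, hence the interior form of the theorem.\<close>
  have "((\<lambda>y. 2 * sqrt (R\<^sup>2 - y\<^sup>2) / (1 + y\<^sup>2)) has_integral (G R - G (- R))) {- R..R}"
  proof (rule fundamental_theorem_of_calculus_interior)
    show "continuous_on {- R..R} G"
      unfolding G_def
    proof (intro continuous_intros)
      show "continuous_on {- R..R} g"
        unfolding g_def using p R by (intro continuous_intros) (auto simp: less_imp_neq[symmetric])
      show "\<forall>x\<in>{- R..R}. - 1 \<le> g x \<and> g x \<le> 1" using g_le by (auto simp: abs_le_iff)
      show "\<forall>x\<in>{- R..R}. - 1 \<le> x / R \<and> x / R \<le> 1"
        using R by (auto simp: pos_le_divide_eq pos_divide_le_eq)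
    qed (use R in auto)
    fix y assume y: "y \<in> {- R<..<R}"
    define q where "q = sqrt (R\<^sup>2 - y\<^sup>2)"
    define t where "t = sqrt (1 + y\<^sup>2)"
    have "\<bar>y\<bar>\<^sup>2 < R\<^sup>2" by (rule power_strict_mono) (use y in auto)
    then have y2: "y\<^sup>2 < R\<^sup>2" by simp
    have q: "q > 0" "q\<^sup>2 = R\<^sup>2 - y\<^sup>2" using y2 by (auto simp: q_def)
    have t: "t > 0" "t\<^sup>2 = 1 + y\<^sup>2" using p[of y] by (auto simp: t_def)
    have dg: "(g has_real_derivative s / (R * t ^ 3)) (at y)"
    proof -
      have "(g has_real_derivative (s * (R * t) - s * y * (R * (y / t))) / (R * t)\<^sup>2) (at y)"
        unfolding g_def t_def using p[of y] R
        by (auto intro!: derivative_eq_intros simp: field_simps power2_eq_square)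
      also have "(s * (R * t) - s * y * (R * (y / t))) = s * R * ((t\<^sup>2 - y\<^sup>2) / t)"
        using t(1) by (simp add: field_simps power2_eq_square)
      also have "t\<^sup>2 - y\<^sup>2 = 1" using t by simp
      also have "s * R * (1 / t) / (R * t)\<^sup>2 = s / (R * t ^ 3)"
        using R t(1) by (simp add: field_simps power2_eq_square power3_eq_cube)
      finally show ?thesis .
    qed
    have sg: "sqrt (1 - (g y)\<^sup>2) = q / (R * t)"
      unfolding g1 using R by (simp add: q_def t_def real_sqrt_divide real_sqrt_mult)
    have g_lt: "- 1 < g y" "g y < 1"
    proof -
      have "0 < 1 - (g y)\<^sup>2" unfolding g1 using y2 p[of y] R by simp
      then have "\<bar>g y\<bar> < 1" by (simp add: abs_square_less_1)
      then show "- 1 < g y" "g y < 1" by auto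
    qed
    have sy: "sqrt (1 - (y / R)\<^sup>2) = q / R"
    proof -
      have "1 - (y / R)\<^sup>2 = (R\<^sup>2 - y\<^sup>2) / R\<^sup>2" using R by (simp add: field_simps power_divide)
      then show ?thesis using R by (simp add: q_def real_sqrt_divide)
    qed
    have "(G has_real_derivative 2 * (s * (inverse (sqrt (1 - (g y)\<^sup>2)) * (s / (R * t ^ 3))) - inverse (sqrt (1 - (y / R)\<^sup>2)) * (1 / R))) (at y)"
      unfolding G_def
      by (intro DERIV_cmult DERIV_diff DERIV_chain2[OF DERIV_arcsin dg] DERIV_chain2[OF DERIV_arcsin] g_lt)
         (use y R in \<open>auto simp: field_simps intro!: derivative_eq_intros\<close>)
    also have "2 * (s * (inverse (sqrt (1 - (g y)\<^sup>2)) * (s / (R * t ^ 3))) - inverse (sqrt (1 - (y / R)\<^sup>2)) * (1 / R))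
       = 2 * ((s\<^sup>2 - t\<^sup>2) / (t\<^sup>2 * q))"
      unfolding sg sy using R q(1) t(1) by (simp add: field_simps power2_eq_square power3_eq_cube)
    also have "s\<^sup>2 - t\<^sup>2 = q\<^sup>2" using s t q by simp
    also have "2 * (q\<^sup>2 / (t\<^sup>2 * q)) = 2 * sqrt (R\<^sup>2 - y\<^sup>2) / (1 + y\<^sup>2)"
      unfolding t(2) q_def[symmetric] using q(1) by (simp add: power2_eq_square[of q])
    finally show "(G has_vector_derivative 2 * sqrt (R\<^sup>2 - y\<^sup>2) / (1 + y\<^sup>2)) (at y)"
      by (simp add: has_real_derivative_iff_has_vector_derivative)
  qed (use R in auto)
  then show ?thesis unfolding ends by (simp add: s_def algebra_simps)
qed

text \<open>The Abel transform acts like a half-order integration: \<open>chord\<close> vanishes to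
  order 1/2 at w = 1, the average to order 1, and the average is piecewise linear in sqrt w.\<close>

lemma nn_integral_chord_average:
  "(\<integral>\<^sup>+y. ennreal (chord (w / (1 + y\<^sup>2)) / sqrt (1 + y\<^sup>2)) \<partial>lborel) = ennreal (2 * pi * max 0 (sqrt w - 1))"
proof (cases "w > 1")
  case True
  define R where "R = sqrt (w - 1)"
  have R: "R > 0" "R\<^sup>2 = w - 1" using True by (auto simp: R_def)
  have p: "0 < 1 + y\<^sup>2" for y :: real by (smt (verit) zero_le_power2)
  have eq: "chord (w / (1 + y\<^sup>2)) / sqrt (1 + y\<^sup>2) = (if y \<in> {- R..R} then 2 * sqrt (R\<^sup>2 - y\<^sup>2) / (1 + y\<^sup>2) else 0)" for y
  proof -
    have e: "w / (1 + y\<^sup>2) - 1 = (R\<^sup>2 - y\<^sup>2) / (1 + y\<^sup>2)" using p[of y] R by (simp add: field_simps)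
    have iff: "y \<in> {- R..R} \<longleftrightarrow> 0 \<le> R\<^sup>2 - y\<^sup>2"
      using R(1) by (auto simp: abs_le_square_iff[symmetric] abs_le_iff)
    show ?thesis
    proof (cases "0 \<le> R\<^sup>2 - y\<^sup>2")
      case True
      have "chord (w / (1 + y\<^sup>2)) / sqrt (1 + y\<^sup>2) = 2 * (sqrt (R\<^sup>2 - y\<^sup>2) / (sqrt (1 + y\<^sup>2) * sqrt (1 + y\<^sup>2)))"
        unfolding chord_def e using True p[of y] by (simp add: max_absorb2 real_sqrt_divide)
      then show ?thesis using True p[of y] by (simp only: iff) simp
    next
      case False
      then have "(R\<^sup>2 - y\<^sup>2) / (1 + y\<^sup>2) \<le> 0" using p[of y] by (simp add: divide_nonpos_pos)
      then show ?thesis unfolding chord_def e iff using False by (simp add: max_absorb1)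
    qed
  qed
  have "((\<lambda>y. chord (w / (1 + y\<^sup>2)) / sqrt (1 + y\<^sup>2)) has_integral 2 * pi * (sqrt (1 + R\<^sup>2) - 1)) UNIV"
    unfolding eq has_integral_restrict_UNIV by (rule has_integral_chord_average[OF R(1)])
  then have "(\<integral>\<^sup>+y. ennreal (chord (w / (1 + y\<^sup>2)) / sqrt (1 + y\<^sup>2)) \<partial>lborel) = ennreal (2 * pi * (sqrt (1 + R\<^sup>2) - 1))"
    using p by (intro nn_integral_has_integral_lborel) (auto simp: less_imp_le)
  then show ?thesis using R True by (simp add: max_absorb2)
next
  case False
  have "chord (w / (1 + y\<^sup>2)) = 0" for y
  proof -
    have "0 < 1 + y\<^sup>2" by (smt (verit) zero_le_power2)
    then have "w / (1 + y\<^sup>2) \<le> 1" using False by (simp add: divide_le_eq) (smt (verit) zero_le_power2)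
    then show ?thesis by (simp add: chord_def max_absorb1)
  qed
  then show ?thesis using False by (simp add: max_absorb1)
qed

text \<open>The same average applied to a linear function; \<open>y / sqrt (1 + y^2)\<close> is an
  antiderivative.\<close>

lemma integral_one_plus_square_three_halves:
  "(\<integral>\<^sup>+y. ennreal (1 / ((1 + y\<^sup>2) * sqrt (1 + y\<^sup>2))) \<partial>lborel) = ennreal 2"
proof -
  have p: "0 < 1 + y\<^sup>2" for y :: real by (smt (verit) zero_le_power2)
  have "(\<integral>\<^sup>+y. ennreal (1 / ((1 + y\<^sup>2) * sqrt (1 + y\<^sup>2))) * indicator {0..} y \<partial>lborel) = ennreal (1 - 0 / sqrt (1 + 0\<^sup>2))"
  proof (rule nn_integral_FTC_atLeast)
    show "((\<lambda>y. y / sqrt (1 + y\<^sup>2)) has_real_derivative 1 / ((1 + y\<^sup>2) * sqrt (1 + y\<^sup>2))) (at y)" for y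
    proof -
      define t where "t = sqrt (1 + y\<^sup>2)"
      have t: "t > 0" "t\<^sup>2 = 1 + y\<^sup>2" using p[of y] by (auto simp: t_def)
      have "((\<lambda>y. y / sqrt (1 + y\<^sup>2)) has_real_derivative (t - y * (y / t)) / t\<^sup>2) (at y)"
        unfolding t_def using p[of y] by (auto intro!: derivative_eq_intros simp: field_simps power2_eq_square)
      also have "t - y * (y / t) = (t\<^sup>2 - y\<^sup>2) / t" using t(1) by (simp add: field_simps power2_eq_square)
      also have "t\<^sup>2 - y\<^sup>2 = 1" using t by simp
      finally show ?thesis using t by (simp add: t_def mult.commute)
    qed
    show "((\<lambda>y::real. y / sqrt (1 + y\<^sup>2)) \<longlongrightarrow> 1) at_top" by real_asymp
  qed (use p in \<open>auto simp: less_imp_le\<close>)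
  then show ?thesis
    by (subst nn_integral_even) auto
qed

section \<open>Asymptotics of the double coset count\<close>

lemma chord_mono: "w \<le> w' \<Longrightarrow> chord w \<le> chord w'"
  by (simp add: chord_def)

lemma chord_eq_0: "w \<le> 1 \<Longrightarrow> chord w = 0"
  by (simp add: chord_def max_absorb1)

section \<open>Finite sums over the representatives\<close>

context cusp_group
begin

abbreviation reps_below :: "real \<Rightarrow> mat2 set" where
  "reps_below x \<equiv> {A \<in> reps. A$2$1 < x}"

lemma nn_integral_reps:
  assumes "\<And>A. A \<in> reps \<Longrightarrow> x \<le> A$2$1 \<Longrightarrow> f A = 0" "\<And>A. A \<in> reps \<Longrightarrow> 0 \<le> f A"
  shows "(\<integral>\<^sup>+A. ennreal (f A) \<partial>count_space reps) = ennreal (\<Sum>A\<in>reps_below x. f A)"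
proof -
  have "(\<integral>\<^sup>+A. ennreal (f A) \<partial>count_space reps) = (\<Sum>A\<in>reps_below x. ennreal (f A))"
    using finite_reps assms(1) by (intro nn_integral_count_space') (auto simp: not_less)
  also have "\<dots> = ennreal (\<Sum>A\<in>reps_below x. f A)"
    using assms(2) by (intro sum_ennreal) auto
  finally show ?thesis .
qed

lemma chord_reps_eq_0:
  assumes "A \<in> reps" "sqrt u \<le> A$2$1"
  shows "chord (u / (A$2$1)\<^sup>2) = 0"
proof (rule chord_eq_0)
  have "u \<le> (A$2$1)\<^sup>2"
    using assms by (auto simp: reps_def intro: sqrt_le_D)
  then show "u / (A$2$1)\<^sup>2 \<le> 1" using assms by (auto simp: reps_def divide_le_eq)
qed

text \<open>Only the finitely many representatives with c < sqrt u contribute to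
  \<open>chord_sum u\<close>, so passing to reals is lossless for every u.\<close>

definition csum :: "real \<Rightarrow> real" where
  "csum u = enn2real (chord_sum u)"

lemma csum_eq: "ennreal (csum u) = chord_sum u"
  unfolding csum_def chord_sum_def
  by (subst (1 2) nn_integral_reps[where x = "sqrt u"]) (auto simp: chord_reps_eq_0 sum_nonneg)

lemma csum_nonneg [simp]: "0 \<le> csum u"
  by (simp add: csum_def)

lemma measurable_csum [measurable]: "csum \<in> borel_measurable borel"
  unfolding csum_def[abs_def] by measurable

lemma chord_sum_mono: "u \<le> u' \<Longrightarrow> chord_sum u \<le> chord_sum u'"
  unfolding chord_sum_def
  by (intro nn_integral_mono ennreal_leI chord_mono divide_right_mono) auto

lemma csum_mono: "u \<le> u' \<Longrightarrow> csum u \<le> csum u'"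
  using chord_sum_mono[of u u'] by (simp add: csum_eq[symmetric])

text \<open>On [X, Y) the increasing \<open>csum\<close> lies between its end values and 1 / u
  between 1 / Y and 1 / X. The increment is named \<open>d\<close> since finiteness of
  \<open>chord_integral\<close>, needed to subtract, is available only with the area.\<close>

lemma chord_integral_increment:
  assumes X: "1 \<le> X" "X \<le> Y"
  obtains d where "chord_integral Y = chord_integral X + d"
    "ennreal (csum X * ((Y - X) / Y)) \<le> d" "d \<le> ennreal (csum Y * ((Y - X) / X))"
proof -
  define d where "d = (\<integral>\<^sup>+u. chord_sum u * indicator {X..<Y} u * ennreal (1 / u) \<partial>lborel)"
  have "chord_integral Y = (\<integral>\<^sup>+u. chord_sum u * indicator {..<X} u * weight u
      + chord_sum u * indicator {X..<Y} u * ennreal (1 / u) \<partial>lborel)"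
    unfolding chord_integral_def using X by (intro nn_integral_cong) (auto split: split_indicator)
  then have 1: "chord_integral Y = chord_integral X + d"
    unfolding chord_integral_def d_def by (simp add: nn_integral_add)
  have "ennreal (csum X * ((Y - X) / Y)) = (\<integral>\<^sup>+u. ennreal (csum X * (1 / Y)) * indicator {X..<Y} u \<partial>lborel)"
    using X by (simp add: nn_integral_cmult_indicator ennreal_mult[symmetric])
  also have "\<dots> \<le> d"
    unfolding d_def
  proof (rule nn_integral_mono)
    fix u
    show "ennreal (csum X * (1 / Y)) * indicator {X..<Y} u \<le> chord_sum u * indicator {X..<Y} u * ennreal (1 / u)"
    proof (cases "u \<in> {X..<Y}")
      case True
      then have "csum X * (1 / Y) \<le> csum u * (1 / u)"
        using X by (intro mult_mono csum_mono divide_left_mono) auto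
      then have "ennreal (csum X * (1 / Y)) \<le> chord_sum u * ennreal (1 / u)"
        using True X unfolding csum_eq[symmetric] by (subst ennreal_mult[symmetric]) (auto intro: ennreal_leI)
      then show ?thesis using True by simp
    qed simp
  qed
  finally have 2: "ennreal (csum X * ((Y - X) / Y)) \<le> d" .
  have "d \<le> (\<integral>\<^sup>+u. ennreal (csum Y * (1 / X)) * indicator {X..<Y} u \<partial>lborel)"
    unfolding d_def
  proof (rule nn_integral_mono)
    fix u
    show "chord_sum u * indicator {X..<Y} u * ennreal (1 / u) \<le> ennreal (csum Y * (1 / X)) * indicator {X..<Y} u"
    proof (cases "u \<in> {X..<Y}")
      case True
      then have "csum u * (1 / u) \<le> csum Y * (1 / X)"
        using X by (intro mult_mono csum_mono divide_left_mono) auto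
      then have "chord_sum u * ennreal (1 / u) \<le> ennreal (csum Y * (1 / X))"
        using True X unfolding csum_eq[symmetric] by (subst ennreal_mult[symmetric]) (auto intro: ennreal_leI)
      then show ?thesis using True by simp
    qed simp
  qed
  also have "\<dots> = ennreal (csum Y * ((Y - X) / X))"
    using X by (simp add: nn_integral_cmult_indicator ennreal_mult[symmetric])
  finally have 3: "d \<le> ennreal (csum Y * ((Y - X) / X))" .
  show thesis by (rule that[OF 1 2 3])
qed

text \<open>This is the integral of N(t) / t^2 over 0 < t < x for the counting function N, as each c
  contributes the integral of 1 / t^2 from c to x; hence exponent 2 in the Tauberian step.\<close>

definition gap_sum :: "real \<Rightarrow> real" where
  "gap_sum x = (\<Sum>A\<in>reps_below x. 1 / A$2$1 - 1 / x)"

lemma gap_sum_increment: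
  assumes X: "1 \<le> X" "X \<le> Y"
  shows "real (card (reps_below X)) * ((Y - X) / Y\<^sup>2) \<le> gap_sum Y - gap_sum X"
    "gap_sum Y - gap_sum X \<le> real (card (reps_below Y)) * ((Y - X) / X\<^sup>2)"
proof -
  \<comment> \<open>Truncation at 0 lets the sums for X and Y run over the same index set.\<close>
  define f where "f x A = max 0 (1 / A$2$1 - 1 / x)" for x and A :: mat2
  have sub: "reps_below X \<subseteq> reps_below Y" using X by auto
  have pos: "A$2$1 > 0" if "A \<in> reps" for A using that by (simp add: reps_def)
  have J: "gap_sum x = (\<Sum>A\<in>reps_below Y. f x A)" if x: "1 \<le> x" "x \<le> Y" for x
  proof -
    have "gap_sum x = (\<Sum>A\<in>reps_below x. f x A)"
      unfolding gap_sum_def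
    proof (intro sum.cong refl)
      fix A assume "A \<in> reps_below x"
      then have "1 / x \<le> 1 / A$2$1" using pos x by (auto intro!: divide_left_mono)
      then show "1 / A$2$1 - 1 / x = f x A" by (simp add: f_def)
    qed
    also have "\<dots> = (\<Sum>A\<in>reps_below Y. f x A)"
    proof (rule sum.mono_neutral_left[OF finite_reps])
      show "\<forall>A\<in>reps_below Y - reps_below x. f x A = 0"
      proof
        fix A assume "A \<in> reps_below Y - reps_below x"
        then have "1 / A$2$1 \<le> 1 / x" using x by (auto intro!: divide_left_mono)
        then show "f x A = 0" by (simp add: f_def)
      qed
    qed (use x in auto)
    finally show ?thesis .
  qed
  have diff: "gap_sum Y - gap_sum X = (\<Sum>A\<in>reps_below Y. f Y A - f X A)"
    using J[of X] J[of Y] X by (simp add: sum_subtractf)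
  have XY: "1 / X - 1 / Y = (Y - X) / (X * Y)" using X by (simp add: diff_frac_eq)
  have q: "(Y - X) / Y\<^sup>2 \<le> (Y - X) / (X * Y)" "(Y - X) / (X * Y) \<le> (Y - X) / X\<^sup>2"
    unfolding power2_eq_square using X by (auto intro!: divide_left_mono mult_mono mult_pos_pos)
  have f_mono: "0 \<le> f Y A - f X A" for A
  proof -
    have "1 / Y \<le> 1 / X" using X by (intro divide_left_mono) auto
    then show ?thesis unfolding f_def by linarith
  qed
  have "real (card (reps_below X)) * ((Y - X) / Y\<^sup>2) = (\<Sum>A\<in>reps_below X. (Y - X) / Y\<^sup>2)" by simp
  also have "\<dots> \<le> (\<Sum>A\<in>reps_below X. f Y A - f X A)"
  proof (rule sum_mono)
    fix A assume A: "A \<in> reps_below X"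
    then have "1 / X \<le> 1 / A$2$1" "1 / Y \<le> 1 / A$2$1" using pos X by (auto intro!: divide_left_mono)
    then have "f Y A - f X A = 1 / X - 1 / Y" by (simp add: f_def)
    then show "(Y - X) / Y\<^sup>2 \<le> f Y A - f X A" using q XY by simp
  qed
  also have "\<dots> \<le> (\<Sum>A\<in>reps_below Y. f Y A - f X A)"
    by (rule sum_mono2[OF finite_reps sub]) (rule f_mono)
  finally show "real (card (reps_below X)) * ((Y - X) / Y\<^sup>2) \<le> gap_sum Y - gap_sum X" unfolding diff .
  have "(\<Sum>A\<in>reps_below Y. f Y A - f X A) \<le> (\<Sum>A\<in>reps_below Y. (Y - X) / X\<^sup>2)"
  proof (rule sum_mono)
    fix A
    have "1 / Y \<le> 1 / X" using X by (intro divide_left_mono) auto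
    then have "f Y A - f X A \<le> 1 / X - 1 / Y" unfolding f_def by (auto simp: max_def)
    then show "f Y A - f X A \<le> (Y - X) / X\<^sup>2" using q XY by simp
  qed
  also have "\<dots> = real (card (reps_below Y)) * ((Y - X) / X\<^sup>2)" by simp
  finally show "gap_sum Y - gap_sum X \<le> real (card (reps_below Y)) * ((Y - X) / X\<^sup>2)" unfolding diff .
qed

text \<open>The transform is applied to each representative with w = W / c^2 and gives 2 pi (sqrt W
  / c - 1), which is 2 pi sqrt W (1 / c - 1 / sqrt W), whenever c < sqrt W.\<close>

lemma integral_csum:
  assumes W: "W > 0"
  shows "(\<integral>y. csum (W / (1 + y\<^sup>2)) / sqrt (1 + y\<^sup>2) \<partial>lborel) = 2 * pi * (sqrt W * gap_sum (sqrt W))"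
proof -
  have p: "0 < 1 + y\<^sup>2" for y :: real by (smt (verit) zero_le_power2)
  have pos: "A$2$1 > 0" if "A \<in> reps" for A using that by (simp add: reps_def)
  have "(\<integral>\<^sup>+y. ennreal (csum (W / (1 + y\<^sup>2)) / sqrt (1 + y\<^sup>2)) \<partial>lborel)
     = (\<integral>\<^sup>+y. chord_sum (W / (1 + y\<^sup>2)) * ennreal (1 / sqrt (1 + y\<^sup>2)) \<partial>lborel)"
    using p by (intro nn_integral_cong) (simp add: csum_eq[symmetric] ennreal_mult[symmetric] less_imp_le)
  also have "\<dots> = (\<integral>\<^sup>+y. \<integral>\<^sup>+A. ennreal (chord (W / (1 + y\<^sup>2) / (A$2$1)\<^sup>2)) * ennreal (1 / sqrt (1 + y\<^sup>2)) \<partial>count_space reps \<partial>lborel)"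
    unfolding chord_sum_def by (simp add: nn_integral_multc)
  also have "\<dots> = (\<integral>\<^sup>+y. \<integral>\<^sup>+A. ennreal (chord (W / (A$2$1)\<^sup>2 / (1 + y\<^sup>2)) / sqrt (1 + y\<^sup>2)) \<partial>count_space reps \<partial>lborel)"
    using p by (intro nn_integral_cong) (simp add: ennreal_mult[symmetric] less_imp_le mult.commute)
  also have "\<dots> = (\<integral>\<^sup>+A. \<integral>\<^sup>+y. ennreal (chord (W / (A$2$1)\<^sup>2 / (1 + y\<^sup>2)) / sqrt (1 + y\<^sup>2)) \<partial>lborel \<partial>count_space reps)"
    by (rule nn_integral_count_space_nn_integral[OF countable_reps]) measurable
  also have "\<dots> = (\<integral>\<^sup>+A. ennreal (2 * pi * max 0 (sqrt (W / (A$2$1)\<^sup>2) - 1)) \<partial>count_space reps)"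
    by (simp only: nn_integral_chord_average)
  also have "\<dots> = (\<integral>\<^sup>+A. ennreal (2 * pi * max 0 (sqrt W / A$2$1 - 1)) \<partial>count_space reps)"
    using pos by (intro nn_integral_cong) (auto simp: real_sqrt_divide less_imp_le)
  also have "\<dots> = ennreal (\<Sum>A\<in>reps_below (sqrt W). 2 * pi * max 0 (sqrt W / A$2$1 - 1))"
    using pos by (intro nn_integral_reps) (auto simp: max_absorb1 divide_le_eq)
  also have "(\<Sum>A\<in>reps_below (sqrt W). 2 * pi * max 0 (sqrt W / A$2$1 - 1))
     = (\<Sum>A\<in>reps_below (sqrt W). 2 * pi * sqrt W * (1 / A$2$1 - 1 / sqrt W))"
    using pos W by (intro sum.cong refl) (auto simp: max_absorb2 le_divide_eq less_imp_le algebra_simps)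
  also have "\<dots> = 2 * pi * (sqrt W * gap_sum (sqrt W))"
    unfolding gap_sum_def by (simp add: sum_distrib_left mult.assoc)
  finally have eq: "(\<integral>\<^sup>+y. ennreal (csum (W / (1 + y\<^sup>2)) / sqrt (1 + y\<^sup>2)) \<partial>lborel) = ennreal (2 * pi * (sqrt W * gap_sum (sqrt W)))" .
  have "0 \<le> gap_sum (sqrt W)"
    unfolding gap_sum_def using pos W by (intro sum_nonneg) (auto intro!: divide_left_mono)
  then show ?thesis
    using p W by (subst integral_eq_nn_integral) (auto simp: eq less_imp_le)
qed

end

context cusp_lattice
begin

text \<open>First Tauberian step: \<open>chord_integral\<close> has density
  \<open>csum u / u\<close>, so the exponent is 1.\<close>

lemma csum_asymptotics:
  assumes k: "(chord_mean \<longlongrightarrow> k) at_top"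
  shows "((\<lambda>X. csum X / X) \<longlongrightarrow> k) at_top"
proof -
  have inc: "csum X * ((Y - X) / Y ^ 1) \<le> enn2real (chord_integral Y) - enn2real (chord_integral X) \<and>
      enn2real (chord_integral Y) - enn2real (chord_integral X) \<le> csum Y * ((Y - X) / X ^ 1)"
    if X: "1 \<le> X" "X \<le> Y" for X Y
  proof -
    obtain d where d: "chord_integral Y = chord_integral X + d"
      "ennreal (csum X * ((Y - X) / Y)) \<le> d" "d \<le> ennreal (csum Y * ((Y - X) / X))"
      using chord_integral_increment[OF X] by blast
    have fin: "chord_integral X < \<infinity>" by (rule chord_integral_finite[OF X(1)])
    have "d < \<infinity>" using d(3) by (simp add: order_le_less_trans)
    then obtain r where r: "d = ennreal r" "0 \<le> r" by (cases d) auto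
    have "enn2real (chord_integral Y) = enn2real (chord_integral X) + r"
      unfolding d(1) using fin r by (simp add: enn2real_plus)
    moreover have "csum X * ((Y - X) / Y) \<le> r" using d(2) r by (simp add: ennreal_le_iff)
    moreover have "r \<le> csum Y * ((Y - X) / X)"
    proof -
      have "0 \<le> csum Y * ((Y - X) / X)" using X by (intro mult_nonneg_nonneg divide_nonneg_nonneg) auto
      then show ?thesis using d(3) r by (simp add: ennreal_le_iff)
    qed
    ultimately show ?thesis by simp
  qed
  have "((\<lambda>X. enn2real (chord_integral X) / X) \<longlongrightarrow> k) at_top"
    using k by (simp add: chord_mean_def[abs_def])
  then have "((\<lambda>X. csum X / X ^ 1) \<longlongrightarrow> k) at_top"
    using inc by (intro monotone_tauberian[where I = "\<lambda>X. enn2real (chord_integral X)"]) auto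
  then show ?thesis by simp
qed

text \<open>Supplies the dominating function for the transform, hence must hold down to u = 0. Below
  c0^2 the sum is empty, between c0^2 and u0 monotonicity suffices, and beyond u0 the asymptotics
  apply.\<close>

lemma csum_linear_bound:
  assumes k: "(chord_mean \<longlongrightarrow> k) at_top"
  obtains C where "0 \<le> C" "\<And>u. 0 < u \<Longrightarrow> csum u \<le> C * u"
proof -
  obtain c0 where c0: "0 < c0" "c0 \<le> 1" "\<And>A. A \<in> \<Gamma> \<Longrightarrow> A$2$1 \<noteq> 0 \<Longrightarrow> c0 \<le> \<bar>A$2$1\<bar>"
    using lower_left_lower_bound by blast
  have "\<forall>\<^sub>F u in at_top. csum u / u < k + 1"
    using csum_asymptotics[OF k] by (simp add: order_tendsto_iff)
  then obtain u0 where u0: "\<And>u. u \<ge> u0 \<Longrightarrow> csum u / u < k + 1"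
    by (auto simp: eventually_at_top_linorder)
  define C where "C = max (\<bar>k\<bar> + 1) (csum u0 / c0\<^sup>2)"
  have C: "0 \<le> C" "k + 1 \<le> C" "csum u0 / c0\<^sup>2 \<le> C" unfolding C_def by auto
  have "csum u \<le> C * u" if u: "0 < u" for u
  proof -
    consider "u < c0\<^sup>2" | "c0\<^sup>2 \<le> u" "u \<le> u0" | "u0 \<le> u" by linarith
    then show ?thesis
    proof cases
      case 1
      have "chord_sum u = (\<integral>\<^sup>+A. 0 \<partial>count_space reps)"
        unfolding chord_sum_def
      proof (rule nn_integral_cong)
        fix A assume "A \<in> space (count_space reps)"
        then have A: "A \<in> reps" "c0 \<le> A$2$1" using c0(3)[of A] by (auto simp: reps_def)
        have "sqrt u \<le> c0" using 1 c0 by (intro real_le_lsqrt) auto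
        then show "ennreal (chord (u / (A$2$1)\<^sup>2)) = 0" using A chord_reps_eq_0[of A u] by simp
      qed
      then show ?thesis using C u by (simp add: csum_def)
    next
      case 2
      have "csum u \<le> csum u0 / c0\<^sup>2 * c0\<^sup>2" using csum_mono[OF 2(2)] c0 by simp
      also have "\<dots> \<le> C * u" using C 2 by (intro mult_mono) auto
      finally show ?thesis .
    next
      case 3
      then have "csum u < (k + 1) * u" using u0[OF 3] u by (simp add: divide_less_eq)
      also have "\<dots> \<le> C * u" using C u by (intro mult_right_mono) auto
      finally show ?thesis by simp
    qed
  qed
  then show thesis using that C by blast
qed

text \<open>Dominated convergence puts the asymptotics of \<open>csum\<close> through the transform:
  divided by W it tends to 2 k, while \<open>integral_csum\<close> at W = X^2 evaluates it as 2 pi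
  times \<open>gap_sum X / X\<close>.\<close>

lemma gap_sum_asymptotics:
  assumes k: "(chord_mean \<longlongrightarrow> k) at_top"
  shows "((\<lambda>X. gap_sum X / X) \<longlongrightarrow> k / pi) at_top"
proof -
  let ?g = "\<lambda>y::real. 1 / ((1 + y\<^sup>2) * sqrt (1 + y\<^sup>2))"
  let ?f = "\<lambda>W y. csum (W / (1 + y\<^sup>2)) / sqrt (1 + y\<^sup>2) / W"
  have p: "0 < 1 + y\<^sup>2" for y :: real by (smt (verit) zero_le_power2)
  obtain C where C: "0 \<le> C" "\<And>u. 0 < u \<Longrightarrow> csum u \<le> C * u"
    using csum_linear_bound[OF k] by blast
  have "((\<lambda>W. \<integral>y. ?f W y \<partial>lborel)
      \<longlongrightarrow> (\<integral>y. k * ?g y \<partial>lborel)) at_top"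
  proof (rule integral_dominated_convergence_at_top[where w = "\<lambda>y. C * ?g y"])
    have "integrable lborel (\<lambda>y::real. 1 / ((1 + y\<^sup>2) * sqrt (1 + y\<^sup>2)))"
      using p by (intro integrableI_nonneg) (auto simp: integral_one_plus_square_three_halves less_imp_le)
    then show "integrable lborel (\<lambda>y::real. C * ?g y)"
      by (rule integrable_mult_right)
    show "\<forall>\<^sub>F W in at_top. AE y in lborel. norm (?f W y) \<le> C * ?g y"
      using eventually_gt_at_top[of 0]
    proof eventually_elim
      case (elim W)
      show ?case
      proof (rule AE_I2)
        fix y :: real
        have "?f W y \<le> C * (W / (1 + y\<^sup>2)) / sqrt (1 + y\<^sup>2) / W"
          using elim p[of y] by (intro divide_right_mono C) auto
        also have "\<dots> = C * ?g y" using elim by simp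
        finally show "norm (?f W y) \<le> C * ?g y"
          using elim p[of y] by (simp add: less_imp_le)
      qed
    qed
    show "AE y in lborel. ((\<lambda>W. ?f W y) \<longlongrightarrow> k * ?g y) at_top"
    proof (rule AE_I2)
      fix y :: real
      have "filterlim (\<lambda>W. 1 / (1 + y\<^sup>2) * W) at_top at_top"
        using p[of y] by (intro filterlim_tendsto_pos_mult_at_top[OF tendsto_const _ filterlim_ident]) auto
      then have "((\<lambda>W. csum (1 / (1 + y\<^sup>2) * W) / (1 / (1 + y\<^sup>2) * W)) \<longlongrightarrow> k) at_top"
        by (rule filterlim_compose[OF csum_asymptotics[OF k]])
      then have "((\<lambda>W. csum (1 / (1 + y\<^sup>2) * W) / (1 / (1 + y\<^sup>2) * W) * ?g y)
          \<longlongrightarrow> k * ?g y) at_top"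
        by (intro tendsto_intros)
      moreover have "csum (1 / (1 + y\<^sup>2) * W) / (1 / (1 + y\<^sup>2) * W) * ?g y
          = ?f W y" for W
      proof -
        have "a / (1 / q * W) * (1 / (q * t)) = a / t / W" if "q \<noteq> 0" for a q t :: real
          using that by (simp add: field_simps)
        then show ?thesis using p[of y] by simp
      qed
      ultimately show "((\<lambda>W. ?f W y) \<longlongrightarrow> k * ?g y) at_top"
        by simp
    qed
  qed auto
  also have "(\<integral>y. k * ?g y \<partial>lborel) = k * 2"
  proof -
    have "(\<integral>y. 1 / ((1 + y\<^sup>2) * sqrt (1 + y\<^sup>2)) \<partial>lborel) = (2::real)"
      using p by (subst integral_eq_nn_integral) (auto simp: integral_one_plus_square_three_halves less_imp_le)
    then show ?thesis by (subst integral_mult_right_zero) simp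
  qed
  finally have lim: "((\<lambda>W. \<integral>y. ?f W y \<partial>lborel) \<longlongrightarrow> k * 2) at_top" .
  have "filterlim (\<lambda>X::real. X\<^sup>2) at_top at_top" by real_asymp
  from filterlim_compose[OF lim this]
  have "((\<lambda>X. (\<integral>y. ?f (X\<^sup>2) y \<partial>lborel) / (2 * pi)) \<longlongrightarrow> k * 2 / (2 * pi)) at_top"
    by (intro tendsto_intros) auto
  moreover have "\<forall>\<^sub>F X in at_top. (\<integral>y. ?f (X\<^sup>2) y \<partial>lborel) / (2 * pi) = gap_sum X / X"
    using eventually_gt_at_top[of 0]
  proof eventually_elim
    case (elim X)
    have "(\<integral>y. ?f (X\<^sup>2) y \<partial>lborel) = (\<integral>y. csum (X\<^sup>2 / (1 + y\<^sup>2)) / sqrt (1 + y\<^sup>2) \<partial>lborel) / X\<^sup>2"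
      by (rule integral_divide_zero)
    also have "\<dots> = 2 * pi * (X * gap_sum X) / X\<^sup>2"
      using elim by (subst integral_csum) auto
    finally show ?case using elim by (simp add: power2_eq_square)
  qed
  ultimately have "((\<lambda>X. gap_sum X / X) \<longlongrightarrow> k * 2 / (2 * pi)) at_top"
    by (rule Lim_transform_eventually)
  then show ?thesis by simp
qed

lemma double_coset_count_asymptotics:
  "measure hyperbolic_area F > 0"
  "((\<lambda>x. real (double_coset_count \<Gamma> x) / x\<^sup>2) \<longlongrightarrow> 1 / (pi * measure hyperbolic_area F)) at_top"
proof -
  obtain k where k: "(chord_mean \<longlongrightarrow> k) at_top" by (rule chord_mean_converges)
  have "k * measure quot UNIV = 1" by (rule limit_times_area[OF k])
  moreover have "measure quot UNIV = measure hyperbolic_area F"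
    by (simp add: measure_def emeasure_quot)
  ultimately have V: "k * measure hyperbolic_area F = 1" by simp
  then show pos: "measure hyperbolic_area F > 0"
    using measure_nonneg[of hyperbolic_area F] by (auto simp: less_le)
  have "((\<lambda>X. real (card (reps_below X)) / X\<^sup>2) \<longlongrightarrow> k / pi) at_top"
    by (intro monotone_tauberian[OF gap_sum_increment gap_sum_asymptotics[OF k]])
  moreover have "k / pi = 1 / (pi * measure hyperbolic_area F)"
    using V pos by (simp add: field_simps)
  ultimately show "((\<lambda>x. real (double_coset_count \<Gamma> x) / x\<^sup>2) \<longlongrightarrow> 1 / (pi * measure hyperbolic_area F)) at_top"
    by (simp add: double_coset_count_eq)
qed

end

theorem theorem2:
  fixes \<Gamma> :: "mat2 set"
  assumes "lattice_SL2R \<Gamma>"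
    and "\<not> cocompact \<Gamma>"
    and "cusp_at_infinity \<Gamma>"
    and "stabilizer_infinity \<Gamma> =
           range (\<lambda>m::int. translation_matrix (of_int m)) \<union>
           range (\<lambda>m::int. - translation_matrix (of_int m))"
  shows "(\<forall>x>0. finite (counted_double_cosets \<Gamma> x)) \<and>
         (\<lambda>x::real. real (double_coset_count \<Gamma> x)) \<sim>[at_top]
           (\<lambda>x. x\<^sup>2 / (pi * enn2real (covolume \<Gamma>)))"
proof -
  interpret cusp_group \<Gamma>
    by (rule cusp_group.intro) (use assms in \<open>auto simp: lattice_SL2R_def\<close>)
  have "covolume \<Gamma> < \<infinity>" using assms(1) by (simp add: lattice_SL2R_def)
  then obtain F where F: "fundamental_domain \<Gamma> F" "emeasure hyperbolic_area F < \<infinity>"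
    unfolding covolume_def by (auto simp: INF_less_iff)
  interpret F: cusp_lattice \<Gamma> F by unfold_locales (use F in auto)
  let ?V = "measure hyperbolic_area F"
  \<comment> \<open>Independence of the fundamental domain comes out of the asymptotics: the double
    coset count does not mention F, yet its limit determines the area. So every domain of finite
    area has the area of F, and the infimum defining \<open>covolume\<close> is attained at
    F.\<close>
  have "emeasure hyperbolic_area F \<le> emeasure hyperbolic_area G" if G: "fundamental_domain \<Gamma> G" for G
  proof (cases "emeasure hyperbolic_area G < \<infinity>")
    case True
    interpret G: cusp_lattice \<Gamma> G by unfold_locales (use G True in auto)
    have "1 / (pi * ?V) = 1 / (pi * measure hyperbolic_area G)"
      by (rule tendsto_unique[OF _ F.double_coset_count_asymptotics(2) G.double_coset_count_asymptotics(2)]) simp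
    then have "?V = measure hyperbolic_area G"
      using F.double_coset_count_asymptotics(1) G.double_coset_count_asymptotics(1) by simp
    then show ?thesis
      using F(2) True by (simp add: emeasure_eq_ennreal_measure)
  qed (simp add: not_less top_unique)
  then have "covolume \<Gamma> = emeasure hyperbolic_area F"
    unfolding covolume_def using F by (intro antisym INF_lower INF_greatest) auto
  then have covol: "enn2real (covolume \<Gamma>) = ?V" by (simp add: measure_def)
  have "(\<lambda>x::real. real (double_coset_count \<Gamma> x)) \<sim>[at_top] (\<lambda>x. x\<^sup>2 / (pi * ?V))"
  proof (rule asymp_equivI')
    have "((\<lambda>x. real (double_coset_count \<Gamma> x) / x\<^sup>2 * (pi * ?V)) \<longlongrightarrow> 1 / (pi * ?V) * (pi * ?V)) at_top"
      by (intro tendsto_mult F.double_coset_count_asymptotics tendsto_const)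
    then show "((\<lambda>x. real (double_coset_count \<Gamma> x) / (x\<^sup>2 / (pi * ?V))) \<longlongrightarrow> 1) at_top"
      using F.double_coset_count_asymptotics(1) by simp
  qed
  then show ?thesis using finite_counted_double_cosets covol by simp
qed

end
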